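(* Let $\Gamma=\Gamma_{t^2}$. For all primes $p$, $\zeta^{\wedge}_{\Gamma,p}(s)=W_{t^2}(p,p^{-s})$, where $$W_{t^2}(X,Y)=\frac{1+X^{10}Y^4}{(1-X^8Y^3)(1-X^{11}Y^4)(1-X^{12}Y^5)}.$$ Thus $\zeta^{\wedge}_{\Gamma,p}(s)$ has abscissa of convergence $11/4$ and satisfies the functional equation $$\zeta^{\wedge}_{\Gamma,p}(s)\big|_{p\to p^{-1}}=(-1)\,p^{21-8s}\,\zeta^{\wedge}_{\Gamma,p}(s).$$
   Context: $\Gamma_{t^2}$ is the group $\langle x_1,x_2,y_1,y_2,z_1,z_2\mid [x_1,y_1]=[x_2,y_2]=z_1,\ [x_1,y_2]=z_2,\ [x_2,y_1]=1,\ [x_i,x_j]=[y_i,y_j]=[x_i,z_j]=[y_i,z_j]=[z_1,z_2]=1\ (1\le i,j\le 2)\rangle$, a torsion-free class-two nilpotent group of Hirsch length $6$. For a finitely generated nilpotent group $\Gamma$, let $a_n^\wedge(\Gamma)$ be the number of subgroups $\Delta\le\Gamma$ with $|\Gamma:\Delta|=n$ and $\widehat\Delta\cong\widehat\Gamma$, where $\widehat{\ }$ denotes profinite completion. For a prime $p$, the local pro-isomorphic zeta function is $\zeta^\wedge_{\Gamma,p}(s)=\sum_{k=0}^\infty a^\wedge_{p^k}(\Gamma)\,p^{-ks}$. If $\zeta^\wedge_{\Gamma,p}(s)=W(p,p^{-s})$ with $W\in\mathbb{Q}(X,Y)$ for all $p$, then $\zeta^\wedge_{\Gamma,p}(s)|_{p\to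 p^{-1}}$ means $W(p^{-1},p^{s})$. *)

theory Defs
  imports
    "HOL-Analysis.Analysis"
    "HOL-Algebra.Product_Groups"
    "HOL-Computational_Algebra.Computational_Algebra"
begin

section \<open>Groups given by generators and relations\<close>

text \<open>A letter \<open>(g, True)\<close> stands for the generator \<open>g\<close> and \<open>(g, False)\<close> for its inverse. A
  relation \<open>u = v\<close> is the pair \<open>(u, v)\<close>.\<close>

type_synonym 'a word = "('a \<times> bool) list"

definition gen_word :: "'a \<Rightarrow> 'a word" where
  "gen_word g = [(g, True)]"

definition inv_word :: "'a word \<Rightarrow> 'a word" where
  "inv_word w = rev (map (\<lambda>(g, e). (g, \<not> e)) w)"

definition comm_word :: "'a word \<Rightarrow> 'a word \<Rightarrow> 'a word" where
  "comm_word u v = inv_word u @ inv_word v @ u @ v"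

inductive pres_eq :: "('a word \<times> 'a word) set \<Rightarrow> 'a word \<Rightarrow> 'a word \<Rightarrow> bool"
  for R :: "('a word \<times> 'a word) set" where
  refl: "pres_eq R w w"
| sym: "pres_eq R u v \<Longrightarrow> pres_eq R v u"
| trans: "pres_eq R u v \<Longrightarrow> pres_eq R v w \<Longrightarrow> pres_eq R u w"
| cancel: "pres_eq R (a @ [(g, e), (g, \<not> e)] @ b) (a @ b)"
| rel: "(u, v) \<in> R \<Longrightarrow> pres_eq R (a @ u @ b) (a @ v @ b)"

definition pres_class :: "('a word \<times> 'a word) set \<Rightarrow> 'a word \<Rightarrow> 'a word set" where
  "pres_class R u = {v. pres_eq R u v}"

definition presented_group :: "('a word \<times> 'a word) set \<Rightarrow> 'a word set monoid" where
  "presented_group R =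
     \<lparr>carrier = range (pres_class R),
      monoid.mult = (\<lambda>A B. \<Union>a\<in>A. \<Union>b\<in>B. pres_class R (a @ b)),
      one = pres_class R []\<rparr>"

lemma pres_class_eq_iff: "pres_class R u = pres_class R v \<longleftrightarrow> pres_eq R u v"
proof
  assume "pres_class R u = pres_class R v"
  moreover have "v \<in> pres_class R v" by (simp add: pres_class_def pres_eq.refl)
  ultimately show "pres_eq R u v" by (auto simp: pres_class_def)
next
  assume "pres_eq R u v"
  then have "pres_eq R u w \<longleftrightarrow> pres_eq R v w" for w
    by (metis pres_eq.sym pres_eq.trans)
  then show "pres_class R u = pres_class R v" by (simp add: pres_class_def)
qed

lemma pres_eq_append_left: "pres_eq R u v \<Longrightarrow> pres_eq R (w @ u) (w @ v)"
proof (induction rule: pres_eq.induct)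
  case (cancel a g e b)
  then show ?case using pres_eq.cancel[of R "w @ a" g e b] by simp
next
  case (rel u v a b)
  then show ?case using pres_eq.rel[of u v R "w @ a" b] by simp
qed (erule (1) pres_eq.trans | rule pres_eq.refl | erule pres_eq.sym)+

lemma pres_eq_append_right: "pres_eq R u v \<Longrightarrow> pres_eq R (u @ w) (v @ w)"
proof (induction rule: pres_eq.induct)
  case (cancel a g e b)
  then show ?case using pres_eq.cancel[of R a g e "b @ w"] by simp
next
  case (rel u v a b)
  then show ?case using pres_eq.rel[of u v R a "b @ w"] by simp
qed (erule (1) pres_eq.trans | rule pres_eq.refl | erule pres_eq.sym)+

lemma pres_class_mult:
  "pres_class R u \<otimes>\<^bsub>presented_group R\<^esub> pres_class R v = pres_class R (u @ v)"
proof -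
  have "pres_class R (a @ b) = pres_class R (u @ v)"
    if "pres_eq R u a" "pres_eq R v b" for a b
    using pres_eq.trans[OF pres_eq_append_right[OF that(1)] pres_eq_append_left[OF that(2)]]
    by (simp add: pres_class_eq_iff pres_eq.sym)
  moreover have "u \<in> pres_class R u" "v \<in> pres_class R v"
    by (auto simp: pres_class_def intro: pres_eq.refl)
  ultimately have "(\<Union>a\<in>pres_class R u. \<Union>b\<in>pres_class R v. pres_class R (a @ b)) =
      pres_class R (u @ v)"
    unfolding pres_class_def[of R u] pres_class_def[of R v] by blast
  then show ?thesis by (simp add: presented_group_def)
qed

lemma pres_eq_inv_word: "pres_eq R (inv_word w @ w) []"
proof (induction w)
  case Nil
  then show ?case by (simp add: inv_word_def pres_eq.refl)
next
  case (Cons l w)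
  obtain g e where l: "l = (g, e)" by force
  have "pres_eq R (inv_word (l # w) @ l # w) (inv_word w @ w)"
    using pres_eq.cancel[of R "inv_word w" g "\<not> e" w] by (simp add: inv_word_def l)
  then show ?case using Cons by (rule pres_eq.trans)
qed

lemma group_presented_group: "group (presented_group R)"
proof (rule groupI)
  fix x assume "x \<in> carrier (presented_group R)"
  then obtain u where x: "x = pres_class R u" by (auto simp: presented_group_def)
  have "pres_class R (inv_word u) \<otimes>\<^bsub>presented_group R\<^esub> x = \<one>\<^bsub>presented_group R\<^esub>"
    unfolding x pres_class_mult using pres_eq_inv_word
    by (simp add: presented_group_def pres_class_eq_iff)
  then show "\<exists>y\<in>carrier (presented_group R). y \<otimes>\<^bsub>presented_group R\<^esub> x = \<one>\<^bsub>presented_group R\<^esub>"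
    by (auto simp: presented_group_def)
next
  have c: "carrier (presented_group R) = range (pres_class R)"
    and o: "\<one>\<^bsub>presented_group R\<^esub> = pres_class R []"
    by (simp_all add: presented_group_def)
  show "\<one>\<^bsub>presented_group R\<^esub> \<in> carrier (presented_group R)"
    by (simp add: c o)
  show "x \<otimes>\<^bsub>presented_group R\<^esub> y \<in> carrier (presented_group R)"
    if "x \<in> carrier (presented_group R)" "y \<in> carrier (presented_group R)" for x y
    using that by (auto simp: c pres_class_mult)
  show "x \<otimes>\<^bsub>presented_group R\<^esub> y \<otimes>\<^bsub>presented_group R\<^esub> z =
      x \<otimes>\<^bsub>presented_group R\<^esub> (y \<otimes>\<^bsub>presented_group R\<^esub> z)"
    if "x \<in> carrier (presented_group R)" "y \<in> carrier (presented_group R)"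
      "z \<in> carrier (presented_group R)" for x y z
    using that by (auto simp: c pres_class_mult)
  show "\<one>\<^bsub>presented_group R\<^esub> \<otimes>\<^bsub>presented_group R\<^esub> x = x"
    if "x \<in> carrier (presented_group R)" for x
    using that by (auto simp: c o pres_class_mult)
qed


section \<open>The group \<open>\<Gamma>\<close> attached to \<open>t\<^sup>2\<close>\<close>

datatype gen_t2 = GX1 | GX2 | GY1 | GY2 | GZ1 | GZ2

definition comm_t2 :: "gen_t2 \<Rightarrow> gen_t2 \<Rightarrow> gen_t2 word" where
  "comm_t2 g h = comm_word (gen_word g) (gen_word h)"

definition rels_t2 :: "(gen_t2 word \<times> gen_t2 word) set" where
  "rels_t2 =
     {(comm_t2 GX1 GY1, gen_word GZ1), (comm_t2 GX2 GY2, gen_word GZ1),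
      (comm_t2 GX1 GY2, gen_word GZ2), (comm_t2 GX2 GY1, [])}
     \<union> {(comm_t2 g h, []) | g h. g \<in> {GX1, GX2} \<and> h \<in> {GX1, GX2}}
     \<union> {(comm_t2 g h, []) | g h. g \<in> {GY1, GY2} \<and> h \<in> {GY1, GY2}}
     \<union> {(comm_t2 g h, []) | g h. g \<in> {GX1, GX2} \<and> h \<in> {GZ1, GZ2}}
     \<union> {(comm_t2 g h, []) | g h. g \<in> {GY1, GY2} \<and> h \<in> {GZ1, GZ2}}
     \<union> {(comm_t2 GZ1 GZ2, [])}"

definition Gamma_t2 :: "gen_t2 word set monoid" where
  "Gamma_t2 = presented_group rels_t2"


section \<open>Profinite completion\<close>

definition finite_index_normal :: "('a, 'b) monoid_scheme \<Rightarrow> 'a set set" where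
  "finite_index_normal G = {N. N \<lhd> G \<and> finite (rcosets\<^bsub>G\<^esub> N)}"

text \<open>The inverse limit of the quotients \<open>G Mod N\<close>. The projection from \<open>G Mod N\<close> to \<open>G Mod M\<close> sends
  a coset of \<open>N\<close> to the unique coset of \<open>M\<close> containing it.\<close>

definition profinite_completion :: "('a, 'b) monoid_scheme \<Rightarrow> ('a set \<Rightarrow> 'a set) monoid" where
  "profinite_completion G =
     (product_group (finite_index_normal G) (\<lambda>N. G Mod N))
       \<lparr>carrier := {f \<in> (\<Pi>\<^sub>E N\<in>finite_index_normal G. carrier (G Mod N)).
          \<forall>N\<in>finite_index_normal G. \<forall>M\<in>finite_index_normal G. N \<subseteq> M \<longrightarrow> f N \<subseteq> f M}\<rparr>"

definition profinite_topology :: "('a, 'b) monoid_scheme \<Rightarrow> ('a set \<Rightarrow> 'a set) topology" where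
  "profinite_topology G =
     subtopology
       (product_topology (\<lambda>N. discrete_topology (carrier (G Mod N))) (finite_index_normal G))
       (carrier (profinite_completion G))"

text \<open>Isomorphism of the completions as topological groups.\<close>

definition profinite_completions_iso ::
    "('a, 'c) monoid_scheme \<Rightarrow> ('b, 'd) monoid_scheme \<Rightarrow> bool" where
  "profinite_completions_iso G H \<longleftrightarrow>
     (\<exists>\<phi>. \<phi> \<in> iso (profinite_completion G) (profinite_completion H) \<and>
          homeomorphic_map (profinite_topology G) (profinite_topology H) \<phi>)"


section \<open>Local pro-isomorphic zeta functions\<close>

text \<open>Only meant for \<open>n \<ge> 1\<close>: the library gives infinite sets the cardinality \<open>0\<close>.\<close>

definition pro_iso_count :: "('a, 'b) monoid_scheme \<Rightarrow> nat \<Rightarrow> nat" where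
  "pro_iso_count G n =
     card {D. subgroup D G \<and> card (rcosets\<^bsub>G\<^esub> D) = n \<and>
              profinite_completions_iso (G\<lparr>carrier := D\<rparr>) G}"

definition local_zeta_term :: "('a, 'b) monoid_scheme \<Rightarrow> nat \<Rightarrow> complex \<Rightarrow> nat \<Rightarrow> complex" where
  "local_zeta_term G p s k =
     of_nat (pro_iso_count G (p ^ k)) * of_nat p powr (- (of_nat k * s))"

definition local_zeta :: "('a, 'b) monoid_scheme \<Rightarrow> nat \<Rightarrow> complex \<Rightarrow> complex" where
  "local_zeta G p s = suminf (local_zeta_term G p s)"

definition local_zeta_abscissa :: "('a, 'b) monoid_scheme \<Rightarrow> nat \<Rightarrow> ereal" where
  "local_zeta_abscissa G p = (INF s\<in>{s. summable (local_zeta_term G p s)}. ereal (Re s))"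


section \<open>Rational functions in two variables over the rationals\<close>

text \<open>\<open>rat poly poly fract\<close> is the field \<open>\<rat>(X, Y)\<close>: the inner polynomials are in \<open>X\<close>, the outer
  ones in \<open>Y\<close>.\<close>

type_synonym ratfun2 = "rat poly poly fract"

definition RX :: ratfun2 where "RX = Fraction_Field.Fract [:[:0, 1:]:] 1"
definition RY :: ratfun2 where "RY = Fraction_Field.Fract [:0, 1:] 1"

definition poly2_eval :: "rat poly poly \<Rightarrow> complex \<Rightarrow> complex \<Rightarrow> complex" where
  "poly2_eval a x y = poly (map_poly (\<lambda>c. poly (map_poly of_rat c) x) a) y"

definition ratfun_regular :: "ratfun2 \<Rightarrow> complex \<Rightarrow> complex \<Rightarrow> bool" where
  "ratfun_regular W x y \<longleftrightarrow> (\<exists>a b. W = Fraction_Field.Fract a b \<and> poly2_eval b x y \<noteq> 0)"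

definition ratfun_eval :: "ratfun2 \<Rightarrow> complex \<Rightarrow> complex \<Rightarrow> complex" where
  "ratfun_eval W x y =
     (THE v. \<exists>a b. W = Fraction_Field.Fract a b \<and> poly2_eval b x y \<noteq> 0 \<and>
                   v = poly2_eval a x y / poly2_eval b x y)"

lemma poly2_eval_0 [simp]: "poly2_eval 0 x y = 0"
  by (simp add: poly2_eval_def)

lemma poly2_eval_pCons:
  "poly2_eval (pCons c a) x y = poly (map_poly of_rat c) x + y * poly2_eval a x y"
  by (simp add: poly2_eval_def map_poly_pCons)

lemma of_rat_poly_add:
  "map_poly (of_rat :: rat \<Rightarrow> complex) (a + b) = map_poly of_rat a + map_poly of_rat b"
  by (rule poly_eqI) (simp add: coeff_map_poly of_rat_add)

lemma of_rat_poly_mult: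
  "map_poly (of_rat :: rat \<Rightarrow> complex) (a * b) = map_poly of_rat a * map_poly of_rat b"
  by (rule poly_eqI) (simp add: coeff_map_poly coeff_mult of_rat_sum of_rat_mult)

lemma poly2_eval_add: "poly2_eval (a + b) x y = poly2_eval a x y + poly2_eval b x y"
proof (induction a b rule: poly_induct2)
  case (pCons c a d b)
  then show ?case by (simp add: poly2_eval_pCons of_rat_poly_add algebra_simps)
qed simp

lemma poly2_eval_smult:
  "poly2_eval (Polynomial.smult c a) x y = poly (map_poly of_rat c) x * poly2_eval a x y"
  by (induction a) (simp_all add: poly2_eval_pCons of_rat_poly_mult algebra_simps)

lemma poly2_eval_mult: "poly2_eval (a * b) x y = poly2_eval a x y * poly2_eval b x y"
proof (induction a)
  case (pCons c a)
  then show ?case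
    by (simp add: poly2_eval_pCons poly2_eval_add poly2_eval_smult algebra_simps)
qed simp

lemma ratfun_eval_Fract:
  assumes "poly2_eval b x y \<noteq> 0"
  shows "ratfun_eval (Fraction_Field.Fract a b) x y = poly2_eval a x y / poly2_eval b x y"
  unfolding ratfun_eval_def
proof (rule the_equality)
  fix v assume "\<exists>c d. Fraction_Field.Fract a b = Fraction_Field.Fract c d \<and>
    poly2_eval d x y \<noteq> 0 \<and> v = poly2_eval c x y / poly2_eval d x y"
  then obtain c d where cd: "Fraction_Field.Fract a b = Fraction_Field.Fract c d"
    "poly2_eval d x y \<noteq> 0" "v = poly2_eval c x y / poly2_eval d x y" by blast
  from assms cd have "b \<noteq> 0" "d \<noteq> 0" by auto
  with cd have "a * d = c * b" by (simp add: Fraction_Field.eq_fract)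
  then have "poly2_eval a x y * poly2_eval d x y = poly2_eval c x y * poly2_eval b x y"
    by (metis poly2_eval_mult)
  then show "v = poly2_eval a x y / poly2_eval b x y"
    unfolding cd(3) using assms cd(2) by (simp add: frac_eq_eq)
qed (use assms in blast)

definition W_t2 :: ratfun2 where
  "W_t2 = (1 + RX ^ 10 * RY ^ 4) /
          ((1 - RX ^ 8 * RY ^ 3) * (1 - RX ^ 11 * RY ^ 4) * (1 - RX ^ 12 * RY ^ 5))"

text \<open>\<open>local_zeta_given_by G p W\<close>: the local zeta function of \<open>G\<close> at \<open>p\<close> is \<open>W(p, p\<^sup>-\<^sup>s)\<close>,
  as functions on the half-plane of convergence. The meromorphic continuation of the zeta function
  to the whole plane is then \<open>ratfun_eval W p (p\<^sup>-\<^sup>s)\<close>.\<close>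

definition local_zeta_given_by :: "('a, 'b) monoid_scheme \<Rightarrow> nat \<Rightarrow> ratfun2 \<Rightarrow> bool" where
  "local_zeta_given_by G p W \<longleftrightarrow>
     local_zeta_abscissa G p < \<infinity> \<and>
     (\<forall>s. ereal (Re s) > local_zeta_abscissa G p \<longrightarrow>
        ratfun_regular W (of_nat p) (of_nat p powr (- s)) \<and>
        local_zeta G p s = ratfun_eval W (of_nat p) (of_nat p powr (- s)))"

end

theory Submission
  imports Defs
begin

text \<open>Put \<open>R = \<int>[t]/(t\<^sup>2)\<close> and write \<open>\<epsilon>\<close> for the class of \<open>t\<close>. The presented group is the Heisenberg group
of \<open>R\<close>: pairs \<open>(v + \<epsilon> r, z)\<close> with \<open>v, r \<in> \<int>\<^sup>2\<close> and \<open>z \<in> R\<close>, whose commutator form is the \<open>R\<close>-bilinear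
determinant on \<open>R\<^sup>2\<close> (lemmas \<open>omega_eq\<close> and \<open>nf_in_iso\<close>). The vectors \<open>\<epsilon> r\<close> are exactly those whose
commutators all lie in \<open>\<epsilon> R\<close>, and the form pairs them perfectly with \<open>R\<^sup>2 / \<epsilon> R\<^sup>2\<close>.

For a subgroup \<open>D\<close> of finite index let \<open>\<Lambda>\<close> be its image in \<open>R\<^sup>2\<close>, \<open>M\<close> its intersection with the
centre, \<open>\<Lambda>\<^sub>0\<close> the image of \<open>\<Lambda>\<close> modulo \<open>\<epsilon>\<close> and \<open>\<Lambda>\<^sub>1 = {r. \<epsilon> r \<in> \<Lambda>}\<close>. The completions of \<open>D\<close> and of the whole
group are isomorphic if and only if the plane lattices \<open>\<Lambda>\<^sub>0\<close> and \<open>\<Lambda>\<^sub>1\<close> are homothetic and \<open>M\<close> is spanned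
by commutators. If the completions are isomorphic, then every finite quotient of the group, in
particular its reduction modulo any prime \<open>q\<close>, is a quotient of \<open>D\<close>. Such an epimorphism identifies
the commutator form of \<open>D\<close> modulo \<open>q\<close> with the standard one, so the pairing of \<open>\<Lambda>\<^sub>0\<close> with \<open>\<Lambda>\<^sub>1\<close> is perfect
modulo every prime, hence perfect, and a lattice paired perfectly with \<open>\<Lambda>\<^sub>0\<close> by a multiple of the
determinant is homothetic to \<open>\<Lambda>\<^sub>0\<close> (\<open>standard_form_if_locally\<close>). Conversely, homothetic lattices have
proportional bases, and lifts of these to \<open>D\<close> satisfy the defining relations, so that \<open>D\<close> is isomorphic
to the whole group already before completion (\<open>standard_form_iso\<close>).

It remains to count. Write \<open>\<Lambda>\<^sub>0 = u L\<close> and \<open>\<Lambda>\<^sub>1 = v L\<close> with a primitive lattice \<open>L\<close> of index \<open>N\<close>. There are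
\<open>(v\<^sup>2 N)\<^sup>2\<close> lattices \<open>\<Lambda>\<close> with these data; the commutators span a lattice \<open>M\<close> of index \<open>u\<^sup>3 v N\<^sup>2\<close>; and there
are \<open>(u\<^sup>3 v N\<^sup>2)\<^sup>4\<close> subgroups \<open>D\<close> over \<open>\<Lambda>\<close> and \<open>M\<close>, because such a \<open>D\<close> amounts to the choice, modulo \<open>M\<close>, of
lifts of four generators (\<open>card_subgroups_over\<close>). So \<open>u\<close>, \<open>v\<close>, \<open>L\<close> contribute \<open>u\<^bsup>12\<^esup> v\<^sup>8 N\<^bsup>10\<^esup>\<close> subgroups of
index \<open>u\<^sup>5 v\<^sup>3 N\<^sup>4\<close>. Since \<open>p\<^sup>m + p\<^bsup>m-1\<^esup>\<close> primitive lattices have index \<open>p\<^sup>m\<close>, \<open>m \<ge> 1\<close>, the local zeta function is a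
product of the geometric series in \<open>p\<^bsup>12\<^esup> y\<^sup>5\<close> and \<open>p\<^sup>8 y\<^sup>3\<close> and of the series
\<open>(1 + p\<^bsup>10\<^esup> y\<^sup>4) / (1 - p\<^bsup>11\<^esup> y\<^sup>4)\<close>, where \<open>y = p\<^sup>-\<^sup>s\<close>. The last denominator vanishes first as the real part of \<open>s\<close> decreases,
at \<open>11/4\<close>. A rational function is determined by its values on all these points \<open>(p, y)\<close>, and the
functional equation is read off from the explicit fraction.\<close>

section \<open>Profinite completions\<close>

lemma (in group) r_coset_Int:
  assumes "A \<subseteq> carrier G" "B \<subseteq> carrier G" "g \<in> carrier G"
  shows "(A \<inter> B) #> g = (A #> g) \<inter> (B #> g)"
  using assms unfolding r_coset_def by (auto simp: subset_iff)

lemma finite_index_normal_Int: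
  assumes "group G" "A \<in> finite_index_normal G" "B \<in> finite_index_normal G"
  shows "A \<inter> B \<in> finite_index_normal G"
proof -
  interpret group G by fact
  have A: "A \<lhd> G" "A \<subseteq> carrier G" and B: "B \<lhd> G" "B \<subseteq> carrier G"
    using assms by (auto simp: finite_index_normal_def dest: normal_imp_subgroup subgroup.subset)
  have "rcosets\<^bsub>G\<^esub> (A \<inter> B) \<subseteq> (\<lambda>(X, Y). X \<inter> Y) ` ((rcosets\<^bsub>G\<^esub> A) \<times> (rcosets\<^bsub>G\<^esub> B))"
    using r_coset_Int[OF A(2) B(2)] by (fastforce simp: RCOSETS_def)
  then have "finite (rcosets\<^bsub>G\<^esub> (A \<inter> B))"
    by (rule finite_subset) (use assms in \<open>auto simp: finite_index_normal_def\<close>)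
  then show ?thesis
    using normal_subgroup_intersect[OF A(1) B(1)] by (simp add: finite_index_normal_def)
qed

lemma finite_index_normal_carrier:
  assumes "group G"
  shows "carrier G \<in> finite_index_normal G"
proof -
  interpret group G by fact
  have "rcosets\<^bsub>G\<^esub> (carrier G) \<subseteq> {carrier G}"
    by (auto simp: RCOSETS_def)
      (metis coset_join2 subgroup_self group_axioms group.coset_join2)+
  then show ?thesis
    by (auto simp: finite_index_normal_def normal_self intro: finite_subset)
qed

lemma finite_index_normal_finite_inf:
  assumes "group G" "finite F" "F \<subseteq> finite_index_normal G"
  shows "\<exists>N\<in>finite_index_normal G. \<forall>M\<in>F. N \<subseteq> M"
  using assms(2,3)
proof (induction F)
  case empty
  then show ?case using finite_index_normal_carrier[OF assms(1)] by auto
next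
  case (insert M F)
  then obtain N where "N \<in> finite_index_normal G" "\<forall>M\<in>F. N \<subseteq> M" by auto
  then show ?case
    using insert finite_index_normal_Int[OF assms(1), of N M] by (intro bexI[of _ "N \<inter> M"]) auto
qed

definition completion_map :: "('a, 'b) monoid_scheme \<Rightarrow> 'a \<Rightarrow> 'a set \<Rightarrow> 'a set" where
  "completion_map G g = (\<lambda>N\<in>finite_index_normal G. N #>\<^bsub>G\<^esub> g)"

lemma carrier_profinite_completion:
  "carrier (profinite_completion G) =
     {f \<in> (\<Pi>\<^sub>E N\<in>finite_index_normal G. carrier (G Mod N)).
          \<forall>N\<in>finite_index_normal G. \<forall>M\<in>finite_index_normal G. N \<subseteq> M \<longrightarrow> f N \<subseteq> f M}"
  by (simp add: profinite_completion_def)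

lemma mult_profinite_completion:
  "x \<otimes>\<^bsub>profinite_completion G\<^esub> y = (\<lambda>N\<in>finite_index_normal G. x N <#>\<^bsub>G\<^esub> y N)"
  by (simp add: profinite_completion_def)

lemma completion_map_closed:
  assumes "g \<in> carrier G"
  shows "completion_map G g \<in> carrier (profinite_completion G)"
  using assms
  by (auto simp: carrier_profinite_completion completion_map_def carrier_FactGroup r_coset_def)

lemma completion_map_mult:
  assumes "g \<in> carrier G" "h \<in> carrier G"
  shows "completion_map G (g \<otimes>\<^bsub>G\<^esub> h) =
    completion_map G g \<otimes>\<^bsub>profinite_completion G\<^esub> completion_map G h"
  using assms unfolding mult_profinite_completion completion_map_def
  by (auto simp: finite_index_normal_def normal.rcos_sum intro!: restrict_ext)

lemma topspace_profinite_topology: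
  "topspace (profinite_topology G) = carrier (profinite_completion G)"
  by (auto simp: profinite_topology_def carrier_profinite_completion topspace_subtopology)

text \<open>A basic open set restricts only finitely many coordinates. These are all determined by the
coordinate at one common finite-index subgroup, and any representative of that coset does the job.\<close>

lemma completion_map_dense:
  assumes "group G" "openin (profinite_topology G) U" "x \<in> U"
  shows "\<exists>g\<in>carrier G. completion_map G g \<in> U"
proof -
  interpret group G by fact
  define I where "I = finite_index_normal G"
  obtain S where S: "openin (product_topology (\<lambda>N. discrete_topology (carrier (G Mod N))) I) S"
      and U: "U = S \<inter> carrier (profinite_completion G)"
    using assms(2) unfolding profinite_topology_def openin_subtopology I_def by auto
  have x: "x \<in> carrier (profinite_completion G)" "x \<in> S" using assms(3) U by auto
  obtain V where V: "finite {i \<in> I. V i \<noteq> carrier (G Mod i)}" "x \<in> Pi\<^sub>E I V" "Pi\<^sub>E I V \<subseteq> S"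
    using S x(2) unfolding openin_product_topology_alt by fastforce
  obtain N where N: "N \<in> I" "\<forall>M\<in>{i \<in> I. V i \<noteq> carrier (G Mod i)}. N \<subseteq> M"
    using finite_index_normal_finite_inf[OF assms(1) V(1)] by (auto simp: I_def)
  have "x N \<in> carrier (G Mod N)" using x N by (auto simp: carrier_profinite_completion I_def)
  then obtain g where g: "g \<in> carrier G" "x N = N #>\<^bsub>G\<^esub> g" by (auto simp: carrier_FactGroup)
  have gN: "g \<in> N #>\<^bsub>G\<^esub> g"
    using N(1) g(1) by (intro rcos_self) (auto simp: I_def finite_index_normal_def normal_imp_subgroup)
  have "completion_map G g i \<in> V i" if i: "i \<in> I" for i
  proof (cases "V i = carrier (G Mod i)")
    case True
    then show ?thesis using i g by (auto simp: completion_map_def carrier_FactGroup I_def)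
  next
    case False
    then have "N \<subseteq> i" using N i by auto
    then have "x N \<subseteq> x i" using x(1) N(1) i by (auto simp: carrier_profinite_completion I_def)
    then have "g \<in> x i" using gN g by auto
    have i': "subgroup i G" using i by (auto simp: I_def finite_index_normal_def normal_imp_subgroup)
    have "x i \<in> carrier (G Mod i)" using x i by (auto simp: carrier_profinite_completion I_def)
    then obtain h where h: "h \<in> carrier G" "x i = i #>\<^bsub>G\<^esub> h" by (auto simp: carrier_FactGroup)
    have "x i = i #>\<^bsub>G\<^esub> g"
      using repr_independence[OF _ h(1) i', of g] \<open>g \<in> x i\<close> h by simp
    moreover have "x i \<in> V i" using V(2) i by auto
    ultimately show ?thesis using i by (simp add: completion_map_def I_def)
  qed
  then have "completion_map G g \<in> Pi\<^sub>E I V" by (auto simp: completion_map_def I_def)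
  then show ?thesis using V(3) U completion_map_closed[OF g(1)] g(1) by auto
qed

text \<open>The topological isomorphism turns the projection of the completion of \<open>H\<close> onto \<open>Q\<close> into a continuous
surjection from the completion of \<open>G\<close>; by density \<open>G\<close> itself already meets each of its open fibres.\<close>

lemma finite_quotient_transfer:
  assumes "group G" "group H" "profinite_completions_iso G H"
    and "group Q" "finite (carrier Q)" "\<psi> \<in> hom H Q" "\<psi> ` carrier H = carrier Q"
  obtains f where "f \<in> hom G Q" "f ` carrier G = carrier Q"
proof -
  interpret H: group H by fact
  interpret \<psi>: group_hom H Q \<psi>
    using assms by (simp add: group_hom_def group_hom_axioms_def)
  define N where "N = kernel H Q \<psi>"
  obtain \<phi> where \<phi>: "\<phi> \<in> iso (profinite_completion G) (profinite_completion H)"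
    "homeomorphic_map (profinite_topology G) (profinite_topology H) \<phi>"
    using assms(3) by (auto simp: profinite_completions_iso_def)
  have QN: "(\<lambda>X. the_elem (\<psi> ` X)) \<in> iso (H Mod N) Q"
    using \<psi>.FactGroup_iso_set assms(7) by (simp add: N_def)
  have cHN: "carrier (H Mod N) = rcosets\<^bsub>H\<^esub> N" by (simp add: FactGroup_def)
  have "finite (rcosets\<^bsub>H\<^esub> N)"
    using QN assms(5) unfolding cHN[symmetric] iso_def by (auto dest: bij_betw_finite)
  then have N: "N \<in> finite_index_normal H"
    using \<psi>.normal_kernel by (simp add: finite_index_normal_def N_def)
  define F where "F = (\<lambda>g. \<phi> (completion_map G g) N)"
  have \<phi>c: "\<phi> x \<in> carrier (profinite_completion H)" if "x \<in> carrier (profinite_completion G)" for x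
    using \<phi>(1) that by (auto simp: iso_def hom_def)
  have F_closed: "F g \<in> carrier (H Mod N)" if "g \<in> carrier G" for g
    using \<phi>c[OF completion_map_closed[OF that]] N
    by (auto simp: carrier_profinite_completion F_def)
  have "F \<in> hom G (H Mod N)"
  proof (rule homI)
    fix g h assume gh: "g \<in> carrier G" "h \<in> carrier G"
    have "F (g \<otimes>\<^bsub>G\<^esub> h) = (\<phi> (completion_map G g) \<otimes>\<^bsub>profinite_completion H\<^esub> \<phi> (completion_map G h)) N"
      using \<phi>(1) gh completion_map_closed[of g G] completion_map_closed[of h G]
      by (simp add: F_def completion_map_mult iso_def hom_def)
    then show "F (g \<otimes>\<^bsub>G\<^esub> h) = F g \<otimes>\<^bsub>H Mod N\<^esub> F h"
      using N by (simp add: mult_profinite_completion F_def)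
  qed (use F_closed in auto)
  moreover have "F ` carrier G = carrier (H Mod N)"
  proof (intro equalityI subsetI)
    fix X assume X: "X \<in> carrier (H Mod N)"
    then obtain h where h: "h \<in> carrier H" "X = N #>\<^bsub>H\<^esub> h" by (auto simp: carrier_FactGroup)
    define y where "y = completion_map H h"
    have y: "y \<in> carrier (profinite_completion H)" "y N = X"
      using completion_map_closed[OF h(1)] h N by (auto simp: y_def completion_map_def)
    obtain x where x: "x \<in> carrier (profinite_completion G)" "\<phi> x = y"
      using \<phi>(1) y(1) by (force simp: iso_def bij_betw_def)
    have "continuous_map (profinite_topology G) (discrete_topology (carrier (H Mod N))) (\<lambda>x. \<phi> x N)"
    proof -
      have 1: "continuous_map (profinite_topology H) (discrete_topology (carrier (H Mod N))) (\<lambda>x. x N)"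
        unfolding profinite_topology_def
        by (intro continuous_map_from_subtopology continuous_map_product_projection N)
      show ?thesis
        using continuous_map_compose[OF homeomorphic_imp_continuous_map[OF \<phi>(2)] 1]
        by (simp add: o_def)
    qed
    then have "openin (profinite_topology G) {z \<in> topspace (profinite_topology G). \<phi> z N \<in> {X}}"
      by (rule openin_continuous_map_preimage) (use X in auto)
    moreover have "x \<in> {z \<in> topspace (profinite_topology G). \<phi> z N \<in> {X}}"
      using x y by (simp add: topspace_profinite_topology)
    ultimately obtain g where "g \<in> carrier G" "\<phi> (completion_map G g) N = X"
      using completion_map_dense[OF assms(1)] by (smt (verit) mem_Collect_eq singletonD)
    then show "X \<in> F ` carrier G" by (auto simp: F_def)
  qed (use F_closed in auto)
  ultimately have F: "F \<in> hom G (H Mod N)" "F ` carrier G = carrier (H Mod N)" by auto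
  define u where "u = (\<lambda>X. the_elem (\<psi> ` X))"
  have u: "u \<in> hom (H Mod N) Q" "u ` carrier (H Mod N) = carrier Q"
    using QN by (auto simp: iso_def bij_betw_def u_def)
  show thesis
  proof (rule that)
    show "u \<circ> F \<in> hom G Q" by (rule hom_compose[OF F(1) u(1)])
    show "(u \<circ> F) ` carrier G = carrier Q" by (simp only: image_comp[symmetric] F(2) u(2))
  qed
qed

lemma iso_image_rcosets:
  assumes "h \<in> iso G H" "S \<subseteq> carrier G"
  shows "rcosets\<^bsub>H\<^esub> (h ` S) = (`) h ` (rcosets\<^bsub>G\<^esub> S)"
proof -
  have "(h ` S) #>\<^bsub>H\<^esub> (h g) = h ` (S #>\<^bsub>G\<^esub> g)" if "g \<in> carrier G" for g
    using assms that
    by (auto simp: r_coset_def iso_def hom_def subset_iff image_UN)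
  moreover have "carrier H = h ` carrier G" using assms by (auto simp: iso_def bij_betw_def)
  ultimately show ?thesis by (auto simp: RCOSETS_def)
qed

lemma iso_image_finite_index_normal:
  assumes "group G" "group H" "h \<in> iso G H" "N \<in> finite_index_normal G"
  shows "h ` N \<in> finite_index_normal H"
  using assms iso_normal_subgroup[of h G H N] iso_image_rcosets[of h G H N]
    subgroup.subset[OF normal_imp_subgroup, of N G]
  by (simp add: finite_index_normal_def)

text \<open>Two isomorphisms inverse to each other are carried along explicitly, so that the map induced on
completions and its inverse are the same construction with the roles exchanged.\<close>

locale inverse_isos = G: group G + H: group H
  for G :: "('a, 'c) monoid_scheme" and H :: "('b, 'd) monoid_scheme" +
  fixes h k
  assumes h: "h \<in> iso G H" and k: "k \<in> iso H G"
    and kh: "x \<in> carrier G \<Longrightarrow> k (h x) = x" and hk: "y \<in> carrier H \<Longrightarrow> h (k y) = y"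
begin

lemma inverse_isos_swap: "inverse_isos H G k h"
  by unfold_locales (use h k kh hk in auto)

definition completion_lift :: "('a set \<Rightarrow> 'a set) \<Rightarrow> 'b set \<Rightarrow> 'b set" where
  "completion_lift f = (\<lambda>M\<in>finite_index_normal H. h ` f (k ` M))"

lemma finite_index_normal_k: "N \<in> finite_index_normal H \<Longrightarrow> k ` N \<in> finite_index_normal G"
  by (rule iso_image_finite_index_normal[OF H.group_axioms G.group_axioms k])

lemma finite_index_normal_sub:
  "N \<in> finite_index_normal H \<Longrightarrow> N \<subseteq> carrier H" "M \<in> finite_index_normal G \<Longrightarrow> M \<subseteq> carrier G"
  by (auto simp: finite_index_normal_def dest: normal_imp_subgroup subgroup.subset)

lemma image_hk: "A \<subseteq> carrier H \<Longrightarrow> h ` k ` A = A"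
  using image_cong[of A A "\<lambda>x. h (k x)" "\<lambda>x. x"] hk by (simp add: image_image subset_iff)

lemma image_kh: "A \<subseteq> carrier G \<Longrightarrow> k ` h ` A = A"
  using image_cong[of A A "\<lambda>x. k (h x)" "\<lambda>x. x"] kh by (simp add: image_image subset_iff)

lemma image_Mod:
  assumes "N \<in> finite_index_normal H"
  shows "(`) h ` carrier (G Mod (k ` N)) = carrier (H Mod N)"
  using iso_image_rcosets[OF h, of "k ` N"] image_hk[of N]
    finite_index_normal_sub(1)[OF assms]
    finite_index_normal_sub(2)[OF finite_index_normal_k[OF assms]]
  by (simp add: FactGroup_def)

lemma completion_component:
  assumes "f \<in> carrier (profinite_completion G)" "N \<in> finite_index_normal G"
  shows "f N \<in> carrier (G Mod N)" "f N \<subseteq> carrier G"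
proof -
  show 1: "f N \<in> carrier (G Mod N)"
    using assms by (auto simp: carrier_profinite_completion)
  show "f N \<subseteq> carrier G"
    using 1 G.r_coset_subset_G[OF finite_index_normal_sub(2)[OF assms(2)]]
    by (auto simp: carrier_FactGroup)
qed

lemma completion_lift_closed:
  assumes f: "f \<in> carrier (profinite_completion G)"
  shows "completion_lift f \<in> carrier (profinite_completion H)"
proof -
  have "h ` f (k ` N) \<in> carrier (H Mod N)" if N: "N \<in> finite_index_normal H" for N
    using completion_component(1)[OF f finite_index_normal_k[OF N]] image_Mod[OF N] by blast
  moreover have "h ` f (k ` N) \<subseteq> h ` f (k ` M)"
    if "N \<in> finite_index_normal H" "M \<in> finite_index_normal H" "N \<subseteq> M" for N M
    using f finite_index_normal_k[OF that(1)] finite_index_normal_k[OF that(2)] that(3)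
    by (simp add: carrier_profinite_completion image_mono)
  ultimately show ?thesis
    by (auto simp: carrier_profinite_completion completion_lift_def)
qed

lemma completion_lift_continuous:
  "continuous_map (profinite_topology G) (profinite_topology H) completion_lift"
proof -
  have 1: "continuous_map (profinite_topology G) (discrete_topology (carrier (H Mod N)))
      (\<lambda>f. completion_lift f N)" if N: "N \<in> finite_index_normal H" for N
  proof -
    have "continuous_map (profinite_topology G) (discrete_topology (carrier (G Mod (k ` N)))) (\<lambda>f. f (k ` N))"
      unfolding profinite_topology_def
      by (intro continuous_map_from_subtopology continuous_map_product_projection finite_index_normal_k N)
    moreover have "continuous_map (discrete_topology (carrier (G Mod (k ` N))))
        (discrete_topology (carrier (H Mod N))) ((`) h)"
      using image_Mod[OF N] by auto
    ultimately have "continuous_map (profinite_topology G) (discrete_topology (carrier (H Mod N)))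
        ((`) h \<circ> (\<lambda>f. f (k ` N)))"
      by (rule continuous_map_compose)
    then show ?thesis
      using N by (simp add: completion_lift_def o_def)
  qed
  have "continuous_map (profinite_topology G)
      (product_topology (\<lambda>N. discrete_topology (carrier (H Mod N))) (finite_index_normal H))
      completion_lift"
    using 1 by (subst continuous_map_componentwise) (auto simp: completion_lift_def)
  then show ?thesis
    using completion_lift_closed
    by (auto simp: profinite_topology_def[of H] continuous_map_in_subtopology topspace_profinite_topology)
qed

lemma completion_lift_mult:
  assumes "x \<in> carrier (profinite_completion G)" "y \<in> carrier (profinite_completion G)"
  shows "completion_lift (x \<otimes>\<^bsub>profinite_completion G\<^esub> y) =
    completion_lift x \<otimes>\<^bsub>profinite_completion H\<^esub> completion_lift y"
  unfolding completion_lift_def mult_profinite_completion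
proof (rule restrict_ext)
  fix N assume N: "N \<in> finite_index_normal H"
  have "h ` (x (k ` N) <#>\<^bsub>G\<^esub> y (k ` N)) = (h ` x (k ` N)) <#>\<^bsub>H\<^esub> (h ` y (k ` N))"
    by (rule set_mult_hom[OF iso_imp_homomorphism[OF h]])
      (rule completion_component(2)[OF assms(1) finite_index_normal_k[OF N]]
        completion_component(2)[OF assms(2) finite_index_normal_k[OF N]])+
  then show "h ` (\<lambda>N\<in>finite_index_normal G. x N <#>\<^bsub>G\<^esub> y N) (k ` N) =
      (\<lambda>M\<in>finite_index_normal H. h ` x (k ` M)) N <#>\<^bsub>H\<^esub> (\<lambda>M\<in>finite_index_normal H. h ` y (k ` M)) N"
    using N finite_index_normal_k[OF N] by simp
qed

end

lemma (in inverse_isos) completion_lift_inverse: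
  assumes "f \<in> carrier (profinite_completion G)"
  shows "inverse_isos.completion_lift G k h (completion_lift f) = f"
proof -
  interpret swap: inverse_isos H G k h by (rule inverse_isos_swap)
  have 1: "k ` h ` f (k ` h ` N) = f N" if N: "N \<in> finite_index_normal G" for N
    unfolding image_kh[OF finite_index_normal_sub(2)[OF N]]
    by (rule image_kh[OF completion_component(2)[OF assms N]])
  have "swap.completion_lift (completion_lift f) = restrict f (finite_index_normal G)"
    unfolding swap.completion_lift_def
    by (rule restrict_ext) (use 1 swap.finite_index_normal_k in \<open>simp add: completion_lift_def\<close>)
  also have "\<dots> = f"
    using assms by (auto simp: carrier_profinite_completion)
  finally show ?thesis .
qed

lemma iso_imp_profinite_completions_iso:
  assumes "group G" "group H" "G \<cong> H"
  shows "profinite_completions_iso G H"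
proof -
  obtain h where h: "h \<in> iso G H" using assms by (auto simp: is_iso_def)
  define k where "k = inv_into (carrier G) h"
  have bij: "bij_betw h (carrier G) (carrier H)" using h by (simp add: iso_def)
  interpret inverse_isos G H h k
    using h group.iso_set_sym[OF assms(1) h] bij bij_betw_inv_into_left[OF bij]
      bij_betw_inv_into_right[OF bij] assms(1,2)
    by (simp add: inverse_isos_def inverse_isos_axioms_def k_def)
  interpret swap: inverse_isos H G k h by (rule inverse_isos_swap)
  have "homeomorphic_maps (profinite_topology G) (profinite_topology H)
      completion_lift swap.completion_lift"
    unfolding homeomorphic_maps_def topspace_profinite_topology
    using completion_lift_continuous swap.completion_lift_continuous
      completion_lift_inverse swap.completion_lift_inverse by auto
  then have "homeomorphic_map (profinite_topology G) (profinite_topology H) completion_lift"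
    using homeomorphic_maps_map by blast
  moreover have "bij_betw completion_lift (carrier (profinite_completion G)) (carrier (profinite_completion H))"
    by (rule bij_betw_byWitness[where f' = swap.completion_lift])
      (use completion_lift_inverse swap.completion_lift_inverse completion_lift_closed
        swap.completion_lift_closed in auto)
  then have "completion_lift \<in> iso (profinite_completion G) (profinite_completion H)"
    using completion_lift_closed completion_lift_mult unfolding iso_def hom_def by blast
  ultimately show ?thesis
    unfolding profinite_completions_iso_def by (intro exI[of _ completion_lift] conjI)
qed

section \<open>Subgroups of central extensions\<close>

text \<open>The additive group of a type is viewed as a group with carrier, so that additive subgroups (called
lattices below, whatever their rank) and subgroups of non-commutative groups share one notion of
subgroup, coset and index.\<close>

definition addg :: "'a::ab_group_add monoid" where
  "addg = \<lparr>carrier = UNIV, monoid.mult = (+), one = 0\<rparr>"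

lemma addg_simps [simp]:
  "carrier addg = UNIV" "x \<otimes>\<^bsub>addg\<^esub> y = x + y" "\<one>\<^bsub>addg\<^esub> = 0"
  by (simp_all add: addg_def)

lemma group_addg: "group addg"
proof (rule groupI)
  show "\<exists>y\<in>carrier addg. y \<otimes>\<^bsub>addg\<^esub> x = \<one>\<^bsub>addg\<^esub>" for x :: 'a
    by (rule bexI[of _ "- x"]) auto
qed (simp_all add: add.assoc)

interpretation addg: group addg by (rule group_addg)

lemma inv_addg [simp]: "inv\<^bsub>addg\<^esub> x = - x"
  by (rule addg.inv_equality) auto

abbreviation lat :: "'a::ab_group_add set \<Rightarrow> bool" where
  "lat S \<equiv> subgroup S addg"

lemma lat_iff: "lat S \<longleftrightarrow> 0 \<in> S \<and> (\<forall>x\<in>S. \<forall>y\<in>S. x - y \<in> S)"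
proof
  assume S: "lat S"
  have "x + - y \<in> S" if "x \<in> S" "y \<in> S" for x y
    using subgroup.m_closed[OF S that(1) subgroup.m_inv_closed[OF S that(2)]] by simp
  then show "0 \<in> S \<and> (\<forall>x\<in>S. \<forall>y\<in>S. x - y \<in> S)" using subgroup.one_closed[OF S] by auto
next
  assume S: "0 \<in> S \<and> (\<forall>x\<in>S. \<forall>y\<in>S. x - y \<in> S)"
  then have neg: "- x \<in> S" if "x \<in> S" for x using that by force
  with S have "x + y \<in> S" if "x \<in> S" "y \<in> S" for x y
    using that by (metis diff_minus_eq_add)
  with S neg show "lat S" by (intro subgroup.intro) auto
qed

lemma lat_closed:
  assumes "lat S"
  shows "0 \<in> S" "x \<in> S \<Longrightarrow> y \<in> S \<Longrightarrow> x + y \<in> S" "x \<in> S \<Longrightarrow> y \<in> S \<Longrightarrow> x - y \<in> S"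
    "x \<in> S \<Longrightarrow> - x \<in> S"
  using assms subgroup.one_closed[OF assms] subgroup.m_closed[OF assms] subgroup.m_inv_closed[OF assms]
  by (auto simp: lat_iff)

definition zmul :: "int \<Rightarrow> 'a::ab_group_add \<Rightarrow> 'a" where
  "zmul j b = b [^]\<^bsub>addg\<^esub> j"

lemma zmul_simps [simp]: "zmul 0 b = 0" "zmul 1 b = b" "zmul j 0 = 0"
  using addg.int_pow_one[of j] by (simp_all add: zmul_def addg.int_pow_1)

lemma zmul_add: "zmul (i + j) b = zmul i b + zmul j b"
  using addg.int_pow_mult[of b i j] by (simp add: zmul_def)

lemma zmul_minus: "zmul (- j) b = - zmul j b"
  using addg.int_pow_neg[of b j] by (simp add: zmul_def)

lemma zmul_diff: "zmul (i - j) b = zmul i b - zmul j b"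
  using zmul_add[of i "-j" b] zmul_minus[of j b] by simp

lemma lat_zmul: "lat S \<Longrightarrow> x \<in> S \<Longrightarrow> zmul j x \<in> S"
  unfolding zmul_def by (rule addg.subgroup_int_pow_closed)

lemma hom_zmul:
  assumes "\<And>x y. f (x + y) = f x + f y"
  shows "f (zmul j b) = zmul j (f b)"
proof -
  have "f \<in> hom addg addg" using assms by (auto simp: hom_def)
  then show ?thesis unfolding zmul_def by (intro hom_int_pow group_addg) auto
qed

lemma zmul_int [simp]: "zmul j (b::int) = j * b"
proof -
  have "(\<lambda>j. j * b) (zmul j 1) = zmul j (1 * b)" 
    by (rule hom_zmul) (simp add: distrib_right)
  moreover have "zmul j (1::int) = j"
  proof (induction j rule: int_induct[where k = 0])
    case (step1 i) then show ?case by (simp add: zmul_add)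
  next
    case (step2 i) then show ?case by (simp add: zmul_diff)
  qed simp
  ultimately show ?thesis by simp
qed

lemma zmul_prod: "zmul j b = (zmul j (fst b), zmul j (snd b))"
  using hom_zmul[of fst j b] hom_zmul[of snd j b] by (simp add: prod_eq_iff)

text \<open>The central extension with cocycle \<open>\<beta>\<close>. A bilinear cocycle always satisfies the cocycle identity, and
\<open>\<beta> = 0\<close> gives the direct product, so sublattices of a product are covered by the same lemmas.\<close>

definition tw :: "('a::ab_group_add \<Rightarrow> 'a \<Rightarrow> 'b::ab_group_add) \<Rightarrow> ('a \<times> 'b) monoid" where
  "tw \<beta> = \<lparr>carrier = UNIV,
     monoid.mult = (\<lambda>x y. (fst x + fst y, snd x + snd y + \<beta> (fst x) (fst y))), one = (0, 0)\<rparr>"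

lemma tw_simps [simp]:
  "carrier (tw \<beta>) = UNIV" "\<one>\<^bsub>tw \<beta>\<^esub> = (0, 0)"
  "x \<otimes>\<^bsub>tw \<beta>\<^esub> y = (fst x + fst y, snd x + snd y + \<beta> (fst x) (fst y))"
  by (simp_all add: tw_def)

lemma tw_0: "tw (\<lambda>_ _. 0) = addg"
  by (auto simp: tw_def addg_def plus_prod_def zero_prod_def fun_eq_iff)

locale biadditive =
  fixes \<beta> :: "'a::ab_group_add \<Rightarrow> 'a \<Rightarrow> 'b::ab_group_add"
  assumes add_left: "\<beta> (u + u') v = \<beta> u v + \<beta> u' v"
    and add_right: "\<beta> u (v + v') = \<beta> u v + \<beta> u v'"
begin

abbreviation twisted_mult (infixl "\<star>" 70) where
  "x \<star> y \<equiv> x \<otimes>\<^bsub>tw \<beta>\<^esub> y"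

lemma zero_left [simp]: "\<beta> 0 v = 0" using add_left[of 0 0 v] by simp
lemma zero_right [simp]: "\<beta> u 0 = 0" using add_right[of u 0 0] by simp
lemma minus_left [simp]: "\<beta> (- u) v = - \<beta> u v"
  using add_left[of u "- u" v] by (simp add: eq_neg_iff_add_eq_0 add.commute)
lemma minus_right [simp]: "\<beta> u (- v) = - \<beta> u v"
  using add_right[of u v "- v"] by (simp add: eq_neg_iff_add_eq_0 add.commute)
lemma diff_left: "\<beta> (u - u') v = \<beta> u v - \<beta> u' v"
  using add_left[of u "- u'" v] by simp

lemma group_tw: "group (tw \<beta>)"
proof (rule groupI)
  show "\<exists>y\<in>carrier (tw \<beta>). y \<star> x = \<one>\<^bsub>tw \<beta>\<^esub>" for x
    by (rule bexI[of _ "(- fst x, - snd x + \<beta> (fst x) (fst x))"]) auto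
qed (auto simp: add_left add_right add.assoc add.left_commute)

sublocale G: group "tw \<beta>" by (rule group_tw)

lemma inv_tw [simp]: "inv\<^bsub>tw \<beta>\<^esub> x = (- fst x, - snd x + \<beta> (fst x) (fst x))"
  by (rule G.inv_equality) auto

definition \<omega> :: "'a \<Rightarrow> 'a \<Rightarrow> 'b" where "\<omega> u v = \<beta> u v - \<beta> v u"

lemma tw_swap: "x \<star> y = (0, \<omega> (fst x) (fst y)) \<star> y \<star> x"
  by (simp add: \<omega>_def)

lemma fst_hom: "fst \<in> hom (tw \<beta>) addg"
  by (auto simp: hom_def)

lemma fst_pow: "fst (x [^]\<^bsub>tw \<beta>\<^esub> (j::int)) = zmul j (fst x)"
  unfolding zmul_def by (rule hom_int_pow[OF fst_hom _ group_tw group_addg]) auto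

end

text \<open>For a subgroup this is its intersection with the central second factor; for a lattice in a product
it is the kernel of the first projection.\<close>

definition zero_fiber :: "('a::zero \<times> 'b) set \<Rightarrow> 'b set" where
  "zero_fiber D = {z. (0, z) \<in> D}"

lemma biadditive_0: "biadditive (\<lambda>_ _. 0)"
  by unfold_locales auto

context biadditive begin

lemma sub_closed:
  assumes D: "subgroup D (tw \<beta>)"
  shows "(0, 0) \<in> D"
    "(u, z) \<in> D \<Longrightarrow> (v, w) \<in> D \<Longrightarrow> (u + v, z + w + \<beta> u v) \<in> D"
    "(u, z) \<in> D \<Longrightarrow> (- u, - z + \<beta> u u) \<in> D"
    "(u, z) \<in> D \<Longrightarrow> (v, w) \<in> D \<Longrightarrow> (u - v, z - w - \<beta> (u - v) v) \<in> D"
proof -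
  show "(0, 0) \<in> D" using subgroup.one_closed[OF D] by simp
  show m: "(u, z) \<in> D \<Longrightarrow> (v, w) \<in> D \<Longrightarrow> (u + v, z + w + \<beta> u v) \<in> D" for u v z w
    using subgroup.m_closed[OF D, of "(u, z)" "(v, w)"] by simp
  show i: "(u, z) \<in> D \<Longrightarrow> (- u, - z + \<beta> u u) \<in> D" for u z
    using subgroup.m_inv_closed[OF D, of "(u, z)"] by simp
  show "(u, z) \<in> D \<Longrightarrow> (v, w) \<in> D \<Longrightarrow> (u - v, z - w - \<beta> (u - v) v) \<in> D"
    using m[OF _ i, of u z v w] by (simp add: diff_left algebra_simps)
qed

lemma lat_proj: "subgroup D (tw \<beta>) \<Longrightarrow> lat (fst ` D)"
  using sub_closed(1,4) by (force simp: lat_iff)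

lemma lat_zero_fiber: "subgroup D (tw \<beta>) \<Longrightarrow> lat (zero_fiber D)"
  using sub_closed(1,4)[of D] by (fastforce simp: lat_iff zero_fiber_def)

lemma fiber_eq:
  assumes D: "subgroup D (tw \<beta>)" and z: "(u, z) \<in> D"
  shows "(u, w) \<in> D \<longleftrightarrow> w - z \<in> zero_fiber D"
proof
  assume "(u, w) \<in> D"
  then show "w - z \<in> zero_fiber D" using sub_closed(4)[OF D _ z, of u w] by (simp add: zero_fiber_def)
next
  assume "w - z \<in> zero_fiber D"
  then show "(u, w) \<in> D" using sub_closed(2)[OF D _ z, of 0 "w - z"] by (simp add: zero_fiber_def)
qed

lemma commutator_in_zero_fiber:
  assumes D: "subgroup D (tw \<beta>)" and "u \<in> fst ` D" "v \<in> fst ` D"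
  shows "\<omega> u v \<in> zero_fiber D"
proof -
  obtain z w where "(u, z) \<in> D" "(v, w) \<in> D" using assms by auto
  then have "(u + v, z + w + \<beta> u v) \<in> D" "(u + v, w + z + \<beta> v u) \<in> D"
    using sub_closed(2)[OF D, of u z v w] sub_closed(2)[OF D, of v w u z] by (auto simp: add.commute)
  then show ?thesis using fiber_eq[OF D] by (fastforce simp: \<omega>_def algebra_simps)
qed

end

subsection \<open>Indices\<close>

text \<open>An infinite index counts as \<open>0\<close>, so \<open>idx S > 0\<close> expresses finite index.\<close>

definition idx :: "'a::ab_group_add set \<Rightarrow> nat" where
  "idx S = card (rcosets\<^bsub>addg\<^esub> S)"

definition transversal :: "('a, 'b) monoid_scheme \<Rightarrow> 'a set \<Rightarrow> 'a set \<Rightarrow> bool" where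
  "transversal G D T \<longleftrightarrow> T \<subseteq> carrier G \<and>
     (\<forall>x\<in>carrier G. \<exists>!t. t \<in> T \<and> x \<otimes>\<^bsub>G\<^esub> inv\<^bsub>G\<^esub> t \<in> D)"

lemma (in group) mem_rcos_iff:
  assumes "subgroup D G" "x \<in> carrier G" "t \<in> carrier G"
  shows "x \<in> D #> t \<longleftrightarrow> x \<otimes> inv t \<in> D"
  using subgroup.rcos_module[OF assms(1) is_group assms(3,2)] .

lemma (in group) card_rcosets_transversal:
  assumes "subgroup D G" "transversal G D T"
  shows "card (rcosets D) = card T"
proof -
  have T: "T \<subseteq> carrier G" using assms by (auto simp: transversal_def)
  have mem: "x \<in> D #> t \<longleftrightarrow> x \<otimes> inv t \<in> D" if "x \<in> carrier G" "t \<in> T" for x t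
    using mem_rcos_iff[OF assms(1) that(1), of t] T that(2) by auto
  have "bij_betw (\<lambda>t. D #> t) T (rcosets D)"
  proof (rule bij_betwI')
    fix s t assume st: "s \<in> T" "t \<in> T"
    show "(D #> s = D #> t) = (s = t)"
    proof
      assume "D #> s = D #> t"
      then have "s \<in> D #> t" "s \<in> D #> s" using rcos_self[OF _ assms(1), of s] st T by auto
      then show "s = t" using assms(2) st mem[of s] T unfolding transversal_def by blast
    qed simp
  next
    show "D #> t \<in> rcosets D" if "t \<in> T" for t
      using rcosetsI[OF subgroup.subset[OF assms(1)]] that T by blast
  next
    fix C assume "C \<in> rcosets D"
    then obtain x where x: "x \<in> carrier G" "C = D #> x" by (auto simp: RCOSETS_def)
    obtain t where t: "t \<in> T" "x \<otimes> inv t \<in> D" using assms(2) x(1) by (auto simp: transversal_def)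
    then have "D #> t = D #> x"
      using repr_independence[OF _ _ assms(1), of x t] mem[OF x(1) t(1)] T by auto
    then show "\<exists>t\<in>T. C = D #> t" using t x by auto
  qed
  then show ?thesis by (simp add: bij_betw_same_card)
qed

lemma (in group) transversal_exists:
  assumes "subgroup D G"
  obtains T where "transversal G D T"
proof -
  define r where "r = (\<lambda>C. SOME x. x \<in> C \<and> D #> x = C \<and> x \<in> carrier G)"
  have r: "r C \<in> C \<and> D #> r C = C \<and> r C \<in> carrier G" if C: "C \<in> rcosets D" for C
  proof -
    obtain x where x: "x \<in> carrier G" "C = D #> x" using C unfolding RCOSETS_def by blast
    then have "x \<in> C \<and> D #> x = C \<and> x \<in> carrier G" using rcos_self[OF x(1) assms] by simp
    then show ?thesis unfolding r_def by (rule someI)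
  qed
  have "transversal G D (r ` (rcosets D))"
    unfolding transversal_def
  proof (intro conjI ballI)
    show "r ` (rcosets D) \<subseteq> carrier G" using r by blast
  next
    fix x assume x: "x \<in> carrier G"
    have C: "D #> x \<in> rcosets D" using rcosetsI[OF subgroup.subset[OF assms] x] .
    have xx: "x \<in> D #> x" using rcos_self[OF x assms] .
    show "\<exists>!t. t \<in> r ` (rcosets D) \<and> x \<otimes> inv t \<in> D"
    proof (rule ex1I[of _ "r (D #> x)"])
      show "r (D #> x) \<in> r ` (rcosets D) \<and> x \<otimes> inv (r (D #> x)) \<in> D"
        using r[OF C] C mem_rcos_iff[OF assms x, of "r (D #> x)"] xx by simp
    next
      fix t assume t: "t \<in> r ` (rcosets D) \<and> x \<otimes> inv t \<in> D"
      then obtain C' where C': "C' \<in> rcosets D" "t = r C'" by auto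
      then have "x \<in> D #> t" using mem_rcos_iff[OF assms x, of t] r[OF C'(1)] t by simp
      then have "x \<in> C'" using r[OF C'(1)] C' by simp
      then have "D #> x = C'"
        using r[OF C'(1)] repr_independence[OF _ _ assms, of x "r C'"] by simp
      then show "t = r (D #> x)" using C' by simp
    qed
  qed
  then show thesis by (rule that)
qed

lemma transversal_addg: "transversal addg D T \<Longrightarrow> \<exists>!t. t \<in> T \<and> x - t \<in> D"
  by (simp add: transversal_def)

text \<open>A transversal of the image times a transversal of the central part is a transversal of the
subgroup.\<close>

lemma (in biadditive) card_rcosets_tw:
  assumes D: "subgroup D (tw \<beta>)"
  shows "card (rcosets\<^bsub>tw \<beta>\<^esub> D) = idx (fst ` D) * idx (zero_fiber D)"
proof -
  obtain S where S: "transversal addg (fst ` D) S"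
    using addg.transversal_exists[OF lat_proj[OF D]] .
  obtain T where T: "transversal addg (zero_fiber D) T"
    using addg.transversal_exists[OF lat_zero_fiber[OF D]] .
  have "transversal (tw \<beta>) D (S \<times> T)"
    unfolding transversal_def
  proof (intro conjI ballI)
    fix x :: "'a \<times> 'b"
    obtain u z where x: "x = (u, z)" by force
    have e: "x \<star> inv\<^bsub>tw \<beta>\<^esub> (s, t) = (u - s, z - t - \<beta> (u - s) s)" for s t
      by (simp add: x diff_left)
    obtain s where s: "s \<in> S" "u - s \<in> fst ` D" and s': "\<And>s'. s' \<in> S \<Longrightarrow> u - s' \<in> fst ` D \<Longrightarrow> s' = s"
      using transversal_addg[OF S, of u] by blast
    obtain w where w: "(u - s, w) \<in> D" using s by auto
    obtain t where t: "t \<in> T" "(z - \<beta> (u - s) s - w) - t \<in> zero_fiber D"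
      and t': "\<And>t'. t' \<in> T \<Longrightarrow> (z - \<beta> (u - s) s - w) - t' \<in> zero_fiber D \<Longrightarrow> t' = t"
      using transversal_addg[OF T, of "z - \<beta> (u - s) s - w"] by blast
    have iff: "(u - s, z - t' - \<beta> (u - s) s) \<in> D \<longleftrightarrow> (z - \<beta> (u - s) s - w) - t' \<in> zero_fiber D" for t'
      using fiber_eq[OF D w, of "z - t' - \<beta> (u - s) s"] by (simp add: algebra_simps)
    show "\<exists>!y. y \<in> S \<times> T \<and> x \<star> inv\<^bsub>tw \<beta>\<^esub> y \<in> D"
    proof (rule ex1I[of _ "(s, t)"])
      show "(s, t) \<in> S \<times> T \<and> x \<star> inv\<^bsub>tw \<beta>\<^esub> (s, t) \<in> D"
        using s(1) t iff[of t] unfolding e by auto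
    next
      fix y assume y: "y \<in> S \<times> T \<and> x \<star> inv\<^bsub>tw \<beta>\<^esub> y \<in> D"
      obtain s1 t1 where y1: "y = (s1, t1)" by force
      have y2: "s1 \<in> S" "t1 \<in> T" "(u - s1, z - t1 - \<beta> (u - s1) s1) \<in> D"
        using y unfolding y1 e by auto
      then have "u - s1 \<in> fst ` D" by (metis fst_conv image_eqI)
      then have "s1 = s" using s' y2 by auto
      then show "y = (s, t)" using t' y2 iff y1 by auto
    qed
  qed auto
  then show ?thesis
    using G.card_rcosets_transversal[OF D] addg.card_rcosets_transversal[OF lat_proj[OF D] S]
      addg.card_rcosets_transversal[OF lat_zero_fiber[OF D] T]
    by (simp add: idx_def card_cartesian_product)
qed

lemma idx_prod:
  assumes "lat (L :: ('a::ab_group_add \<times> 'b::ab_group_add) set)"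
  shows "idx L = idx (fst ` L) * idx (zero_fiber L)"
  using biadditive.card_rcosets_tw[OF biadditive_0, of L] assms unfolding tw_0 idx_def by blast

subsection \<open>Counting subgroups with given projection and kernel\<close>

text \<open>A lattice of free rank \<open>r\<close> is reached from \<open>0\<close> by adjoining \<open>r\<close> generators, none of which has a nonzero
multiple in the lattice already built. This chain is the form of freeness on which the count of
subgroups runs its induction.\<close>

inductive free_rank :: "'a::ab_group_add set \<Rightarrow> nat \<Rightarrow> bool" where
  zero: "free_rank {0} 0"
| extend: "free_rank L r \<Longrightarrow> (\<And>j. zmul j b \<in> L \<Longrightarrow> j = 0) \<Longrightarrow>
    free_rank {u + zmul j b | u j. u \<in> L} (Suc r)"

lemma lat_extend:
  assumes "lat L"
  shows "lat {u + zmul j b | u j. u \<in> L}"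
  unfolding lat_iff
proof (intro conjI ballI)
  show "0 \<in> {u + zmul j b | u j. u \<in> L}"
    using lat_closed(1)[OF assms] by (auto intro!: exI[of _ 0])
  fix x y assume "x \<in> {u + zmul j b | u j. u \<in> L}" "y \<in> {u + zmul j b | u j. u \<in> L}"
  then obtain u i v j where "x = u + zmul i b" "y = v + zmul j b" "u \<in> L" "v \<in> L" by auto
  then have "x - y = (u - v) + zmul (i - j) b" "u - v \<in> L"
    using lat_closed(3)[OF assms] by (auto simp: zmul_diff)
  then show "x - y \<in> {u + zmul j b | u j. u \<in> L}" by auto
qed

lemma free_rank_lat: "free_rank L r \<Longrightarrow> lat L"
proof (induction rule: free_rank.induct)
  case zero
  show ?case by (simp add: lat_iff)
next
  case (extend L r b)
  then show ?case by (intro lat_extend)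
qed

lemma addg_r_coset: "M #>\<^bsub>addg\<^esub> z = {w. w - z \<in> M}"
proof (intro equalityI subsetI)
  fix w assume "w \<in> {w. w - z \<in> M}"
  then have "w - z \<in> M" "w = (w - z) + z" by auto
  then show "w \<in> M #>\<^bsub>addg\<^esub> z" unfolding r_coset_def by fastforce
qed (auto simp: r_coset_def)

context biadditive begin

definition subgroups_over :: "'a set \<Rightarrow> 'b set \<Rightarrow> ('a \<times> 'b) set set" where
  "subgroups_over L M = {D. subgroup D (tw \<beta>) \<and> fst ` D = L \<and> zero_fiber D = M}"

text \<open>Adjoining a generator \<open>b\<close> to \<open>L\<close>. A subgroup over the larger lattice is determined by its part over \<open>L\<close>
and by the lifts of \<open>b\<close> it contains, which form one coset of \<open>M\<close>. Every choice occurs: a lift \<open>g\<close> normalises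
the part over \<open>L\<close> because commutators land in \<open>M\<close>, so the products of that part with the powers of \<open>g\<close>
form a subgroup, and no new central elements arise because no nonzero multiple of \<open>b\<close> lies in \<open>L\<close>.\<close>

lemma subgroups_over_extend:
  assumes L: "lat L" and M: "lat M" and b: "\<And>j. zmul j b \<in> L \<Longrightarrow> j = 0"
    and L'_def: "L' = {u + zmul j b | u j. u \<in> L}"
    and comm: "\<And>u v. u \<in> L' \<Longrightarrow> v \<in> L' \<Longrightarrow> \<omega> u v \<in> M"
  shows "bij_betw (\<lambda>D. (D \<inter> L \<times> UNIV, {z. (b, z) \<in> D})) (subgroups_over L' M) (subgroups_over L M \<times> rcosets\<^bsub>addg\<^esub> M)"
proof -
  have L': "lat L'" unfolding L'_def by (rule lat_extend[OF L])
  have zL': "zmul j b \<in> L'" for j unfolding L'_def using lat_closed(1)[OF L] by force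
  have LL': "L \<subseteq> L'" unfolding L'_def by (force intro: exI[of _ 0])
  have bL': "b \<in> L'" using zL'[of 1] by simp
  have coset: "{z. (b, z) \<in> D} = M #>\<^bsub>addg\<^esub> z0" if "D \<in> subgroups_over L' M" "(b, z0) \<in> D" for D z0
  proof -
    have D: "subgroup D (tw \<beta>)" "zero_fiber D = M" using that(1) by (auto simp: subgroups_over_def)
    show ?thesis using fiber_eq[OF D(1) that(2)] unfolding D(2) addg_r_coset by blast
  qed
  have restrict_over: "D \<inter> L \<times> UNIV \<in> subgroups_over L M" if "D \<in> subgroups_over L' M" for D
  proof -
    have D: "subgroup D (tw \<beta>)" "fst ` D = L'" "zero_fiber D = M" using that by (auto simp: subgroups_over_def)
    have "subgroup (D \<inter> L \<times> UNIV) (tw \<beta>)"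
      by (rule subgroup.intro) (use sub_closed[OF D(1)] lat_closed[OF L] in auto)
    moreover have "fst ` (D \<inter> L \<times> UNIV) = L" using D(2) LL' by force
    moreover have "zero_fiber (D \<inter> L \<times> UNIV) = M" using D(3) lat_closed(1)[OF L] by (auto simp: zero_fiber_def)
    ultimately show ?thesis by (simp add: subgroups_over_def)
  qed
  have recover: "D = {d \<star> (b, z0) [^]\<^bsub>tw \<beta>\<^esub> (j::int) | d j. d \<in> D \<inter> L \<times> UNIV}"
    if "D \<in> subgroups_over L' M" "(b, z0) \<in> D" for D z0
  proof (intro equalityI subsetI)
    have D: "subgroup D (tw \<beta>)" "fst ` D = L'" using that(1) by (auto simp: subgroups_over_def)
    have pow: "(b, z0) [^]\<^bsub>tw \<beta>\<^esub> (j::int) \<in> D" for j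
      using G.subgroup_int_pow_closed[OF D(1) that(2)] .
    {
      fix x assume x: "x \<in> D"
      then obtain u j where uj: "fst x = u + zmul j b" "u \<in> L" using D(2) L'_def by force
      define d where "d = x \<star> inv\<^bsub>tw \<beta>\<^esub> ((b, z0) [^]\<^bsub>tw \<beta>\<^esub> j)"
      have "fst d = u" unfolding d_def by (simp add: fst_pow uj)
      moreover have "d \<in> D" unfolding d_def
        using subgroup.m_closed[OF D(1) x subgroup.m_inv_closed[OF D(1) pow]] .
      ultimately have "d \<in> D \<inter> L \<times> UNIV" using uj(2) by (simp add: mem_Times_iff)
      moreover have "x = d \<star> (b, z0) [^]\<^bsub>tw \<beta>\<^esub> j"
        unfolding d_def by (simp only: G.m_assoc G.l_inv G.r_one tw_simps(1) UNIV_I G.inv_closed)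
      ultimately show "x \<in> {d \<star> (b, z0) [^]\<^bsub>tw \<beta>\<^esub> (j::int) | d j. d \<in> D \<inter> L \<times> UNIV}"
        by blast
    next
      fix x assume "x \<in> {d \<star> (b, z0) [^]\<^bsub>tw \<beta>\<^esub> (j::int) | d j. d \<in> D \<inter> L \<times> UNIV}"
      then show "x \<in> D" using subgroup.m_closed[OF D(1) _ pow] by blast
    }
  qed
  show ?thesis
  proof (rule bij_betwI')
    fix D E assume DE: "D \<in> subgroups_over L' M" "E \<in> subgroups_over L' M"
    show "((D \<inter> L \<times> UNIV, {z. (b, z) \<in> D}) = (E \<inter> L \<times> UNIV, {z. (b, z) \<in> E})) = (D = E)"
    proof
      assume eq: "(D \<inter> L \<times> UNIV, {z. (b, z) \<in> D}) = (E \<inter> L \<times> UNIV, {z. (b, z) \<in> E})"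
      obtain z0 where z0: "(b, z0) \<in> D" using DE(1) bL' by (force simp: subgroups_over_def)
      then have z0': "(b, z0) \<in> E" using eq by auto
      have eq': "D \<inter> L \<times> UNIV = E \<inter> L \<times> UNIV" using eq by simp
      show "D = E" using recover[OF DE(1) z0] recover[OF DE(2) z0'] unfolding eq'
        by (rule HOL.trans[OF _ HOL.sym])
    qed simp
  next
    fix D assume D: "D \<in> subgroups_over L' M"
    obtain z0 where z0: "(b, z0) \<in> D" using D bL' by (force simp: subgroups_over_def)
    show "(D \<inter> L \<times> UNIV, {z. (b, z) \<in> D}) \<in> subgroups_over L M \<times> rcosets\<^bsub>addg\<^esub> M"
      using restrict_over[OF D] coset[OF D z0] by (auto simp: RCOSETS_def)
  next
    fix y assume "y \<in> subgroups_over L M \<times> rcosets\<^bsub>addg\<^esub> M"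
    then obtain D0 z0 where y: "y = (D0, M #>\<^bsub>addg\<^esub> z0)" and "D0 \<in> subgroups_over L M"
      by (auto simp: RCOSETS_def)
    then have D0: "subgroup D0 (tw \<beta>)" "fst ` D0 = L" "zero_fiber D0 = M" by (auto simp: subgroups_over_def)
    define g where "g = (\<lambda>j::int. (b, z0) [^]\<^bsub>tw \<beta>\<^esub> j)"
    have g: "fst (g j) = zmul j b" "g 0 = (0, 0)" "g 1 = (b, z0)"
       "g (i + j) = g i \<star> g j" "inv\<^bsub>tw \<beta>\<^esub> g j = g (- j)" for i j
      using G.int_pow_mult[of "(b, z0)" i j] G.int_pow_neg[of "(b, z0)" j] G.int_pow_1[of "(b, z0)"]
      by (simp_all add: g_def fst_pow del: tw_simps(3) inv_tw)
    have swap: "\<exists>d'\<in>D0. g j \<star> d = d' \<star> g j" if d: "d \<in> D0" for d j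
    proof (rule bexI)
      show "g j \<star> d = ((0, \<omega> (fst (g j)) (fst d)) \<star> d) \<star> g j"
        by (rule tw_swap)
      have "fst d \<in> L'" using d D0(2) LL' by auto
      then have "(0, \<omega> (fst (g j)) (fst d)) \<in> D0"
        using comm zL' D0(3) g(1) by (auto simp: zero_fiber_def)
      then show "(0, \<omega> (fst (g j)) (fst d)) \<star> d \<in> D0"
        by (rule subgroup.m_closed[OF D0(1) _ d])
    qed
    define D where "D = {d \<star> g j | d j. d \<in> D0}"
    have D: "subgroup D (tw \<beta>)"
    proof (rule G.subgroupI)
      show "D \<noteq> {}" using subgroup.one_closed[OF D0(1)] unfolding D_def by blast
    next
      fix x assume "x \<in> D"
      then obtain d j where x: "x = d \<star> g j" "d \<in> D0" by (auto simp: D_def)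
      obtain d' where d': "d' \<in> D0" "g (- j) \<star> inv\<^bsub>tw \<beta>\<^esub> d = d' \<star> g (- j)"
        using swap[OF subgroup.m_inv_closed[OF D0(1) x(2)]] by blast
      have "inv\<^bsub>tw \<beta>\<^esub> x = g (- j) \<star> inv\<^bsub>tw \<beta>\<^esub> d"
        unfolding x(1) using G.inv_mult_group[of d "g j"] g(5) by (simp del: tw_simps(3) inv_tw)
      then show "inv\<^bsub>tw \<beta>\<^esub> x \<in> D" unfolding D_def d'(2) using d'(1) by blast
    next
      fix x y assume "x \<in> D" "y \<in> D"
      then obtain d i e j where x: "x = d \<star> g i" "d \<in> D0" and y: "y = e \<star> g j" "e \<in> D0"
        by (auto simp: D_def)
      obtain e' where e': "e' \<in> D0" "g i \<star> e = e' \<star> g i"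
        using swap[OF y(2)] by blast
      have "x \<star> y = d \<star> (g i \<star> e) \<star> g j"
        unfolding x y by (simp only: G.m_assoc tw_simps(1) UNIV_I G.m_closed)
      also have "\<dots> = (d \<star> e') \<star> g (i + j)"
        unfolding e'(2) g(4) by (simp only: G.m_assoc tw_simps(1) UNIV_I G.m_closed)
      finally show "x \<star> y \<in> D"
        unfolding D_def using subgroup.m_closed[OF D0(1) x(2) e'(1)] by blast
    qed auto
    have fstD: "fst (d \<star> g j) = fst d + zmul j b" for d j by (simp add: g)
    have inL: "j = 0" if "u + zmul j b \<in> L" "u \<in> L" for u j
      using b lat_closed(3)[OF L that] by simp
    have DL: "D \<inter> L \<times> UNIV = D0"
    proof (intro equalityI subsetI)
      fix x assume "x \<in> D \<inter> L \<times> UNIV"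
      then obtain d j where x: "x = d \<star> g j" "d \<in> D0" "fst x \<in> L" by (auto simp: D_def)
      have "j = 0" using x D0(2) inL[of "fst d" j] fstD[of d j] by auto
      then show "x \<in> D0" using x g(2) by simp
    next
      fix x assume x: "x \<in> D0"
      have "x = x \<star> g 0" using g(2) by simp
      then have "x \<in> D" unfolding D_def using x by blast
      then show "x \<in> D \<inter> L \<times> UNIV" using x D0(2) by (auto simp: mem_Times_iff)
    qed
    have "fst ` D = L'"
    proof -
      have "fst ` D = {fst (d \<star> g j) | d j. d \<in> D0}" unfolding D_def by blast
      then have "fst ` D = {fst d + zmul j b | d j. d \<in> D0}" unfolding fstD .
      then show ?thesis unfolding L'_def D0(2)[symmetric] by blast
    qed
    moreover have "zero_fiber D = M"
    proof -
      have "zero_fiber D = zero_fiber (D \<inter> L \<times> UNIV)" using lat_closed(1)[OF L] by (auto simp: zero_fiber_def)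
      then show ?thesis using DL D0(3) by simp
    qed
    ultimately have Df: "D \<in> subgroups_over L' M" using D by (simp add: subgroups_over_def)
    have "(b, z0) = (0, 0) \<star> g 1" using g(3) by simp
    then have "(b, z0) \<in> D" unfolding D_def using sub_closed(1)[OF D0(1)] by blast
    then show "\<exists>D\<in>subgroups_over L' M. y = (D \<inter> L \<times> UNIV, {z. (b, z) \<in> D})"
      using Df DL coset[OF Df] y by auto
  qed
qed

lemma card_subgroups_over:
  assumes "free_rank L r" "lat M" "\<And>u v. u \<in> L \<Longrightarrow> v \<in> L \<Longrightarrow> \<omega> u v \<in> M"
  shows "card (subgroups_over L M) = idx M ^ r"
  using assms(1,3)
proof (induction rule: free_rank.induct)
  case zero
  have "subgroups_over {0} M = {{0} \<times> M}"
  proof -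
    have "subgroup ({0} \<times> M) (tw \<beta>)"
      by (rule subgroup.intro) (use lat_closed[OF assms(2)] in auto)
    moreover have "fst ` ({0} \<times> M) = {0}" using lat_closed(1)[OF assms(2)] by force
    moreover have "D = {0} \<times> zero_fiber D" if D: "fst ` D = {0}" for D :: "('a \<times> 'b) set"
    proof -
      have "fst x = 0" if "x \<in> D" for x using imageI[OF that, of fst] D by simp
      then show ?thesis unfolding zero_fiber_def by (auto simp: prod_eq_iff) (metis prod.collapse)
    qed
    ultimately show ?thesis unfolding subgroups_over_def by (auto simp: zero_fiber_def)
  qed
  then show ?case by simp
next
  case (extend L r b)
  let ?L = "{u + zmul j b | u j. u \<in> L}"
  have L: "lat L" using extend free_rank_lat by auto
  have sub: "L \<subseteq> ?L" by (force intro: exI[of _ 0])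
  have "card (subgroups_over ?L M) = card (subgroups_over L M \<times> rcosets\<^bsub>addg\<^esub> M)"
    using subgroups_over_extend[OF L assms(2) extend(2) HOL.refl extend(4)] by (rule bij_betw_same_card)
  also have "\<dots> = idx M ^ r * idx M"
    using extend(3) extend(4) sub by (simp add: card_cartesian_product idx_def subset_iff)
  finally show ?case by simp
qed

end

section \<open>Lattices in the plane\<close>

type_synonym plane = "int \<times> int"

definition mults :: "int \<Rightarrow> int set" where "mults d = {x. d dvd x}"

lemma lat_mults [simp]: "lat (mults d)"
  by (auto simp: lat_iff mults_def)

lemma lat_int:
  assumes "lat (S :: int set)"
  obtains d where "d \<ge> 0" "S = mults d"
proof (cases "\<exists>n>0. int n \<in> S")
  case False
  have "x = 0" if "x \<in> S" for x
  proof (rule ccontr)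
    assume "x \<noteq> 0"
    moreover have "- x \<in> S" using lat_closed(4)[OF assms that] .
    ultimately have "int (nat \<bar>x\<bar>) \<in> S" "nat \<bar>x\<bar> > 0" using that by (auto simp: abs_if)
    then show False using False by blast
  qed
  then have "S = mults 0" using lat_closed(1)[OF assms] by (auto simp: mults_def)
  then show thesis using that by force
next
  case True
  define n where "n = (LEAST n. n > 0 \<and> int n \<in> S)"
  have n: "n > 0" "int n \<in> S" using LeastI_ex[OF True] by (auto simp: n_def)
  have least: "n \<le> m" if "m > 0" "int m \<in> S" for m
    unfolding n_def by (rule Least_le) (use that in auto)
  have "S = mults (int n)"
  proof (intro equalityI subsetI)
    fix x assume x: "x \<in> S"
    have "x - zmul (x div int n) (int n) \<in> S"
      by (rule lat_closed(3)[OF assms x lat_zmul[OF assms n(2)]])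
    then have "int (nat (x mod int n)) \<in> S" using n(1) by (simp add: minus_div_mult_eq_mod)
    moreover have "nat (x mod int n) < n" using n(1) by (simp add: nat_less_iff)
    ultimately have "\<not> nat (x mod int n) > 0" using least leD by blast
    moreover have "x mod int n \<ge> 0" using n(1) by simp
    ultimately have "x mod int n = 0" by simp
    then show "x \<in> mults (int n)" by (simp add: mults_def dvd_eq_mod_eq_0)
  next
    fix x assume "x \<in> mults (int n)"
    then obtain k where "x = zmul k (int n)" by (auto simp: mults_def dvd_def mult.commute)
    then show "x \<in> S" using lat_zmul[OF assms n(2)] by simp
  qed
  then show thesis by (intro that[of "int n"]) simp_all
qed

lemma idx_mults_pos:
  assumes "d > 0"
  shows "idx (mults d) = nat d"
proof -
  have "transversal addg (mults d) {0..<d}"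
    unfolding transversal_def
  proof (intro conjI ballI)
    fix x :: int
    show "\<exists>!t. t \<in> {0..<d} \<and> x \<otimes>\<^bsub>addg\<^esub> inv\<^bsub>addg\<^esub> t \<in> mults d"
    proof (rule ex1I[of _ "x mod d"])
      show "x mod d \<in> {0..<d} \<and> x \<otimes>\<^bsub>addg\<^esub> inv\<^bsub>addg\<^esub> (x mod d) \<in> mults d"
        using assms by (simp add: mults_def minus_mod_eq_mult_div)
    next
      fix t assume "t \<in> {0..<d} \<and> x \<otimes>\<^bsub>addg\<^esub> inv\<^bsub>addg\<^esub> t \<in> mults d"
      then have "0 \<le> t" "t < d" "d dvd x - t" by (auto simp: mults_def)
      then have "x mod d = t mod d" "t mod d = t" using mod_eq_dvd_iff[of x d t] by simp_all
      then show "t = x mod d" by simp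
    qed
  qed auto
  then show ?thesis using addg.card_rcosets_transversal[OF lat_mults] by (simp add: idx_def)
qed

lemma idx_mults_0: "idx (mults 0) = 0"
proof -
  have "transversal addg (mults 0) UNIV"
    by (auto simp: transversal_def mults_def)
  then show ?thesis using addg.card_rcosets_transversal[OF lat_mults, of 0 UNIV]
    by (simp add: idx_def infinite_UNIV_int)
qed

lemma idx_mults: "d \<ge> 0 \<Longrightarrow> idx (mults d) = nat d"
  by (cases "d = 0") (simp_all add: idx_mults_0 idx_mults_pos)

lemma lat_int_idx:
  assumes "lat (S :: int set)"
  shows "S = mults (int (idx S))"
proof -
  obtain d where d: "d \<ge> 0" "S = mults d" using lat_int[OF assms] .
  show ?thesis unfolding d(2) using d(1) by (simp add: idx_mults)
qed

lemma mults_eq_iff: "d \<ge> 0 \<Longrightarrow> e \<ge> 0 \<Longrightarrow> mults d = mults e \<longleftrightarrow> d = e"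
  by (metis dvd_refl mem_Collect_eq mults_def zdvd_antisym_nonneg)

lemma mults_subset_iff: "mults a \<subseteq> mults b \<longleftrightarrow> b dvd a"
  unfolding mults_def by (blast intro: dvd_trans dvd_refl)

lemma mults_range: "mults d = range (\<lambda>j. j * d)"
  by (auto simp: mults_def dvd_def mult.commute)

lemma free_rank_mults:
  assumes "d \<noteq> 0"
  shows "free_rank (mults d) (Suc 0)"
proof -
  have "mults d = {u + zmul j d | u j. u \<in> {0}}"
    by (auto simp: mults_range)
  then show ?thesis using free_rank.extend[OF free_rank.zero, of d] assms by auto
qed

lemma eq_if_same_fst_zero_fiber:
  assumes "lat (K :: ('a::ab_group_add \<times> 'b::ab_group_add) set)" "lat L" "K \<subseteq> L" "fst ` L \<subseteq> fst ` K" "zero_fiber L \<subseteq> zero_fiber K"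
  shows "K = L"
proof (intro equalityI subsetI)
  fix x assume x: "x \<in> L"
  then obtain w where w: "w \<in> K" "fst x = fst w" using assms(4) by blast
  have "x - w \<in> L" using lat_closed(3)[OF assms(2) x] w(1) assms(3) by blast
  moreover have "x - w = (0, snd x - snd w)" using w(2) by (simp add: prod_eq_iff)
  ultimately have "x - w \<in> K" using assms(5) by (auto simp: zero_fiber_def)
  then show "x \<in> K" using lat_closed(2)[OF assms(1) _ w(1)] by fastforce
qed (use assms in auto)

lemma lat_fst: "lat (L :: ('a::ab_group_add \<times> 'b::ab_group_add) set) \<Longrightarrow> lat (fst ` L)"
  using biadditive.lat_proj[OF biadditive_0, of L] by (simp add: tw_0)

lemma lat_zero_fiber: "lat (L :: ('a::ab_group_add \<times> 'b::ab_group_add) set) \<Longrightarrow> lat (zero_fiber L)"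
  using biadditive.lat_zero_fiber[OF biadditive_0, of L] by (simp add: tw_0)

lemma free_rank_zero_times:
  "free_rank K s \<Longrightarrow> free_rank ({0::'a::ab_group_add} \<times> K) s"
proof (induction rule: free_rank.induct)
  case zero
  have "{0::'a} \<times> {0::'b} = {0}" by (simp add: zero_prod_def)
  then show ?case using free_rank.zero by simp
next
  case (extend L r b)
  have z: "zmul j (0::'a, b) = (0, zmul j b)" for j by (simp add: zmul_prod)
  have "{0::'a} \<times> {u + zmul j b | u j. u \<in> L} = {u + zmul j (0, b) | u j. u \<in> {0} \<times> L}"
    unfolding z by auto
  then show ?case using free_rank.extend[OF extend(3), of "(0, b)"] extend(2) by (simp add: z)
qed

text \<open>Generators of the image can be lifted one at a time; the independence of a lift is already visible
in the first coordinate.\<close>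

lemma free_rank_product:
  assumes "free_rank P r" "free_rank K s"
    "lat (L :: ('a::ab_group_add \<times> 'b::ab_group_add) set)" "fst ` L = P" "zero_fiber L = K"
  shows "free_rank L (r + s)"
  using assms(1,3,4,5)
proof (induction arbitrary: L rule: free_rank.induct)
  case zero
  have "fst x = 0" if "x \<in> L" for x using imageI[OF that, of fst] zero by simp
  then have "L = {0} \<times> K" unfolding zero(3)[symmetric] zero_fiber_def
    by (auto simp: prod_eq_iff) (metis prod.collapse)
  then show ?case using free_rank_zero_times[OF assms(2)] by simp
next
  case (extend P r b)
  have P: "lat P" using extend(1) by (rule free_rank_lat)
  have sub: "u + zmul j b \<in> fst ` L" if "u \<in> P" for u j using that extend(5) by blast
  have "b \<in> fst ` L" using sub[OF lat_closed(1)[OF P], of 1] by simp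
  then obtain z where z: "(b, z) \<in> L" by force
  define L1 where "L1 = L \<inter> P \<times> UNIV"
  have "lat L1" unfolding L1_def lat_iff
    using lat_closed[OF extend(4)] lat_closed[OF P] by (auto simp: zero_prod_def mem_Times_iff)
  moreover have "fst ` L1 = P"
  proof
    show "P \<subseteq> fst ` L1"
    proof
      fix u assume u: "u \<in> P"
      then have "u \<in> fst ` L" using sub[of u 0] by simp
      then show "u \<in> fst ` L1" using u by (force simp: L1_def)
    qed
  qed (auto simp: L1_def)
  moreover have "zero_fiber L1 = K" using extend(6) lat_closed(1)[OF P] by (auto simp: L1_def zero_fiber_def)
  ultimately have L1: "free_rank L1 (r + s)" using extend(3) by blast
  have "L = {u + zmul j (b, z) | u j. u \<in> L1}"
  proof (intro equalityI subsetI)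
    fix x assume x: "x \<in> L"
    then obtain u j where uj: "fst x = u + zmul j b" "u \<in> P" using extend(5) by blast
    have "x - zmul j (b, z) \<in> L" using lat_closed(3)[OF extend(4) x lat_zmul[OF extend(4) z]] .
    moreover have "fst (x - zmul j (b, z)) = u" using uj by (simp add: zmul_prod[of j "(b, z)"])
    ultimately have "x - zmul j (b, z) \<in> L1" using uj(2) by (simp add: L1_def mem_Times_iff)
    moreover have "x = (x - zmul j (b, z)) + zmul j (b, z)" by simp
    ultimately show "x \<in> {u + zmul j (b, z) | u j. u \<in> L1}" by blast
  next
    fix x assume "x \<in> {u + zmul j (b, z) | u j. u \<in> L1}"
    then obtain u j where "x = u + zmul j (b, z)" "u \<in> L" unfolding L1_def by blast
    then show "x \<in> L" using lat_closed(2)[OF extend(4) _ lat_zmul[OF extend(4) z]] by simp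
  qed
  moreover have "j = 0" if "zmul j (b, z) \<in> L1" for j
    using that extend(2) by (auto simp: L1_def zmul_prod[of j "(b, z)"])
  ultimately show ?case using free_rank.extend[OF L1, of "(b, z)"] by simp
qed

lemma free_rank_plane:
  assumes "lat (L :: plane set)" "idx L > 0"
  shows "free_rank L 2"
proof -
  have "idx (fst ` L) \<noteq> 0" "idx (zero_fiber L) \<noteq> 0" using assms idx_prod[OF assms(1)] by auto
  then have "free_rank (mults (int (idx (fst ` L)))) (Suc 0)" "free_rank (mults (int (idx (zero_fiber L)))) (Suc 0)"
    by (auto intro: free_rank_mults)
  then have "free_rank (fst ` L) (Suc 0)" "free_rank (zero_fiber L) (Suc 0)"
    unfolding lat_int_idx[OF lat_fst[OF assms(1)], symmetric] lat_int_idx[OF lat_zero_fiber[OF assms(1)], symmetric] .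
  from free_rank_product[OF this assms(1) HOL.refl HOL.refl] show ?thesis
    by (simp add: numeral_2_eq_2)
qed

lemma free_rank_4:
  assumes "lat (L :: (plane \<times> plane) set)" "idx L > 0"
  shows "free_rank L 4"
proof -
  have "idx (fst ` L) > 0" "idx (zero_fiber L) > 0" using assms idx_prod[OF assms(1)] by auto
  then have "free_rank (fst ` L) 2" "free_rank (zero_fiber L) 2"
    using free_rank_plane[OF lat_fst[OF assms(1)]] free_rank_plane[OF lat_zero_fiber[OF assms(1)]] by auto
  from free_rank_product[OF this assms(1) HOL.refl HOL.refl] show ?thesis by simp
qed

lemma card_lat_fiber:
  assumes "free_rank P r" "lat M"
  shows "card {L. lat L \<and> fst ` L = P \<and> zero_fiber L = M} = idx M ^ r"
proof -
  have "biadditive.\<omega> (\<lambda>_ _. 0) u v \<in> M" for u v :: 'a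
    using lat_closed(1)[OF assms(2)] by (simp add: biadditive.\<omega>_def[OF biadditive_0])
  then have "card (biadditive.subgroups_over (\<lambda>_ _. 0) P M) = idx M ^ r"
    by (intro biadditive.card_subgroups_over[OF biadditive_0 assms])
  then show ?thesis unfolding biadditive.subgroups_over_def[OF biadditive_0] tw_0 .
qed

subsection \<open>Hermite bases\<close>

text \<open>The lattice with basis \<open>(d1, t)\<close>, \<open>(0, d2)\<close>; every plane lattice of finite index has such a triangular
basis, and \<open>d1 * d2\<close> is its index.\<close>

abbreviation hermite :: "int \<Rightarrow> int \<Rightarrow> int \<Rightarrow> plane set" where
  "hermite d1 t d2 \<equiv> {(i * d1, i * t + j * d2) | i j. True}"

lemma hermite_mem: "(d1, t) \<in> hermite d1 t d2" "(0, d2) \<in> hermite d1 t d2"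
  by (rule CollectI, rule exI[of _ 1], rule exI[of _ 0], simp)
    (rule CollectI, rule exI[of _ 0], rule exI[of _ 1], simp)

lemma hermite_basis:
  assumes "lat (L :: plane set)" "idx L > 0"
  obtains d1 d2 t where "d1 > 0" "d2 > 0" "int (idx L) = d1 * d2"
    "L = hermite d1 t d2"
proof -
  define d1 d2 where "d1 = int (idx (fst ` L))" and "d2 = int (idx (zero_fiber L))"
  have d: "d1 > 0" "d2 > 0" "int (idx L) = d1 * d2"
    using assms idx_prod[OF assms(1)] by (auto simp: d1_def d2_def)
  have f: "fst ` L = mults d1" "zero_fiber L = mults d2"
    using lat_int_idx[OF lat_fst[OF assms(1)]] lat_int_idx[OF lat_zero_fiber[OF assms(1)]]
    by (simp_all add: d1_def d2_def)
  have "d1 \<in> fst ` L" unfolding f by (simp add: mults_def)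
  then obtain t where t: "(d1, t) \<in> L" by force
  have "L = hermite d1 t d2"
  proof (intro equalityI subsetI)
    fix x assume x: "x \<in> L"
    have "fst x \<in> mults d1" using x f by auto
    then obtain i where i: "fst x = i * d1" by (auto simp: mults_def dvd_def mult.commute)
    have "x - zmul i (d1, t) \<in> L" using lat_closed(3)[OF assms(1) x lat_zmul[OF assms(1) t]] .
    moreover have "x - zmul i (d1, t) = (0, snd x - i * t)"
      using i by (simp add: prod_eq_iff zmul_prod[of i "(d1, t)"])
    ultimately have "snd x - i * t \<in> mults d2" using f(2) by (auto simp: zero_fiber_def)
    then obtain j where "snd x - i * t = j * d2" by (auto simp: mults_def dvd_def mult.commute)
    then have "x = (i * d1, i * t + j * d2)" using i by (simp add: prod_eq_iff)
    then show "x \<in> hermite d1 t d2" by blast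
  next
    fix x assume "x \<in> hermite d1 t d2"
    then obtain i j where x: "x = (i * d1, i * t + j * d2)" by blast
    have "j * d2 \<in> zero_fiber L" unfolding f by (simp add: mults_def)
    then have "(0, j * d2) \<in> L" by (simp add: zero_fiber_def)
    then have "zmul i (d1, t) + (0, j * d2) \<in> L"
      using lat_closed(2)[OF assms(1) lat_zmul[OF assms(1) t]] by blast
    then show "x \<in> L" by (simp add: x zmul_prod[of i "(d1, t)"])
  qed
  then show thesis using that d by blast
qed

lemma lat_hermite: "lat (hermite d1 t d2)"
  unfolding lat_iff
proof (intro conjI ballI)
  show "0 \<in> hermite d1 t d2"
    by (auto simp: zero_prod_def intro!: exI[of _ 0])
  fix x y assume "x \<in> hermite d1 t d2" "y \<in> hermite d1 t d2"
  then obtain i j k l where "x = (i * d1, i * t + j * d2)" "y = (k * d1, k * t + l * d2)" by blast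
  then have "x - y = ((i - k) * d1, (i - k) * t + (j - l) * d2)" by (simp add: algebra_simps)
  then show "x - y \<in> hermite d1 t d2" by blast
qed

lemma idx_hermite:
  assumes "d1 > 0" "d2 > 0"
  shows "idx (hermite d1 t d2) = nat (d1 * d2)"
proof -
  let ?L = "hermite d1 t d2"
  have "fst ` ?L = mults d1"
    unfolding mults_range by force
  moreover have "zero_fiber ?L = mults d2"
    unfolding mults_range zero_fiber_def using assms by auto
  ultimately show ?thesis
    using idx_prod[OF lat_hermite, of d1 t d2] assms by (simp add: idx_mults nat_mult_distrib)
qed

lemma plane_eq_if_idx:
  assumes "lat (K :: plane set)" "lat L" "K \<subseteq> L" "idx K \<le> idx L" "idx K > 0"
  shows "K = L"
proof (rule eq_if_same_fst_zero_fiber[OF assms(1-3)])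
  define a b c d where "a = idx (fst ` K)" and "b = idx (zero_fiber K)" and "c = idx (fst ` L)" and "d = idx (zero_fiber L)"
  have e: "fst ` K = mults (int a)" "zero_fiber K = mults (int b)" "fst ` L = mults (int c)" "zero_fiber L = mults (int d)"
    using lat_int_idx lat_fst lat_zero_fiber assms(1,2) by (auto simp: a_def b_def c_def d_def)
  have "fst ` K \<subseteq> fst ` L" "zero_fiber K \<subseteq> zero_fiber L" using assms(3) by (auto simp: zero_fiber_def)
  then have dv: "c dvd a" "d dvd b" unfolding e mults_subset_iff by simp_all
  have "a * b = idx K" "c * d = idx L"
    using idx_prod[OF assms(1)] idx_prod[OF assms(2)] by (auto simp: a_def b_def c_def d_def)
  then have le: "a * b \<le> c * d" and "a * b > 0" using assms(4,5) by simp_all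
  then have pos: "a > 0" "b > 0" by simp_all
  have "c \<le> a" "d \<le> b" using dv pos by (auto simp: dvd_imp_le)
  then have "a = c" "b = d" 
    using le pos mult_less_le_imp_less[of c a d b] mult_le_less_imp_less[of c a d b]
    by (force simp: le_less)+
  then show "fst ` L \<subseteq> fst ` K" "zero_fiber L \<subseteq> zero_fiber K" unfolding e by auto
qed

subsection \<open>Dilations and primitive lattices\<close>

definition dilate :: "int \<Rightarrow> plane set \<Rightarrow> plane set" where
  "dilate g L = (\<lambda>x. (g * fst x, g * snd x)) ` L"

lemma dilate_basis:
  "dilate g (hermite d1 t d2) = hermite (g * d1) (g * t) (g * d2)"
  by (force simp: dilate_def algebra_simps image_iff)

lemma dilate_dilate: "dilate g (dilate h L) = dilate (g * h) L"
  by (force simp: dilate_def image_image algebra_simps)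

lemma dilate_1 [simp]: "dilate 1 L = L"
  by (simp add: dilate_def)

lemma inj_dilate: "g \<noteq> 0 \<Longrightarrow> dilate g K = dilate g L \<Longrightarrow> K = L"
  unfolding dilate_def by (subst (asm) inj_image_eq_iff) (auto simp: inj_def prod_eq_iff)

lemma lat_dilate:
  assumes "lat L"
  shows "lat (dilate g L)"
  unfolding lat_iff
proof (intro conjI ballI)
  show "0 \<in> dilate g L" using lat_closed(1)[OF assms] by (force simp: dilate_def zero_prod_def)
  fix x y assume "x \<in> dilate g L" "y \<in> dilate g L"
  then obtain v w where "v \<in> L" "w \<in> L" "x = (g * fst v, g * snd v)" "y = (g * fst w, g * snd w)"
    by (auto simp: dilate_def)
  then have "x - y = (g * fst (v - w), g * snd (v - w))" "v - w \<in> L"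
    using lat_closed(3)[OF assms] by (auto simp: algebra_simps)
  then show "x - y \<in> dilate g L" unfolding dilate_def by blast
qed

lemma idx_dilate:
  assumes "lat L" "g > 0"
  shows "idx (dilate g L) = nat (g ^ 2) * idx L"
proof -
  define a b where "a = idx (fst ` L)" and "b = idx (zero_fiber L)"
  have e: "fst ` L = mults (int a)" "zero_fiber L = mults (int b)"
    using lat_int_idx lat_fst lat_zero_fiber assms(1) by (auto simp: a_def b_def)
  have "fst ` dilate g L = (*) g ` mults (int a)" unfolding e(1)[symmetric] by (force simp: dilate_def)
  also have "\<dots> = mults (g * int a)" by (auto simp: mults_range image_image mult.left_commute image_iff)
  finally have 1: "fst ` dilate g L = mults (g * int a)" .
  have "zero_fiber (dilate g L) = (*) g ` mults (int b)"
    unfolding e(2)[symmetric] using assms(2) by (force simp: dilate_def zero_fiber_def)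
  also have "\<dots> = mults (g * int b)" by (auto simp: mults_range image_image mult.left_commute image_iff)
  finally have 2: "zero_fiber (dilate g L) = mults (g * int b)" .
  show ?thesis
    using idx_prod[OF lat_dilate[OF assms(1)], of g] idx_prod[OF assms(1)] assms(2) unfolding 1 2
    by (simp add: idx_mults nat_mult_distrib power2_eq_square a_def b_def)
qed

lemma dilate_if_divisible:
  assumes "lat L" "\<And>x. x \<in> L \<Longrightarrow> g dvd fst x \<and> g dvd snd x"
  obtains K where "lat K" "L = dilate g K"
proof
  define K where "K = {x. (g * fst x, g * snd x) \<in> L}"
  show "lat K" using lat_closed[OF assms(1)]
    by (fastforce simp: K_def lat_iff zero_prod_def algebra_simps)
  show "L = dilate g K"
  proof (intro equalityI subsetI)
    fix x assume x: "x \<in> L"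
    then obtain a b where "fst x = g * a" "snd x = g * b" using assms(2) by (meson dvdE)
    then have "x = (g * a, g * b)" by (simp add: prod_eq_iff)
    then show "x \<in> dilate g K" using x unfolding K_def dilate_def
      by (intro image_eqI[of _ _ "(a, b)"]) simp_all
  qed (auto simp: K_def dilate_def)
qed

definition primitive_lat :: "plane set \<Rightarrow> bool" where
  "primitive_lat L \<longleftrightarrow> lat L \<and> idx L > 0 \<and> (\<forall>g>1. \<exists>x\<in>L. \<not> (g dvd fst x \<and> g dvd snd x))"

lemma primitive_part:
  assumes "lat L" "idx L > 0"
  shows "\<exists>c K. c > 0 \<and> primitive_lat K \<and> L = dilate c K"
  using assms
proof (induction "idx L" arbitrary: L rule: less_induct)
  case less
  show ?case
  proof (cases "primitive_lat L")
    case True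
    then show ?thesis by (intro exI[of _ 1] exI[of _ L]) auto
  next
    case False
    then obtain g where g: "g > 1" "\<And>x. x \<in> L \<Longrightarrow> g dvd fst x \<and> g dvd snd x"
      using less by (auto simp: primitive_lat_def)
    obtain K where K: "lat K" "L = dilate g K" using dilate_if_divisible[OF less(2) g(2)] .
    have e: "idx L = nat (g ^ 2) * idx K" using idx_dilate[OF K(1), of g] K(2) g(1) by simp
    then have "idx K > 0" using less(3) by (cases "idx K = 0") simp_all
    moreover have "g ^ 2 > 1" using g(1) by (simp add: one_less_power)
    then have "1 * idx K < nat (g ^ 2) * idx K"
      using \<open>idx K > 0\<close> by (intro mult_strict_right_mono) simp_all
    ultimately have "idx K < idx L" "idx K > 0" using e by simp_all
    then obtain c K' where "c > 0" "primitive_lat K'" "K = dilate c K'" using less(1)[OF _ K(1)] by blast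
    then show ?thesis using K(2) g(1) by (intro exI[of _ "g * c"] exI[of _ K']) (auto simp: dilate_dilate)
  qed
qed

text \<open>A coprime factor \<open>v\<close> would divide all vectors of the primitive lattice.\<close>

lemma dilation_factor_1:
  assumes "dilate u L = dilate v K" "coprime u v" "v > 0" "primitive_lat L"
  shows "v = 1"
proof (rule ccontr)
  assume "v \<noteq> 1"
  then have "v > 1" using assms(3) by simp
  then obtain x where x: "x \<in> L" "\<not> (v dvd fst x \<and> v dvd snd x)" using assms(4) by (auto simp: primitive_lat_def)
  have "(u * fst x, u * snd x) \<in> dilate u L" unfolding dilate_def using x(1) by (rule imageI)
  then have "(u * fst x, u * snd x) \<in> dilate v K" unfolding assms(1) .
  then have "v dvd u * fst x" "v dvd u * snd x" by (auto simp: dilate_def)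
  then show False using x(2) assms(2) by (simp add: coprime_commute coprime_dvd_mult_right_iff)
qed

lemma primitive_part_unique:
  assumes "dilate u L = dilate v K" "u > 0" "v > 0" "primitive_lat L" "primitive_lat K"
  shows "u = v \<and> L = K"
proof -
  define g where "g = gcd u v"
  have g: "g > 0" using assms(2) by (simp add: g_def)
  obtain u' v' where "u = u' * gcd u v" "v = v' * gcd u v" "coprime u' v'"
    using gcd_coprime_exists[of u v] assms(2) by auto
  then have uv: "u = g * u'" "v = g * v'" "coprime u' v'"
    unfolding g_def by (metis mult.commute)+
  have pos: "u' > 0" "v' > 0" using uv(1,2) assms(2,3) g by (simp_all add: zero_less_mult_iff)
  have "dilate (g * u') L = dilate (g * v') K" using assms(1) unfolding uv(1) uv(2) .
  then have "dilate g (dilate u' L) = dilate g (dilate v' K)" unfolding dilate_dilate .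
  then have eq: "dilate u' L = dilate v' K" using inj_dilate[of g] g by simp
  have "coprime v' u'" using uv(3) by (simp add: coprime_commute)
  then have "v' = 1" "u' = 1"
    using dilation_factor_1[OF eq uv(3) pos(2) assms(4)]
      dilation_factor_1[OF eq[symmetric] _ pos(1) assms(5)] by blast+
  then show ?thesis using uv eq by simp
qed

subsection \<open>The number of lattices of prime power index\<close>

text \<open>A plane lattice of index \<open>p\<^sup>n\<close> has image \<open>p\<^bsup>n-i\<^esup>\<int>\<close> and kernel \<open>p\<^sup>i\<int>\<close> under the first projection for some
\<open>i \<le> n\<close>, and \<open>p\<^sup>i\<close> lattices belong to each \<open>i\<close>.\<close>

lemma card_lat_prime_power:
  assumes "prime (p::nat)"
  shows "card {L :: plane set. lat L \<and> idx L = p ^ n} = (\<Sum>i\<le>n. p ^ i)"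
    and "finite {L :: plane set. lat L \<and> idx L = p ^ n}"
proof -
  define A :: "nat \<Rightarrow> plane set set" where
    "A i = {L. lat L \<and> fst ` L = mults (int (p ^ (n - i))) \<and> zero_fiber L = mults (int (p ^ i))}" for i
  have p0: "p > 0" using assms prime_gt_0_nat by auto
  have cA: "card (A i) = p ^ i" for i
    unfolding A_def using card_lat_fiber[OF free_rank_mults lat_mults, of "int (p ^ (n - i))"] p0
    by (simp add: idx_mults nat_power_eq)
  have fA: "finite (A i)" for i
    by (rule card_ge_0_finite) (use cA p0 in simp)
  have eq: "{L :: plane set. lat L \<and> idx L = p ^ n} = (\<Union>i\<le>n. A i)"
  proof (intro equalityI subsetI)
    fix L :: "plane set" assume "L \<in> {L. lat L \<and> idx L = p ^ n}"
    then have L: "lat L" "idx (fst ` L) * idx (zero_fiber L) = p ^ n" using idx_prod[of L] by auto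
    then have "idx (zero_fiber L) dvd p ^ n" by (metis dvd_triv_right)
    then obtain i where i: "i \<le> n" "idx (zero_fiber L) = p ^ i"
      using divides_primepow_nat[OF assms] by auto
    have "p ^ n = p ^ (n - i) * p ^ i" using i(1) by (simp add: power_add[symmetric])
    then have "idx (fst ` L) = p ^ (n - i)" using L(2) i(2) p0 by simp
    then have "L \<in> A i"
      using L(1) i lat_int_idx[OF lat_fst[OF L(1)]] lat_int_idx[OF lat_zero_fiber[OF L(1)]] by (simp add: A_def)
    then show "L \<in> (\<Union>i\<le>n. A i)" using i by blast
  next
    fix L assume "L \<in> (\<Union>i\<le>n. A i)"
    then obtain i where i: "i \<le> n" "L \<in> A i" by blast
    then have "lat L" "idx L = p ^ (n - i) * p ^ i"
      using idx_prod[of L] by (simp_all add: A_def idx_mults nat_power_eq)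
    then show "L \<in> {L. lat L \<and> idx L = p ^ n}" using i(1) by (simp add: power_add[symmetric])
  qed
  have disj: "A i \<inter> A j = {}" if "i \<noteq> j" for i j
  proof -
    have "mults (int (p ^ i)) \<noteq> mults (int (p ^ j))"
      using that prime_gt_1_nat[OF assms] by (subst mults_eq_iff) (auto simp: power_inject_exp)
    then show ?thesis by (auto simp: A_def)
  qed
  show "card {L :: plane set. lat L \<and> idx L = p ^ n} = (\<Sum>i\<le>n. p ^ i)"
    unfolding eq using fA disj cA by (subst card_UN_disjoint) auto
  show "finite {L :: plane set. lat L \<and> idx L = p ^ n}"
    unfolding eq using fA by auto
qed

text \<open>A common divisor of all vectors has square dividing the index, so in prime power index it may be
taken to be \<open>p\<close>. Subtracting these lattices from all lattices leaves the primitive ones.\<close>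

lemma nonprimitive_prime_power:
  assumes "prime (p::nat)"
  shows "{L. lat L \<and> idx L = p ^ n \<and> \<not> primitive_lat L} =
    (if n < 2 then {} else dilate (int p) ` {L. lat L \<and> idx L = p ^ (n - 2)})" (is "?N = _")
proof -
  have p0: "p > 1" using assms prime_gt_1_nat by auto
  have 1: "\<exists>K. lat K \<and> L = dilate (int p) K \<and> n \<ge> 2 \<and> idx K = p ^ (n - 2)" if L: "L \<in> ?N" for L
  proof -
    obtain g where g: "g > 1" "\<And>x. x \<in> L \<Longrightarrow> g dvd fst x \<and> g dvd snd x"
      using L p0 by (auto simp: primitive_lat_def)
    obtain K where K: "lat K" "L = dilate g K" using dilate_if_divisible[OF _ g(2)] L by blast
    have i: "nat (g ^ 2) * idx K = p ^ n" using idx_dilate[OF K(1), of g] K(2) g(1) L by simp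
    moreover have "nat (g ^ 2) = nat g * nat g" using g(1) by (simp add: power2_eq_square nat_mult_distrib)
    ultimately have "nat g dvd p ^ n" by (intro dvdI[of "p ^ n" "nat g" "nat g * idx K"]) simp
    then obtain i where i: "nat g = p ^ i" using divides_primepow_nat[OF assms] by auto
    have "i \<noteq> 0" using i g(1) by (intro notI) simp
    then have "p dvd nat g" unfolding i by simp
    then have "int p dvd g" using g(1) by (simp add: int_dvd_int_iff[symmetric])
    then have "\<And>x. x \<in> L \<Longrightarrow> int p dvd fst x \<and> int p dvd snd x" using g(2) dvd_trans by blast
    then obtain K where K: "lat K" "L = dilate (int p) K" using dilate_if_divisible[of L "int p"] L by blast
    have i: "p ^ 2 * idx K = p ^ n" using idx_dilate[OF K(1), of "int p"] K(2) p0 L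
      by (simp add: nat_power_eq)
    then have "p ^ 2 dvd p ^ n" by (metis dvd_triv_left)
    then have n: "n \<ge> 2" using p0 by (simp add: power_dvd_imp_le)
    then have "p ^ n = p ^ 2 * p ^ (n - 2)" by (metis le_add_diff_inverse power_add)
    then show ?thesis using i K n p0 by auto
  qed
  have 2: "dilate (int p) K \<in> ?N" if "n \<ge> 2" "lat K" "idx K = p ^ (n - 2)" for K
  proof -
    have "p ^ n = p ^ 2 * p ^ (n - 2)" using that(1) by (metis le_add_diff_inverse power_add)
    then have "idx (dilate (int p) K) = p ^ n"
      using idx_dilate[OF that(2), of "int p"] p0 that by (simp add: nat_power_eq)
    moreover have "\<not> primitive_lat (dilate (int p) K)"
      using p0 by (auto simp: primitive_lat_def dilate_def intro!: exI[of _ "int p"])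
    ultimately show ?thesis using lat_dilate[OF that(2)] by auto
  qed
  show ?thesis
  proof (cases "n < 2")
    case True
    then have "?N = {}" using 1 by (metis (no_types, lifting) ex_in_conv not_le)
    then show ?thesis using True by simp
  next
    case False
    have "?N = dilate (int p) ` {L. lat L \<and> idx L = p ^ (n - 2)}"
    proof (intro equalityI subsetI)
      fix L assume "L \<in> ?N"
      from 1[OF this] show "L \<in> dilate (int p) ` {L. lat L \<and> idx L = p ^ (n - 2)}" by blast
    next
      fix L assume "L \<in> dilate (int p) ` {L. lat L \<and> idx L = p ^ (n - 2)}"
      then obtain K where "lat K" "idx K = p ^ (n - 2)" "L = dilate (int p) K" by blast
      then show "L \<in> ?N" using 2[of K] False by simp
    qed
    then show ?thesis using False by simp
  qed
qed

lemma card_primitive_prime_power: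
  assumes "prime (p::nat)"
  shows "card {L. primitive_lat L \<and> idx L = p ^ n} = (if n = 0 then 1 else p ^ n + p ^ (n - 1))"
    and "finite {L. primitive_lat L \<and> idx L = p ^ n}"
proof -
  have p0: "p > 0" using assms prime_gt_0_nat by auto
  let ?A = "{L :: plane set. lat L \<and> idx L = p ^ n}"
  let ?N = "{L. lat L \<and> idx L = p ^ n \<and> \<not> primitive_lat L}"
  have "{L. primitive_lat L \<and> idx L = p ^ n} = ?A - ?N" by (auto simp: primitive_lat_def)
  moreover have fin: "finite ?A" by (rule card_lat_prime_power[OF assms])
  ultimately have "card {L. primitive_lat L \<and> idx L = p ^ n} = card ?A - card ?N"
    by (simp add: card_Diff_subset finite_subset[OF _ fin] subset_iff)
  moreover have "card ?N = (if n < 2 then 0 else (\<Sum>i\<le>n - 2. p ^ i))"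
  proof -
    have "inj_on (dilate (int p)) S" for S
      by (rule inj_onI) (use inj_dilate[of "int p"] p0 in simp)
    then show ?thesis
      by (simp add: nonprimitive_prime_power[OF assms] card_image card_lat_prime_power[OF assms])
  qed
  ultimately have c: "card {L. primitive_lat L \<and> idx L = p ^ n} = (\<Sum>i\<le>n. p ^ i) - (if n < 2 then 0 else (\<Sum>i\<le>n - 2. p ^ i))"
    by (simp add: card_lat_prime_power[OF assms])
  consider "n = 0" | "n = 1" | m where "n = Suc (Suc m)" by (metis One_nat_def not0_implies_Suc)
  then show "card {L. primitive_lat L \<and> idx L = p ^ n} = (if n = 0 then 1 else p ^ n + p ^ (n - 1))"
    unfolding c by cases auto
  show "finite {L. primitive_lat L \<and> idx L = p ^ n}"
    by (rule finite_subset[OF _ fin]) (auto simp: primitive_lat_def)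
qed

section \<open>A Heisenberg model of the group\<close>

definition det2 :: "int \<times> int \<Rightarrow> int \<times> int \<Rightarrow> int" where
  "det2 v w = fst v * snd w - snd v * fst w"

text \<open>The coordinates of an element are \<open>((v, r), z)\<close> with \<open>v = (x\<^sub>1, y\<^sub>2)\<close>, \<open>r = (x\<^sub>2, y\<^sub>1)\<close> and \<open>z = (z\<^sub>2, z\<^sub>1)\<close>, the
exponents in the normal form \<open>x\<^sub>1 x\<^sub>2 y\<^sub>1 y\<^sub>2 z\<^sub>1 z\<^sub>2\<close>; the cocycle comes from moving the \<open>x\<close>-part of the second factor
to the left past the \<open>y\<close>-part of the first. In this order \<open>v\<close> and \<open>r\<close> are the constant and the
\<open>\<epsilon>\<close>-part of a vector over \<open>\<int>[\<epsilon>]\<close>, and the second coordinate of \<open>z\<close> is the \<open>\<epsilon>\<close>-part of a central element,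
so that the \<open>zero_fiber\<close> of a lattice of vectors or of central elements picks out the multiples of \<open>\<epsilon>\<close> in it.\<close>

definition cocycle :: "plane \<times> plane \<Rightarrow> plane \<times> plane \<Rightarrow> plane" where
  "cocycle x y = (- (snd (fst x) * fst (fst y)),
     - (snd (snd x) * fst (fst y) + snd (fst x) * fst (snd y)))"

type_synonym heis_elt = "(plane \<times> plane) \<times> plane"

abbreviation heis :: "heis_elt monoid" where "heis \<equiv> tw cocycle"

abbreviation heis_mult :: "heis_elt \<Rightarrow> heis_elt \<Rightarrow> heis_elt" (infixl "\<star>" 70) where
  "x \<star> y \<equiv> x \<otimes>\<^bsub>heis\<^esub> y"

interpretation heis: biadditive cocycle
  by unfold_locales (simp_all add: cocycle_def algebra_simps)

text \<open>The commutator form is the determinant over \<open>\<int>[\<epsilon>]\<close>, split into its constant part and its \<open>\<epsilon>\<close>-part.\<close>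

lemma omega_eq:
  "heis.\<omega> x y = (det2 (fst x) (fst y), det2 (fst x) (snd y) + det2 (snd x) (fst y))"
  by (simp add: heis.\<omega>_def cocycle_def det2_def algebra_simps)

lemma det2_self [simp]: "det2 v v = 0"
  by (simp add: det2_def)

lemma det2_0 [simp]: "det2 (0, 0) v = 0" "det2 v (0, 0) = 0" "det2 0 v = 0" "det2 v 0 = 0"
  by (simp_all add: det2_def)

section \<open>Normal forms\<close>

text \<open>Conjugation by \<open>y\<close> is an endomorphism sending \<open>x\<close> to \<open>x z\<close>; apply it to \<open>x\<^sup>a\<close>.\<close>

lemma (in group) int_pow_commutator1:
  assumes "x \<in> carrier G" "y \<in> carrier G" "z \<in> carrier G"
    and xy: "x \<otimes> y = y \<otimes> x \<otimes> z" and zx: "x \<otimes> z = z \<otimes> x"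
  shows "x [^] (a::int) \<otimes> y = y \<otimes> x [^] a \<otimes> z [^] a"
proof -
  define c where "c = (\<lambda>w. inv y \<otimes> w \<otimes> y)"
  have "c \<in> hom G G"
  proof (rule homI)
    fix v w assume "v \<in> carrier G" "w \<in> carrier G"
    then show "c (v \<otimes> w) = c v \<otimes> c w" using assms(2)
      by (simp add: c_def m_assoc) (simp add: m_assoc[symmetric])
  qed (use assms in \<open>auto simp: c_def\<close>)
  then have "c (x [^] a) = c x [^] a"
    by (rule hom_int_pow) (use assms in auto)
  moreover have "c x = x \<otimes> z"
    using assms(1-3) unfolding c_def by (simp add: m_assoc xy) (simp add: m_assoc[symmetric])
  moreover have "(x \<otimes> z) [^] a = x [^] a \<otimes> z [^] a"
    by (rule int_pow_mult_distrib[OF zx]) (use assms in auto)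
  ultimately have "inv y \<otimes> x [^] a \<otimes> y = x [^] a \<otimes> z [^] a" by (simp add: c_def)
  then have "y \<otimes> (inv y \<otimes> x [^] a \<otimes> y) = y \<otimes> (x [^] a \<otimes> z [^] a)" by simp
  then show ?thesis using assms(1-3) by (simp add: m_assoc[symmetric])
qed

lemma (in group) int_pow_commutator:
  assumes "x \<in> carrier G" "y \<in> carrier G" "z \<in> carrier G"
    and xy: "x \<otimes> y = y \<otimes> x \<otimes> z" and zx: "x \<otimes> z = z \<otimes> x" and zy: "y \<otimes> z = z \<otimes> y"
  shows "y [^] (b::int) \<otimes> x [^] (a::int) = x [^] a \<otimes> (y [^] b \<otimes> z [^] (- (a * b)))"
proof -
  define x' z' where "x' = x [^] a" and "z' = z [^] a"
  have c: "x' \<in> carrier G" "z' \<in> carrier G" using assms by (auto simp: x'_def z'_def)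
  have 1: "x' \<otimes> y = y \<otimes> x' \<otimes> z'"
    unfolding x'_def z'_def by (rule int_pow_commutator1[OF assms(1-5)])
  have "y \<otimes> x' \<otimes> z' \<otimes> inv z' = x' \<otimes> y \<otimes> inv z'" using 1 by simp
  then have "y \<otimes> x' = x' \<otimes> y \<otimes> inv z'" using c assms(2) by (simp add: m_assoc)
  moreover have "y \<otimes> inv z' = inv z' \<otimes> y"
    using int_pow_commutator1[of z y \<one> "- a"] assms(1-3) zy by (simp add: z'_def int_pow_neg)
  ultimately have "y [^] b \<otimes> x' = x' \<otimes> y [^] b \<otimes> (inv z') [^] b"
    using c assms(2) by (intro int_pow_commutator1) auto
  moreover have "(inv z') [^] b = z [^] (- (a * b))"
    using assms(3) by (simp add: z'_def int_pow_neg[symmetric] int_pow_pow)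
  ultimately show ?thesis using c assms by (simp add: x'_def m_assoc)
qed

text \<open>Elements satisfying the defining relations, in any group. The system is used twice: in the presented
group, where it gives the normal form, and in a subgroup \<open>D\<close> of standard form, where it gives the
isomorphism onto \<open>D\<close>.\<close>

locale heis_system = group G for G (structure) +
  fixes x1 x2 y1 y2 z1 z2
  assumes closed: "x1 \<in> carrier G" "x2 \<in> carrier G" "y1 \<in> carrier G" "y2 \<in> carrier G"
      "z1 \<in> carrier G" "z2 \<in> carrier G"
    and rels: "x1 \<otimes> y1 = y1 \<otimes> x1 \<otimes> z1" "x2 \<otimes> y2 = y2 \<otimes> x2 \<otimes> z1" "x1 \<otimes> y2 = y2 \<otimes> x1 \<otimes> z2"
      "x2 \<otimes> y1 = y1 \<otimes> x2" "x1 \<otimes> x2 = x2 \<otimes> x1" "y1 \<otimes> y2 = y2 \<otimes> y1"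
    and central: "x1 \<otimes> z1 = z1 \<otimes> x1" "x2 \<otimes> z1 = z1 \<otimes> x2" "y1 \<otimes> z1 = z1 \<otimes> y1" "y2 \<otimes> z1 = z1 \<otimes> y2"
      "x1 \<otimes> z2 = z2 \<otimes> x1" "x2 \<otimes> z2 = z2 \<otimes> x2" "y1 \<otimes> z2 = z2 \<otimes> y1" "y2 \<otimes> z2 = z2 \<otimes> y2"
      "z1 \<otimes> z2 = z2 \<otimes> z1"
begin

definition nf :: "heis_elt \<Rightarrow> 'a" where
  "nf g = x1 [^] fst (fst (fst g)) \<otimes> (x2 [^] fst (snd (fst g)) \<otimes> (y1 [^] snd (snd (fst g)) \<otimes>
     (y2 [^] snd (fst (fst g)) \<otimes> (z1 [^] snd (snd g) \<otimes> z2 [^] fst (snd g)))))"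

lemma swap_commute:
  assumes "x \<in> carrier G" "y \<in> carrier G" "x \<otimes> y = y \<otimes> x"
  shows "y [^] (b::int) \<otimes> x [^] (a::int) = x [^] a \<otimes> y [^] b"
    "w \<in> carrier G \<Longrightarrow> y [^] (b::int) \<otimes> (x [^] (a::int) \<otimes> w) = x [^] a \<otimes> (y [^] b \<otimes> w)"
proof -
  show 1: "y [^] (b::int) \<otimes> x [^] (a::int) = x [^] a \<otimes> y [^] b"
    using int_pow_commutator[of x y \<one> b a] assms by simp
  show "w \<in> carrier G \<Longrightarrow> y [^] (b::int) \<otimes> (x [^] (a::int) \<otimes> w) = x [^] a \<otimes> (y [^] b \<otimes> w)"
    using assms 1 by (simp add: m_assoc[symmetric])
qed

lemma swap_commutator:
  assumes "x \<in> carrier G" "y \<in> carrier G" "z \<in> carrier G"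
    "x \<otimes> y = y \<otimes> x \<otimes> z" "x \<otimes> z = z \<otimes> x" "y \<otimes> z = z \<otimes> y"
  shows "y [^] (b::int) \<otimes> x [^] (a::int) = x [^] a \<otimes> (y [^] b \<otimes> z [^] (- (a * b)))"
    "w \<in> carrier G \<Longrightarrow> y [^] (b::int) \<otimes> (x [^] (a::int) \<otimes> w) = x [^] a \<otimes> (y [^] b \<otimes> (z [^] (- (a * b)) \<otimes> w))"
proof -
  show 1: "y [^] (b::int) \<otimes> x [^] (a::int) = x [^] a \<otimes> (y [^] b \<otimes> z [^] (- (a * b)))"
    by (rule int_pow_commutator[OF assms])
  show "w \<in> carrier G \<Longrightarrow> y [^] (b::int) \<otimes> (x [^] (a::int) \<otimes> w) = x [^] a \<otimes> (y [^] b \<otimes> (z [^] (- (a * b)) \<otimes> w))"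
    using assms(1-3) 1 by (simp add: m_assoc[symmetric])
qed

lemma merge_powers:
  assumes "x \<in> carrier G"
  shows "x [^] (a::int) \<otimes> x [^] (b::int) = x [^] (a + b)"
    "w \<in> carrier G \<Longrightarrow> x [^] (a::int) \<otimes> (x [^] (b::int) \<otimes> w) = x [^] (a + b) \<otimes> w"
  using assms by (simp_all add: int_pow_mult m_assoc)

text \<open>A terminating rewrite system that sorts products of powers into the order
\<open>x1, x2, y1, y2, z1, z2\<close> and merges equal bases.\<close>

lemmas normalise =
  swap_commute[OF closed(1,2) rels(5)] swap_commute[OF closed(2,3) rels(4)]
  swap_commute[OF closed(3,4) rels(6)] swap_commute[OF closed(1,5) central(1)]
  swap_commute[OF closed(2,5) central(2)] swap_commute[OF closed(3,5) central(3)]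
  swap_commute[OF closed(4,5) central(4)] swap_commute[OF closed(1,6) central(5)]
  swap_commute[OF closed(2,6) central(6)] swap_commute[OF closed(3,6) central(7)]
  swap_commute[OF closed(4,6) central(8)] swap_commute[OF closed(5,6) central(9)]
  swap_commutator[OF closed(1,3,5) rels(1) central(1,3)]
  swap_commutator[OF closed(2,4,5) rels(2) central(2,4)]
  swap_commutator[OF closed(1,4,6) rels(3) central(5,8)]
  merge_powers[OF closed(1)] merge_powers[OF closed(2)] merge_powers[OF closed(3)]
  merge_powers[OF closed(4)] merge_powers[OF closed(5)] merge_powers[OF closed(6)]

lemma nf_hom: "nf \<in> hom heis G"
proof (rule homI)
  show "nf g \<in> carrier G" for g using closed by (simp add: nf_def)
  fix g h :: "heis_elt"
  obtain a b c d e f where g: "g = (((a, b), (c, d)), (e, f))" by (metis prod.collapse)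
  obtain a' b' c' d' e' f' where h: "h = (((a', b'), (c', d')), (e', f'))" by (metis prod.collapse)
  have 1: "nf g = x1 [^] a \<otimes> (x2 [^] c \<otimes> (y1 [^] d \<otimes> (y2 [^] b \<otimes> (z1 [^] f \<otimes> z2 [^] e))))"
    "nf h = x1 [^] a' \<otimes> (x2 [^] c' \<otimes> (y1 [^] d' \<otimes> (y2 [^] b' \<otimes> (z1 [^] f' \<otimes> z2 [^] e'))))"
    by (simp_all add: nf_def g h)
  have "nf g \<otimes> nf h =
    x1 [^] (a + a') \<otimes> (x2 [^] (c + c') \<otimes> (y1 [^] (d + d') \<otimes>
     (y2 [^] (b + b') \<otimes> (z1 [^] (f + f' - (d * a' + b * c')) \<otimes> z2 [^] (e + e' - b * a')))))"
    unfolding 1 using closed by (simp add: m_assoc normalise) (simp add: algebra_simps)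
  moreover have "nf (g \<star> h) =
    x1 [^] (a + a') \<otimes> (x2 [^] (c + c') \<otimes> (y1 [^] (d + d') \<otimes>
     (y2 [^] (b + b') \<otimes> (z1 [^] (f + f' - (d * a' + b * c')) \<otimes> z2 [^] (e + e' - b * a')))))"
    by (simp add: nf_def g h cocycle_def algebra_simps)
  ultimately show "nf (g \<star> h) = nf g \<otimes> nf h" by (simp only:)
qed

lemma nf_gens:
  "nf (((1, 0), (0, 0)), (0, 0)) = x1" "nf (((0, 0), (1, 0)), (0, 0)) = x2"
  "nf (((0, 0), (0, 1)), (0, 0)) = y1" "nf (((0, 1), (0, 0)), (0, 0)) = y2"
  "nf (((0, 0), (0, 0)), (0, 1)) = z1" "nf (((0, 0), (0, 0)), (1, 0)) = z2"
  using closed by (simp_all add: nf_def int_pow_1)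

end

section \<open>The presented group\<close>

primrec gen_val :: "gen_t2 \<Rightarrow> heis_elt" where
  "gen_val GX1 = (((1, 0), (0, 0)), (0, 0))"
| "gen_val GX2 = (((0, 0), (1, 0)), (0, 0))"
| "gen_val GY1 = (((0, 0), (0, 1)), (0, 0))"
| "gen_val GY2 = (((0, 1), (0, 0)), (0, 0))"
| "gen_val GZ1 = (((0, 0), (0, 0)), (0, 1))"
| "gen_val GZ2 = (((0, 0), (0, 0)), (1, 0))"

definition letter_val :: "gen_t2 \<times> bool \<Rightarrow> heis_elt" where
  "letter_val l = (if snd l then gen_val (fst l) else inv\<^bsub>heis\<^esub> gen_val (fst l))"

text \<open>Evaluation of words in the model. It respects the relations and so provides the inverse of the
normal form map.\<close>

definition word_val :: "gen_t2 word \<Rightarrow> heis_elt" where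
  "word_val w = foldr (\<lambda>l x. letter_val l \<star> x) w \<one>\<^bsub>heis\<^esub>"

lemma word_val_Nil [simp]: "word_val [] = \<one>\<^bsub>heis\<^esub>"
  by (simp add: word_val_def)

lemma word_val_Cons [simp]: "word_val (l # w) = letter_val l \<star> word_val w"
  by (simp add: word_val_def)

lemma word_val_append: "word_val (u @ v) = word_val u \<star> word_val v"
proof (induction u)
  case Nil
  show ?case by simp
next
  case (Cons l u)
  then show ?case
    using heis.G.m_assoc[of "letter_val l" "word_val u" "word_val v"] by (simp del: tw_simps(3))
qed

lemma letter_val_cancel: "letter_val (g, e) \<star> letter_val (g, \<not> e) = \<one>\<^bsub>heis\<^esub>"
  by (cases g; cases e) (simp_all add: letter_val_def cocycle_def zero_prod_def)

lemma word_val_rels: "(u, v) \<in> rels_t2 \<Longrightarrow> word_val u = word_val v"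
  unfolding rels_t2_def
  by (auto simp: comm_t2_def comm_word_def inv_word_def gen_word_def letter_val_def cocycle_def zero_prod_def)

lemma word_val_pres_eq: "pres_eq rels_t2 u v \<Longrightarrow> word_val u = word_val v"
proof (induction rule: pres_eq.induct)
  case (cancel a g e b)
  have "word_val ([(g, e), (g, \<not> e)] @ b) = (letter_val (g, e) \<star> letter_val (g, \<not> e)) \<star> word_val b"
    using heis.G.m_assoc[of "letter_val (g, e)" "letter_val (g, \<not> e)" "word_val b"]
    by (simp del: tw_simps(3))
  also have "\<dots> = word_val b" unfolding letter_val_cancel by simp
  finally show ?case by (simp only: word_val_append)
next
  case (rel u v a b)
  then show ?case using word_val_rels by (simp add: word_val_append)
qed auto

lemma group_Gamma: "group Gamma_t2"
  unfolding Gamma_t2_def by (rule group_presented_group)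

abbreviation gen_cls :: "gen_t2 \<Rightarrow> gen_t2 word set" where
  "gen_cls g \<equiv> pres_class rels_t2 (gen_word g)"

lemma Gamma_commutator:
  assumes "(comm_t2 g h, w) \<in> rels_t2"
  shows "gen_cls g \<otimes>\<^bsub>Gamma_t2\<^esub> gen_cls h =
    gen_cls h \<otimes>\<^bsub>Gamma_t2\<^esub> gen_cls g \<otimes>\<^bsub>Gamma_t2\<^esub> pres_class rels_t2 w"
proof -
  let ?u = "gen_word g" and ?v = "gen_word h"
  have "pres_eq rels_t2 (?v @ ?u @ comm_t2 g h) (?v @ ?u @ w)"
    using pres_eq.rel[OF assms, of "?v @ ?u" "[]"] by simp
  moreover have "pres_eq rels_t2 (?v @ ?u @ comm_t2 g h) (?u @ ?v)"
  proof -
    have "pres_eq rels_t2 (?v @ ?u @ comm_t2 g h) (?v @ [(h, False)] @ ?u @ ?v)"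
      using pres_eq.cancel[of rels_t2 ?v g True "[(h, False)] @ ?u @ ?v"]
      by (simp add: comm_t2_def comm_word_def inv_word_def gen_word_def)
    moreover have "pres_eq rels_t2 (?v @ [(h, False)] @ ?u @ ?v) (?u @ ?v)"
      using pres_eq.cancel[of rels_t2 "[]" h True "?u @ ?v"] by (simp add: gen_word_def)
    ultimately show ?thesis by (rule pres_eq.trans)
  qed
  ultimately have "pres_eq rels_t2 (?u @ ?v) (?v @ ?u @ w)"
    by (metis pres_eq.sym pres_eq.trans)
  then show ?thesis unfolding Gamma_t2_def pres_class_mult by (simp add: pres_class_eq_iff)
qed

lemma Gamma_commute:
  assumes "(comm_t2 g h, []) \<in> rels_t2"
  shows "gen_cls g \<otimes>\<^bsub>Gamma_t2\<^esub> gen_cls h = gen_cls h \<otimes>\<^bsub>Gamma_t2\<^esub> gen_cls g"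
  using Gamma_commutator[OF assms] unfolding Gamma_t2_def pres_class_mult by simp

interpretation Gamma: heis_system Gamma_t2 "gen_cls GX1" "gen_cls GX2" "gen_cls GY1" "gen_cls GY2"
  "gen_cls GZ1" "gen_cls GZ2"
proof -
  interpret group Gamma_t2 by (rule group_Gamma)
  have c: "gen_cls g \<in> carrier Gamma_t2" for g by (simp add: Gamma_t2_def presented_group_def)
  show "heis_system Gamma_t2 (gen_cls GX1) (gen_cls GX2) (gen_cls GY1) (gen_cls GY2)
      (gen_cls GZ1) (gen_cls GZ2)"
    by unfold_locales
      ((rule c Gamma_commutator Gamma_commute; unfold rels_t2_def; blast) | rule c)+
qed

lemma heis_int_pow:
  assumes "cocycle u u = 0"
  shows "(u, z) [^]\<^bsub>heis\<^esub> (a::int) = (zmul a u, zmul a z)"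
proof -
  have c: "cocycle (zmul a u) u = 0" for a
    using hom_zmul[of "\<lambda>x. cocycle x u" a u] assms by (simp add: heis.add_left)
  have step: "(u, z) [^]\<^bsub>heis\<^esub> (a + 1) = (u, z) [^]\<^bsub>heis\<^esub> a \<star> (u, z)" for a :: int
    using heis.G.int_pow_mult[of "(u, z)" a 1] heis.G.int_pow_1[of "(u, z)"] by (simp del: tw_simps(3))
  have step': "(u, z) [^]\<^bsub>heis\<^esub> (a - 1) = (u, z) [^]\<^bsub>heis\<^esub> a \<star> inv\<^bsub>heis\<^esub> (u, z)" for a :: int
    using heis.G.int_pow_diff[of "(u, z)" a 1] heis.G.int_pow_1[of "(u, z)"] by (simp del: tw_simps(3) heis.inv_tw)
  show ?thesis
  proof (induction a rule: int_induct[where k = 0])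
    case base
    show ?case by (simp add: zero_prod_def)
  next
    case (step1 a)
    then show ?case unfolding step by (simp add: zmul_add c)
  next
    case (step2 a)
    then show ?case unfolding step' by (simp add: zmul_diff c assms)
  qed
qed

text \<open>Evaluation of words is inverse to \<open>nf\<close>: on normal forms this is a computation of powers, and
\<open>nf\<close> sends the value of a word to the class of the word because it does so on letters.\<close>

lemma nf_in_iso: "Gamma.nf \<in> iso heis Gamma_t2"
proof -
  let ?h = "Gamma.nf"
  interpret h: group_hom heis Gamma_t2 ?h
    using Gamma.nf_hom by (simp add: group_hom_def group_hom_axioms_def heis.group_tw group_Gamma)
  have gen: "?h (gen_val g) = gen_cls g" for g
    by (cases g) (simp_all add: Gamma.nf_gens)
  have letter: "?h (letter_val l) = pres_class rels_t2 [l]" for l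
  proof -
    obtain g e where l: "l = (g, e)" by force
    have "inv\<^bsub>Gamma_t2\<^esub> (gen_cls g) = pres_class rels_t2 [(g, False)]"
    proof (rule Gamma.inv_equality)
      show "pres_class rels_t2 [(g, False)] \<otimes>\<^bsub>Gamma_t2\<^esub> gen_cls g = \<one>\<^bsub>Gamma_t2\<^esub>"
        unfolding Gamma_t2_def pres_class_mult
        using pres_eq.cancel[of rels_t2 "[]" g False "[]"]
        by (simp add: presented_group_def gen_word_def pres_class_eq_iff)
    qed (simp_all add: Gamma_t2_def presented_group_def)
    then show ?thesis
      using h.hom_inv[of "gen_val g"] gen[of g]
      by (simp add: l letter_val_def gen_word_def del: heis.inv_tw)
  qed
  have surj: "?h (word_val w) = pres_class rels_t2 w" for w
  proof (induction w)
    case Nil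
    then show ?case using h.hom_one by (simp add: Gamma_t2_def presented_group_def del: tw_simps(2))
  next
    case (Cons l w)
    then show ?case
      using h.hom_mult[of "letter_val l" "word_val w"] letter[of l]
      by (simp add: Gamma_t2_def pres_class_mult del: tw_simps(3))
  qed
  define val where "val = (\<lambda>C. word_val (SOME w. w \<in> C))"
  have val: "val (pres_class rels_t2 w) = word_val w" for w
  proof -
    have "(SOME v. v \<in> pres_class rels_t2 w) \<in> pres_class rels_t2 w"
      by (rule someI[of _ w]) (simp add: pres_class_def pres_eq.refl)
    then show ?thesis using word_val_pres_eq by (force simp: val_def pres_class_def)
  qed
  have carrier: "carrier Gamma_t2 = range (pres_class rels_t2)"
    by (simp add: Gamma_t2_def presented_group_def)
  have "val (A \<otimes>\<^bsub>Gamma_t2\<^esub> B) = val A \<star> val B"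
    if AB: "A \<in> carrier Gamma_t2" "B \<in> carrier Gamma_t2" for A B
  proof -
    obtain u v where "A = pres_class rels_t2 u" "B = pres_class rels_t2 v"
      using AB unfolding carrier by blast
    then show ?thesis unfolding Gamma_t2_def by (simp only: pres_class_mult val word_val_append)
  qed
  then have val_hom: "val \<in> hom Gamma_t2 heis" by (simp add: hom_def)
  have val_pow: "val (A [^]\<^bsub>Gamma_t2\<^esub> j) = val A [^]\<^bsub>heis\<^esub> j" if "A \<in> carrier Gamma_t2" for A and j :: int
    by (rule hom_int_pow[OF val_hom that group_Gamma heis.group_tw])
  have val_gen: "val (gen_cls g) = gen_val g" for g
    by (simp add: val gen_word_def letter_val_def)
  have inj: "val (?h g) = g" for g
  proof -
    obtain a b c d e f where g: "g = (((a, b), (c, d)), (e, f))" by (metis prod.collapse)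
    show ?thesis using Gamma.closed
      by (simp add: Gamma.nf_def g hom_mult[OF val_hom] val_pow val_gen heis_int_pow cocycle_def
          zero_prod_def zmul_prod)
  qed
  have "bij_betw ?h UNIV (carrier Gamma_t2)"
    unfolding bij_betw_def
  proof
    show "inj ?h" by (rule inj_on_inverseI[of _ val]) (rule inj)
    show "range ?h = carrier Gamma_t2"
      using surj h.hom_closed unfolding carrier by auto
  qed
  then show ?thesis using Gamma.nf_hom by (simp add: iso_def)
qed

section \<open>Subgroups of standard form\<close>

definition commutator_span :: "(plane \<times> plane) set \<Rightarrow> plane set" where
  "commutator_span L = generate addg {heis.\<omega> x y | x y. x \<in> L \<and> y \<in> L}"

lemma lat_commutator_span: "lat (commutator_span L)"
  unfolding commutator_span_def by (rule addg.generate_is_subgroup) simp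

lemma omega_in_commutator_span: "x \<in> L \<Longrightarrow> y \<in> L \<Longrightarrow> heis.\<omega> x y \<in> commutator_span L"
  unfolding commutator_span_def by (rule generate.incl) blast

lemma commutator_span_subset:
  assumes "lat M" "\<And>x y. x \<in> L \<Longrightarrow> y \<in> L \<Longrightarrow> heis.\<omega> x y \<in> M"
  shows "commutator_span L \<subseteq> M"
  unfolding commutator_span_def by (rule addg.generate_subgroup_incl[OF _ assms(1)]) (use assms(2) in blast)

text \<open>Asking \<open>L\<close> to be primitive makes \<open>u\<close>, \<open>v\<close> and \<open>L\<close> unique, so that they can index the count.\<close>

definition homothetic :: "int \<Rightarrow> int \<Rightarrow> plane set \<Rightarrow> (plane \<times> plane) set \<Rightarrow> bool" where
  "homothetic u v L \<Lambda> \<longleftrightarrow> u > 0 \<and> v > 0 \<and> primitive_lat L \<and> lat \<Lambda> \<and> fst ` \<Lambda> = dilate u L \<and> zero_fiber \<Lambda> = dilate v L"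

text \<open>These will turn out to be the subgroups of finite index whose completion is isomorphic to that of
the whole group.\<close>

definition standard_form :: "heis_elt set \<Rightarrow> bool" where
  "standard_form D \<longleftrightarrow> subgroup D heis \<and> (\<exists>u v L. homothetic u v L (fst ` D)) \<and> zero_fiber D = commutator_span (fst ` D)"

lemma zmul_plane: "zmul i (a, b :: int) = (i * a, i * b :: int)"
  by (simp add: zmul_prod)

lemma zmul_plane2: "zmul i (x, y :: plane) = (zmul i x, zmul i y :: plane)"
  by (subst zmul_prod) simp

text \<open>With \<open>g1 = (d1, t)\<close> and \<open>g2 = (0, d2)\<close>, the lattice with basis \<open>(u g1, (a, b))\<close>, \<open>(u g2, (c, e))\<close>, \<open>(0, v g1)\<close>, \<open>(0, v g2)\<close>.
Proportional bases of image and kernel are what homothety provides.\<close>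

abbreviation frame ::
    "int \<Rightarrow> int \<Rightarrow> int \<Rightarrow> int \<Rightarrow> int \<Rightarrow> int \<Rightarrow> int \<Rightarrow> int \<Rightarrow> int \<Rightarrow> (plane \<times> plane) set" where
  "frame u v d1 d2 t a b c e \<equiv>
     {((i * (u * d1), i * (u * t) + j * (u * d2)),
        (i * a + j * c + k * (v * d1), i * b + j * e + k * (v * t) + l * (v * d2))) | i j k l. True}"

lemma frame_mem:
  "((u * d1, u * t), (a, b)) \<in> frame u v d1 d2 t a b c e"
  "((0, u * d2), (c, e)) \<in> frame u v d1 d2 t a b c e"
  "((0, 0), (v * d1, v * t)) \<in> frame u v d1 d2 t a b c e"
  "((0, 0), (0, v * d2)) \<in> frame u v d1 d2 t a b c e"
proof -
  show "((u * d1, u * t), (a, b)) \<in> frame u v d1 d2 t a b c e"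
    by (rule CollectI, rule exI[of _ 1], rule exI[of _ 0], rule exI[of _ 0], rule exI[of _ 0]) simp
  show "((0, u * d2), (c, e)) \<in> frame u v d1 d2 t a b c e"
    by (rule CollectI, rule exI[of _ 0], rule exI[of _ 1], rule exI[of _ 0], rule exI[of _ 0]) simp
  show "((0, 0), (v * d1, v * t)) \<in> frame u v d1 d2 t a b c e"
    by (rule CollectI, rule exI[of _ 0], rule exI[of _ 0], rule exI[of _ 1], rule exI[of _ 0]) simp
  show "((0, 0), (0, v * d2)) \<in> frame u v d1 d2 t a b c e"
    by (rule CollectI, rule exI[of _ 0], rule exI[of _ 0], rule exI[of _ 0], rule exI[of _ 1]) simp
qed

lemma homothetic_basis:
  assumes "homothetic u v L \<Lambda>"
  obtains d1 d2 t a b c e where "d1 > 0" "d2 > 0" "int (idx L) = d1 * d2"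
    "\<Lambda> = frame u v d1 d2 t a b c e"
proof -
  have s: "u > 0" "v > 0" "primitive_lat L" and La: "lat \<Lambda>" and f: "fst ` \<Lambda> = dilate u L" "zero_fiber \<Lambda> = dilate v L"
    using assms by (auto simp: homothetic_def)
  obtain d1 d2 t where d: "d1 > 0" "d2 > 0" "int (idx L) = d1 * d2"
    and L: "L = hermite d1 t d2"
    using hermite_basis[of L] s(3) unfolding primitive_lat_def by blast
  have f1: "fst ` \<Lambda> = hermite (u * d1) (u * t) (u * d2)"
    and k1: "zero_fiber \<Lambda> = hermite (v * d1) (v * t) (v * d2)"
    unfolding f L dilate_basis by (rule HOL.refl)+
  have "(u * d1, u * t) \<in> fst ` \<Lambda>" unfolding f1 by (rule hermite_mem)
  then obtain a b where 1: "((u * d1, u * t), (a, b)) \<in> \<Lambda>" by force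
  have "(0, u * d2) \<in> fst ` \<Lambda>" unfolding f1 by (rule hermite_mem)
  then obtain c e where 2: "((0, u * d2), (c, e)) \<in> \<Lambda>" by force
  have comb: "zmul i ((u * d1, u * t), (a, b)) + zmul j ((0, u * d2), (c, e)) =
      ((i * (u * d1), i * (u * t) + j * (u * d2)), (i * a + j * c, i * b + j * e))" for i j
    by (simp add: zmul_plane zmul_plane2)
  have combL: "((i * (u * d1), i * (u * t) + j * (u * d2)), (i * a + j * c, i * b + j * e)) \<in> \<Lambda>" for i j
    unfolding comb[symmetric] by (rule lat_closed(2)[OF La lat_zmul[OF La 1] lat_zmul[OF La 2]])
  have "\<Lambda> = frame u v d1 d2 t a b c e"
  proof (intro equalityI subsetI)
    fix x assume x: "x \<in> \<Lambda>"
    then have "fst x \<in> fst ` \<Lambda>" by blast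
    then obtain i j where ij: "fst x = (i * (u * d1), i * (u * t) + j * (u * d2))" unfolding f1 by blast
    have "x - ((i * (u * d1), i * (u * t) + j * (u * d2)), (i * a + j * c, i * b + j * e)) \<in> \<Lambda>"
      by (rule lat_closed(3)[OF La x combL])
    moreover have "x - ((i * (u * d1), i * (u * t) + j * (u * d2)), (i * a + j * c, i * b + j * e)) =
        (0, snd x - (i * a + j * c, i * b + j * e))" using ij by (simp add: prod_eq_iff)
    ultimately have "snd x - (i * a + j * c, i * b + j * e) \<in> zero_fiber \<Lambda>" by (simp add: zero_fiber_def)
    then obtain k l where "snd x - (i * a + j * c, i * b + j * e) = (k * (v * d1), k * (v * t) + l * (v * d2))"
      unfolding k1 by blast
    then have "x = ((i * (u * d1), i * (u * t) + j * (u * d2)),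
        (i * a + j * c + k * (v * d1), i * b + j * e + k * (v * t) + l * (v * d2)))"
      using ij by (simp add: prod_eq_iff)
    then show "x \<in> frame u v d1 d2 t a b c e" by blast
  next
    fix x assume "x \<in> frame u v d1 d2 t a b c e"
    then obtain i j k l where x: "x = ((i * (u * d1), i * (u * t) + j * (u * d2)),
        (i * a + j * c + k * (v * d1), i * b + j * e + k * (v * t) + l * (v * d2)))" by blast
    have "(k * (v * d1), k * (v * t) + l * (v * d2)) \<in> zero_fiber \<Lambda>" unfolding k1 by blast
    then have "(0, (k * (v * d1), k * (v * t) + l * (v * d2))) \<in> \<Lambda>" by (simp add: zero_fiber_def)
    then have "((i * (u * d1), i * (u * t) + j * (u * d2)), (i * a + j * c, i * b + j * e))
        + (0, (k * (v * d1), k * (v * t) + l * (v * d2))) \<in> \<Lambda>" by (rule lat_closed(2)[OF La combL])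
    then show "x \<in> \<Lambda>" unfolding x by (simp add: add.assoc)
  qed
  then show thesis using that d by blast
qed

text \<open>In the basis of the frame the only commutators of basis vectors that do not vanish are the two
listed generators: \<open>[u g1 + \<epsilon>(a, b), u g2 + \<epsilon>(c, e)]\<close> and \<open>[u g1, \<epsilon> v g2] = [\<epsilon> v g1, u g2]\<close>. The equality of the
latter two reflects that both pairs of bases are proportional.\<close>

lemma commutator_span_basis:
  assumes L: "\<Lambda> = frame u v d1 d2 t a b c e"
  shows "commutator_span \<Lambda> = hermite (u ^ 2 * (d1 * d2)) (u * d1 * e - u * t * c + a * (u * d2)) (u * v * (d1 * d2))" (is "_ = ?M")
proof
  show "commutator_span \<Lambda> \<subseteq> ?M"
  proof (rule commutator_span_subset[OF lat_hermite])
    fix x y assume "x \<in> \<Lambda>" "y \<in> \<Lambda>"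
    then obtain i j k l i' j' k' l' where
      x: "x = ((i * (u * d1), i * (u * t) + j * (u * d2)),
        (i * a + j * c + k * (v * d1), i * b + j * e + k * (v * t) + l * (v * d2)))" and
      y: "y = ((i' * (u * d1), i' * (u * t) + j' * (u * d2)),
        (i' * a + j' * c + k' * (v * d1), i' * b + j' * e + k' * (v * t) + l' * (v * d2)))"
      unfolding L by blast
    have "heis.\<omega> x y = ((i * j' - j * i') * (u ^ 2 * (d1 * d2)),
       (i * j' - j * i') * (u * d1 * e - u * t * c + a * (u * d2)) +
       (i * l' + k * j' - j * k' - l * i') * (u * v * (d1 * d2)))"
      unfolding omega_eq x y by (simp add: det2_def algebra_simps power2_eq_square)
    then show "heis.\<omega> x y \<in> ?M" by blast
  qed
  define e1 where "e1 = ((u * d1, u * t), (a, b))"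
  define e2 where "e2 = ((0::int, u * d2), (c, e))"
  define f2 where "f2 = ((0::int, 0::int), (0::int, v * d2))"
  have "e1 \<in> \<Lambda>" unfolding L e1_def
    by (rule frame_mem)
  have "e2 \<in> \<Lambda>" unfolding L e2_def
    by (rule frame_mem)
  have "f2 \<in> \<Lambda>" unfolding L f2_def
    by (rule frame_mem)
  have "heis.\<omega> e1 e2 = (u ^ 2 * (d1 * d2), u * d1 * e - u * t * c + a * (u * d2))"
    unfolding omega_eq e1_def e2_def by (simp add: det2_def algebra_simps power2_eq_square)
  then have 1: "(u ^ 2 * (d1 * d2), u * d1 * e - u * t * c + a * (u * d2)) \<in> commutator_span \<Lambda>"
    using omega_in_commutator_span[OF \<open>e1 \<in> \<Lambda>\<close> \<open>e2 \<in> \<Lambda>\<close>] by simp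
  have "heis.\<omega> e1 f2 = (0, u * v * (d1 * d2))"
    unfolding omega_eq e1_def f2_def by (simp add: det2_def algebra_simps)
  then have 2: "(0, u * v * (d1 * d2)) \<in> commutator_span \<Lambda>"
    using omega_in_commutator_span[OF \<open>e1 \<in> \<Lambda>\<close> \<open>f2 \<in> \<Lambda>\<close>] by simp
  show "?M \<subseteq> commutator_span \<Lambda>"
  proof
    fix x assume "x \<in> ?M"
    then obtain i j where "x = zmul i (u ^ 2 * (d1 * d2), u * d1 * e - u * t * c + a * (u * d2))
        + zmul j (0, u * v * (d1 * d2))" unfolding zmul_plane by auto
    then show "x \<in> commutator_span \<Lambda>"
      using lat_closed(2)[OF lat_commutator_span lat_zmul[OF lat_commutator_span 1] lat_zmul[OF lat_commutator_span 2]] by simp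
  qed
qed

lemma idx_commutator_span:
  assumes "homothetic u v L \<Lambda>"
  shows "idx (commutator_span \<Lambda>) = nat (u ^ 3 * v) * idx L ^ 2"
proof -
  obtain d1 d2 t a b c e where d: "d1 > 0" "d2 > 0" "int (idx L) = d1 * d2"
    and L: "\<Lambda> = frame u v d1 d2 t a b c e"
    using homothetic_basis[OF assms] .
  have uv: "u > 0" "v > 0" using assms by (auto simp: homothetic_def)
  have "int (idx (commutator_span \<Lambda>)) = u ^ 2 * (d1 * d2) * (u * v * (d1 * d2))"
    unfolding commutator_span_basis[OF L] using uv d(1,2) by (subst idx_hermite) auto
  also have "\<dots> = int (nat (u ^ 3 * v) * idx L ^ 2)"
    using uv d by (simp add: power2_eq_square power3_eq_cube)
  finally show ?thesis by (simp only: of_nat_eq_iff)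
qed

lemma idx_homothetic:
  assumes "homothetic u v L \<Lambda>"
  shows "idx \<Lambda> = nat (u ^ 2 * v ^ 2) * idx L ^ 2"
proof -
  have s: "u > 0" "v > 0" "lat L" "lat \<Lambda>" "fst ` \<Lambda> = dilate u L" "zero_fiber \<Lambda> = dilate v L"
    using assms by (auto simp: homothetic_def primitive_lat_def)
  show ?thesis using idx_prod[OF s(4)] s by (simp add: idx_dilate nat_mult_distrib power2_eq_square)
qed

lemma index_standard_form:
  assumes "subgroup D heis" "homothetic u v L (fst ` D)" "zero_fiber D = commutator_span (fst ` D)"
  shows "card (rcosets\<^bsub>heis\<^esub> D) = nat (u ^ 5 * v ^ 3) * idx L ^ 4"
proof -
  have uv: "u > 0" "v > 0" using assms by (auto simp: homothetic_def)
  have "card (rcosets\<^bsub>heis\<^esub> D) = idx (fst ` D) * idx (zero_fiber D)"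
    by (rule heis.card_rcosets_tw[OF assms(1)])
  also have "\<dots> = (nat (u ^ 2 * v ^ 2) * nat (u ^ 3 * v)) * (idx L ^ 2 * idx L ^ 2)"
    unfolding assms(3) idx_homothetic[OF assms(2)] idx_commutator_span[OF assms(2)] by simp
  also have "nat (u ^ 2 * v ^ 2) * nat (u ^ 3 * v) = nat (u ^ 5 * v ^ 3)"
    using uv by (simp add: nat_mult_distrib[symmetric] eval_nat_numeral algebra_simps)
  also have "idx L ^ 2 * idx L ^ 2 = idx L ^ 4" by (simp add: power_add[symmetric])
  finally show ?thesis .
qed

subsection \<open>Subgroups of standard form are isomorphic to the whole group\<close>

lemma heis_swap: "x \<star> y = y \<star> x \<star> (0, heis.\<omega> (fst x) (fst y))"
  by (simp add: heis.\<omega>_def)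

text \<open>The frame basis, lifted to \<open>D\<close>, satisfies the defining relations with \<open>z1\<close> and \<open>z2\<close> replaced by generators
of the span of commutators. The resulting homomorphism is injective and onto because it is so on the
images in \<open>\<int>\<^sup>4\<close> and on the central parts.\<close>

lemma standard_form_iso:
  assumes "standard_form D"
  shows "heis \<cong> heis\<lparr>carrier := D\<rparr>"
proof -
  obtain u v L where D: "subgroup D heis" and sh: "homothetic u v L (fst ` D)"
    and kerD: "zero_fiber D = commutator_span (fst ` D)" using assms by (auto simp: standard_form_def)
  obtain d1 d2 t a b c e where d: "d1 > 0" "d2 > 0" "int (idx L) = d1 * d2"
    and La: "fst ` D = frame u v d1 d2 t a b c e"
    using homothetic_basis[OF sh] .
  have uv: "u > 0" "v > 0" using sh by (auto simp: homothetic_def)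
  define M1 where "M1 = u ^ 2 * (d1 * d2)"
  define M2 where "M2 = u * v * (d1 * d2)"
  define h where "h = u * d1 * e - u * t * c + a * (u * d2)"
  have ws: "zero_fiber D = hermite M1 h M2"
    unfolding kerD commutator_span_basis[OF La] M1_def M2_def h_def ..
  have M: "M1 > 0" "M2 > 0" using uv d by (auto simp: M1_def M2_def)
  let ?e1 = "((u * d1, u * t), (a, b))" and ?e2 = "((0, u * d2), (c, e))"
  let ?f1 = "((0::int, 0::int), (v * d1, v * t))" and ?f2 = "((0::int, 0::int), (0::int, v * d2))"
  let ?z1 = "(0 :: plane \<times> plane, (0, M2))" and ?z2 = "(0 :: plane \<times> plane, (M1, h))"
  have "?e1 \<in> fst ` D" unfolding La
    by (rule frame_mem)
  then obtain w1 where w1: "(?e1, w1) \<in> D" by force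
  have "?e2 \<in> fst ` D" unfolding La
    by (rule frame_mem)
  then obtain w2 where w2: "(?e2, w2) \<in> D" by force
  have "?f1 \<in> fst ` D" unfolding La
    by (rule frame_mem)
  then obtain w3 where w3: "(?f1, w3) \<in> D" by force
  have "?f2 \<in> fst ` D" unfolding La
    by (rule frame_mem)
  then obtain w4 where w4: "(?f2, w4) \<in> D" by force
  have "(0, M2) \<in> zero_fiber D" unfolding ws by (rule hermite_mem)
  moreover have "(M1, h) \<in> zero_fiber D" unfolding ws by (rule hermite_mem)
  ultimately have z: "?z1 \<in> D" "?z2 \<in> D" by (auto simp: zero_fiber_def)
  let ?G = "heis\<lparr>carrier := D\<rparr>"
  interpret G: group ?G by (rule subgroup.subgroup_is_group[OF D heis.group_tw])
  have om: "heis.\<omega> ?e1 ?f2 = (0, M2)" "heis.\<omega> ?f1 ?e2 = (0, M2)" "heis.\<omega> ?e1 ?e2 = (M1, h)"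
    "heis.\<omega> ?f1 ?f2 = 0" "heis.\<omega> ?e1 ?f1 = 0" "heis.\<omega> ?f2 ?e2 = 0"
    unfolding omega_eq M1_def M2_def h_def
    by (simp_all add: det2_def zero_prod_def algebra_simps power2_eq_square)
  have one: "x \<star> (0, 0) = x" for x by simp
  interpret H: heis_system ?G "(?e1, w1)" "(?f1, w3)" "(?f2, w4)" "(?e2, w2)" ?z1 ?z2
  proof unfold_locales
    show "(?e1, w1) \<otimes>\<^bsub>?G\<^esub> (?f2, w4) = (?f2, w4) \<otimes>\<^bsub>?G\<^esub> (?e1, w1) \<otimes>\<^bsub>?G\<^esub> ?z1"
      using heis_swap[of "(?e1, w1)" "(?f2, w4)"] om by (simp del: tw_simps(3))
    show "(?f1, w3) \<otimes>\<^bsub>?G\<^esub> (?e2, w2) = (?e2, w2) \<otimes>\<^bsub>?G\<^esub> (?f1, w3) \<otimes>\<^bsub>?G\<^esub> ?z1"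
      using heis_swap[of "(?f1, w3)" "(?e2, w2)"] om by (simp del: tw_simps(3))
    show "(?e1, w1) \<otimes>\<^bsub>?G\<^esub> (?e2, w2) = (?e2, w2) \<otimes>\<^bsub>?G\<^esub> (?e1, w1) \<otimes>\<^bsub>?G\<^esub> ?z2"
      using heis_swap[of "(?e1, w1)" "(?e2, w2)"] om by (simp del: tw_simps(3))
    show "(?f1, w3) \<otimes>\<^bsub>?G\<^esub> (?f2, w4) = (?f2, w4) \<otimes>\<^bsub>?G\<^esub> (?f1, w3)"
      using heis_swap[of "(?f1, w3)" "(?f2, w4)"] om by (simp only: one fst_conv) simp
    show "(?e1, w1) \<otimes>\<^bsub>?G\<^esub> (?f1, w3) = (?f1, w3) \<otimes>\<^bsub>?G\<^esub> (?e1, w1)"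
      using heis_swap[of "(?e1, w1)" "(?f1, w3)"] om by (simp only: one fst_conv) simp
    show "(?f2, w4) \<otimes>\<^bsub>?G\<^esub> (?e2, w2) = (?e2, w2) \<otimes>\<^bsub>?G\<^esub> (?f2, w4)"
      using heis_swap[of "(?f2, w4)" "(?e2, w2)"] om by (simp only: one fst_conv) simp
  qed (use w1 w2 w3 w4 z in \<open>simp_all add: add.commute\<close>)
  have pow: "x [^]\<^bsub>?G\<^esub> j = x [^]\<^bsub>heis\<^esub> j" if "x \<in> D" for x and j :: int
    using heis.G.int_pow_consistent[OF D that] by simp
  have fst_nf: "fst (H.nf g) = ((fst (fst (fst g)) * (u * d1), fst (fst (fst g)) * (u * t) + snd (fst (fst g)) * (u * d2)),
        (fst (fst (fst g)) * a + snd (fst (fst g)) * c + fst (snd (fst g)) * (v * d1),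
         fst (fst (fst g)) * b + snd (fst (fst g)) * e + fst (snd (fst g)) * (v * t) + snd (snd (fst g)) * (v * d2)))" for g
    using w1 w2 w3 w4 z unfolding H.nf_def
    by (simp add: pow heis.fst_pow zmul_plane zmul_plane2 algebra_simps)
  have nf_center: "H.nf (0, (m, n)) = (0, (m * M1, m * h + n * M2))" for m n
    using w1 w2 w3 w4 z
    unfolding H.nf_def
    by (simp add: pow heis_int_pow cocycle_def zmul_plane zmul_plane2 zero_prod_def)
  interpret nf: group_hom heis ?G H.nf
    using H.nf_hom by (simp add: group_hom_def group_hom_axioms_def heis.group_tw G.group_axioms)
  have inj: "g = (0, 0)" if g: "H.nf g = (0, 0)" for g
  proof -
    obtain i j k l m n where g': "g = (((i, j), (k, l)), (m, n))" by (metis prod.collapse)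
    have "fst (H.nf g) = ((0, 0), (0, 0))" using g by (simp add: zero_prod_def)
    then have z0: "i = 0" "j = 0" "k = 0" "l = 0"
      using fst_nf[of g] d uv by (auto simp: g')
    then have "g = (0, (m, n))" by (simp add: g' zero_prod_def)
    then have "m * M1 = 0" "m * h + n * M2 = 0" using nf_center[of m n] g by (auto simp: zero_prod_def)
    then show ?thesis using M z0 by (simp add: g' zero_prod_def)
  qed
  have surj: "x \<in> range H.nf" if x: "x \<in> D" for x
  proof -
    have "fst x \<in> fst ` D" using x by blast
    then obtain i j k l where ij: "fst x = ((i * (u * d1), i * (u * t) + j * (u * d2)),
        (i * a + j * c + k * (v * d1), i * b + j * e + k * (v * t) + l * (v * d2)))"
      unfolding La by blast
    define y where "y = H.nf (((i, j), (k, l)), (0, 0))"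
    have y: "y \<in> D" using nf.hom_closed[of "(((i, j), (k, l)), (0, 0))"] by (simp add: y_def)
    have fy: "fst y = fst x" unfolding y_def fst_nf ij by simp
    have "(fst x, snd y) \<in> D" "(fst x, snd x) \<in> D" using y x fy by (metis prod.collapse)+
    then have "snd x - snd y \<in> zero_fiber D" using heis.fiber_eq[OF D] by blast
    then obtain m n where mn: "snd x - snd y = (m * M1, m * h + n * M2)" unfolding ws by blast
    have "x = H.nf (0, (m, n)) \<star> y"
      unfolding nf_center using mn fy by (simp add: prod_eq_iff)
    also have "\<dots> = H.nf ((0, (m, n)) \<star> (((i, j), (k, l)), (0, 0)))"
      using nf.hom_mult[of "(0, (m, n))" "(((i, j), (k, l)), (0, 0))"] by (simp add: y_def)
    finally show ?thesis by blast
  qed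
  have "H.nf \<in> iso heis ?G"
    unfolding nf.iso_iff using surj inj by auto
  then show ?thesis by (auto simp: is_iso_def)
qed

section \<open>Congruences\<close>

text \<open>Congruence modulo \<open>q\<close> in any additive group. On products it is componentwise, so one set of rules serves
vectors, central elements and pairs.\<close>

definition cong_mod :: "int \<Rightarrow> 'a::ab_group_add \<Rightarrow> 'a \<Rightarrow> bool" where
  "cong_mod q x y \<longleftrightarrow> (\<exists>w. x - y = zmul q w)"

lemma zmul_distrib: "zmul j (x + y) = zmul j x + zmul j y"
  using addg.int_pow_mult_distrib[of x y j] by (simp add: zmul_def add.commute)

lemma zmul_uminus_right: "zmul j (- x) = - zmul j x"
  by (rule hom_zmul[symmetric]) simp

lemma cong_mod_refl [simp]: "cong_mod q x x"
  unfolding cong_mod_def by (rule exI[of _ 0]) simp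

lemma cong_mod_sym: "cong_mod q x y \<Longrightarrow> cong_mod q y x"
  unfolding cong_mod_def by (metis minus_diff_eq zmul_uminus_right)

lemma cong_mod_add: "cong_mod q x y \<Longrightarrow> cong_mod q x' y' \<Longrightarrow> cong_mod q (x + x') (y + y')"
  unfolding cong_mod_def by (metis add_diff_add zmul_distrib)

lemma cong_mod_trans [trans]: "cong_mod q x y \<Longrightarrow> cong_mod q y z \<Longrightarrow> cong_mod q x z"
  unfolding cong_mod_def by (metis diff_add_cancel add_diff_eq zmul_distrib)

lemma cong_mod_minus: "cong_mod q x y \<Longrightarrow> cong_mod q (- x) (- y)"
  unfolding cong_mod_def by (metis minus_diff_minus zmul_uminus_right)

lemma cong_mod_diff: "cong_mod q x y \<Longrightarrow> cong_mod q x' y' \<Longrightarrow> cong_mod q (x - x') (y - y')"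
  using cong_mod_add[OF _ cong_mod_minus] by fastforce

lemma cong_mod_hom:
  assumes "\<And>x y. \<phi> (x + y) = \<phi> x + \<phi> y" "cong_mod q x y"
  shows "cong_mod q (\<phi> x) (\<phi> y)"
proof -
  obtain w where "x - y = zmul q w" using assms(2) by (auto simp: cong_mod_def)
  then have "x = zmul q w + y" by (simp add: algebra_simps)
  then have "\<phi> x - \<phi> y = zmul q (\<phi> w)" by (simp add: assms(1) hom_zmul[OF assms(1)])
  then show ?thesis by (auto simp: cong_mod_def)
qed

lemma cong_mod_zmul: "cong_mod q x y \<Longrightarrow> cong_mod q (zmul j x) (zmul j y)"
  by (rule cong_mod_hom[OF zmul_distrib])

lemma cong_mod_int: "cong_mod q (x::int) y \<longleftrightarrow> q dvd x - y"
  by (auto simp: cong_mod_def dvd_def)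

lemma cong_mod_prod: "cong_mod q x y \<longleftrightarrow> cong_mod q (fst x) (fst y) \<and> cong_mod q (snd x) (snd y)"
proof
  assume "cong_mod q x y"
  then show "cong_mod q (fst x) (fst y) \<and> cong_mod q (snd x) (snd y)" by (simp add: cong_mod_hom[of fst] cong_mod_hom[of snd])
next
  assume "cong_mod q (fst x) (fst y) \<and> cong_mod q (snd x) (snd y)"
  then obtain a b where "fst x - fst y = zmul q a" "snd x - snd y = zmul q b" by (auto simp: cong_mod_def)
  then have "x - y = zmul q (a, b)" by (simp add: prod_eq_iff zmul_prod[of q "(a, b)"])
  then show "cong_mod q x y" by (auto simp: cong_mod_def)
qed

lemma cong_mod_plane: "cong_mod q (x::plane) y \<longleftrightarrow> q dvd fst x - fst y \<and> q dvd snd x - snd y"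
  by (simp add: cong_mod_prod cong_mod_int)

lemma cong_mod_biadditive:
  assumes "biadditive \<beta>" "cong_mod q u u'" "cong_mod q v v'"
  shows "cong_mod q (\<beta> u v) (\<beta> u' v')"
proof -
  have "cong_mod q (\<beta> u v) (\<beta> u' v)"
    by (rule cong_mod_hom[of "\<lambda>u. \<beta> u v", OF _ assms(2)]) (rule biadditive.add_left[OF assms(1)])
  also have "cong_mod q (\<beta> u' v) (\<beta> u' v')"
    by (rule cong_mod_hom[of "\<lambda>v. \<beta> u' v", OF _ assms(3)]) (rule biadditive.add_right[OF assms(1)])
  finally show ?thesis .
qed

lemma biadditive_omega: "biadditive heis.\<omega>"
  by unfold_locales (simp_all add: heis.\<omega>_def heis.add_left heis.add_right)

lemmas cong_mod_cocycle = cong_mod_biadditive[OF heis.biadditive_axioms]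
lemmas cong_mod_omega = cong_mod_biadditive[OF biadditive_omega]

lemma cong_mod_heis_mult: "cong_mod q x x' \<Longrightarrow> cong_mod q y y' \<Longrightarrow> cong_mod q (x \<star> y) (x' \<star> y')"
  unfolding cong_mod_prod[of q x] cong_mod_prod[of q y] by (simp add: cong_mod_prod[of q "(_, _)"] cong_mod_add cong_mod_cocycle)

text \<open>The values of the map matter only up to congruence. Keeping them integral leaves all the bilinear
algebra over \<open>\<int>\<close>.\<close>

definition epi_mod :: "int \<Rightarrow> heis_elt set \<Rightarrow> (_ \<Rightarrow> heis_elt) \<Rightarrow> bool" where
  "epi_mod q D f \<longleftrightarrow> (\<forall>x\<in>D. \<forall>y\<in>D. cong_mod q (f (x \<star> y)) (f x \<star> f y)) \<and> (\<forall>h. \<exists>x\<in>D. cong_mod q (f x) h)"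

locale epi_mod_prime =
  fixes q D f
  assumes D: "subgroup D heis" and q: "prime (q::int)" and f: "epi_mod q D f"
begin

lemma f_mult: "x \<in> D \<Longrightarrow> y \<in> D \<Longrightarrow> cong_mod q (f (x \<star> y)) (f x \<star> f y)"
  using f unfolding epi_mod_def by blast

lemma f_surj: "\<exists>x\<in>D. cong_mod q (f x) h"
  using f unfolding epi_mod_def by blast

definition \<alpha> where "\<alpha> x = fst (f x)"
definition \<zeta> where "\<zeta> z = snd (f (0, z))"

lemma D_closed: "x \<in> D \<Longrightarrow> y \<in> D \<Longrightarrow> x \<star> y \<in> D" "(0, 0) \<in> D"
  using subgroup.m_closed[OF D] subgroup.one_closed[OF D] by auto

lemma \<alpha>_mult: "x \<in> D \<Longrightarrow> y \<in> D \<Longrightarrow> cong_mod q (\<alpha> (x \<star> y)) (\<alpha> x + \<alpha> y)"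
  using f_mult[of x y] unfolding \<alpha>_def cong_mod_prod[of q "f _"] by simp

lemma \<alpha>_mult_cong:
  assumes "x \<in> D" "y \<in> D" "cong_mod q (\<alpha> x) a" "cong_mod q (\<alpha> y) b"
  shows "cong_mod q (\<alpha> (x \<star> y)) (a + b)"
  using cong_mod_trans[OF \<alpha>_mult[OF assms(1,2)] cong_mod_add[OF assms(3,4)]] .

lemma cong_mod_cancel: "cong_mod q (x + y) (x + z) \<longleftrightarrow> cong_mod q y z"
  by (simp add: cong_mod_def)

lemma f_one: "cong_mod q (f (0, 0)) (0, 0)"
proof -
  have 1: "cong_mod q (f (0, 0)) (f (0, 0) \<star> f (0, 0))"
    using f_mult[OF D_closed(2) D_closed(2)] by simp
  then have "cong_mod q (fst (f (0, 0)) + 0) (fst (f (0, 0)) + fst (f (0, 0)))"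
    unfolding cong_mod_prod[of q "f _"] by simp
  then have a: "cong_mod q (fst (f (0, 0))) 0" unfolding cong_mod_cancel by (rule cong_mod_sym)
  have "cong_mod q (snd (f (0, 0))) (snd (f (0, 0)) + snd (f (0, 0)) + cocycle (fst (f (0, 0))) (fst (f (0, 0))))"
    using 1 unfolding cong_mod_prod[of q "f _"] by simp
  also have "cong_mod q (snd (f (0, 0)) + snd (f (0, 0)) + cocycle (fst (f (0, 0))) (fst (f (0, 0))))
      (snd (f (0, 0)) + snd (f (0, 0)) + cocycle 0 0)"
    by (intro cong_mod_add cong_mod_refl cong_mod_cocycle a)
  finally have "cong_mod q (snd (f (0, 0)) + 0) (snd (f (0, 0)) + snd (f (0, 0)))" by simp
  then have "cong_mod q (snd (f (0, 0))) 0" unfolding cong_mod_cancel by (rule cong_mod_sym)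
  with a show ?thesis by (simp add: cong_mod_prod[of q "f _"] zero_prod_def)
qed

lemma \<alpha>_pow: "x \<in> D \<Longrightarrow> cong_mod q (\<alpha> (x [^]\<^bsub>heis\<^esub> (j::int))) (zmul j (\<alpha> x))"
proof (induction j rule: int_induct[where k = 0])
  case base
  show ?case using f_one by (simp add: \<alpha>_def cong_mod_prod[of q "f _"] zero_prod_def)
next
  case (step1 j)
  have p: "x [^]\<^bsub>heis\<^esub> j \<in> D" using heis.G.subgroup_int_pow_closed[OF D step1(3)] .
  have "x [^]\<^bsub>heis\<^esub> (j + 1) = x [^]\<^bsub>heis\<^esub> j \<star> x"
    using heis.G.int_pow_mult[of x j 1] heis.G.int_pow_1[of x] by (simp del: tw_simps(3))
  then have "cong_mod q (\<alpha> (x [^]\<^bsub>heis\<^esub> (j + 1))) (\<alpha> (x [^]\<^bsub>heis\<^esub> j) + \<alpha> x)"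
    using \<alpha>_mult[OF p step1(3)] by simp
  also have "cong_mod q \<dots> (zmul j (\<alpha> x) + \<alpha> x)" by (intro cong_mod_add cong_mod_refl step1(2,3))
  finally show ?case by (simp add: zmul_add)
next
  case (step2 j)
  have p: "x [^]\<^bsub>heis\<^esub> (j - 1) \<in> D" using heis.G.subgroup_int_pow_closed[OF D step2(3)] .
  have "x [^]\<^bsub>heis\<^esub> j = x [^]\<^bsub>heis\<^esub> (j - 1) \<star> x"
    using heis.G.int_pow_mult[of x "j - 1" 1] heis.G.int_pow_1[of x] by (simp del: tw_simps(3))
  then have "cong_mod q (\<alpha> (x [^]\<^bsub>heis\<^esub> j)) (\<alpha> (x [^]\<^bsub>heis\<^esub> (j - 1)) + \<alpha> x)"
    using \<alpha>_mult[OF p step2(3)] by simp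
  then have "cong_mod q (\<alpha> (x [^]\<^bsub>heis\<^esub> (j - 1)) + \<alpha> x) (zmul j (\<alpha> x))"
    using cong_mod_trans[OF cong_mod_sym step2(2)[OF step2(3)]] by blast
  then have "cong_mod q ((\<alpha> (x [^]\<^bsub>heis\<^esub> (j - 1)) + \<alpha> x) - \<alpha> x) (zmul j (\<alpha> x) - \<alpha> x)"
    by (intro cong_mod_diff cong_mod_refl)
  then show ?case by (simp add: zmul_diff)
qed

text \<open>A homomorphism maps commutators to commutators; in both groups the commutator is the central
element given by \<open>\<omega>\<close>.\<close>

lemma commutator:
  assumes x: "x \<in> D" and y: "y \<in> D"
  shows "cong_mod q (f (0, heis.\<omega> (fst x) (fst y))) (0, heis.\<omega> (\<alpha> x) (\<alpha> y))"
proof -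
  define c where "c = (0 :: plane \<times> plane, heis.\<omega> (fst x) (fst y))"
  have cD: "c \<in> D" using heis.commutator_in_zero_fiber[OF D, of "fst x" "fst y"] x y by (simp add: c_def zero_fiber_def)
  have e: "x \<star> y = c \<star> (y \<star> x)"
    unfolding c_def by (simp add: heis.\<omega>_def)
  have "cong_mod q (f x \<star> f y) (f (x \<star> y))" by (rule cong_mod_sym[OF f_mult[OF x y]])
  also have "cong_mod q (f (x \<star> y)) (f c \<star> f (y \<star> x))"
    unfolding e by (rule f_mult[OF cD D_closed(1)[OF y x]])
  also have "cong_mod q (f c \<star> f (y \<star> x)) (f c \<star> (f y \<star> f x))"
    by (rule cong_mod_heis_mult[OF cong_mod_refl f_mult[OF y x]])
  finally have 1: "cong_mod q (f x \<star> f y) (f c \<star> (f y \<star> f x))" .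
  then have "cong_mod q ((\<alpha> x + \<alpha> y) + 0) ((\<alpha> x + \<alpha> y) + \<alpha> c)"
    unfolding \<alpha>_def by (simp add: cong_mod_prod[of q "(_, _)"] algebra_simps)
  then have a: "cong_mod q (\<alpha> c) 0" unfolding cong_mod_cancel by (rule cong_mod_sym)
  have "cong_mod q (snd (f x) + snd (f y) + cocycle (\<alpha> x) (\<alpha> y))
      (snd (f c) + (snd (f y) + snd (f x) + cocycle (\<alpha> y) (\<alpha> x)) + cocycle (\<alpha> c) (\<alpha> y + \<alpha> x))"
    using 1 unfolding \<alpha>_def by (simp add: cong_mod_prod[of q "(_, _)"])
  also have "cong_mod q (snd (f c) + (snd (f y) + snd (f x) + cocycle (\<alpha> y) (\<alpha> x)) + cocycle (\<alpha> c) (\<alpha> y + \<alpha> x))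
     (snd (f c) + (snd (f y) + snd (f x) + cocycle (\<alpha> y) (\<alpha> x)) + cocycle 0 (\<alpha> y + \<alpha> x))"
    by (intro cong_mod_add cong_mod_refl cong_mod_cocycle a)
  finally have "cong_mod q (snd (f x) + snd (f y) + cocycle (\<alpha> x) (\<alpha> y) - (snd (f y) + snd (f x) + cocycle (\<alpha> y) (\<alpha> x)))
     (snd (f c) + (snd (f y) + snd (f x) + cocycle (\<alpha> y) (\<alpha> x)) - (snd (f y) + snd (f x) + cocycle (\<alpha> y) (\<alpha> x)))"
    by (intro cong_mod_diff cong_mod_refl) simp
  then have "cong_mod q (snd (f c)) (heis.\<omega> (\<alpha> x) (\<alpha> y))"
    by (intro cong_mod_sym[of q "heis.\<omega> _ _"]) (simp add: heis.\<omega>_def algebra_simps)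
  then show ?thesis using a unfolding c_def[symmetric] by (simp add: cong_mod_prod[of q "f _"] \<alpha>_def)
qed

lemma \<zeta>_omega: "x \<in> D \<Longrightarrow> y \<in> D \<Longrightarrow> cong_mod q (\<zeta> (heis.\<omega> (fst x) (fst y))) (heis.\<omega> (\<alpha> x) (\<alpha> y))"
  using commutator[of x y] unfolding \<zeta>_def by (simp add: cong_mod_prod[of q "f _"])

lemma omega_nondegenerate:
  assumes "\<And>w. cong_mod q (heis.\<omega> u w) 0"
  shows "cong_mod q u 0"
proof -
  note a = assms[of "((0, 0), (1, 0))"] assms[of "((0, 0), (0, 1))"] assms[of "((1, 0), (0, 0))"] assms[of "((0, 1), (0, 0))"]
  show ?thesis using a
    by (simp add: omega_eq det2_def cong_mod_prod[of q u] cong_mod_plane)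
qed

text \<open>A central element maps to an element commuting with everything modulo \<open>q\<close>, and the form is
nondegenerate modulo \<open>q\<close>. Hence \<open>\<alpha>\<close> depends only on the image in \<open>\<int>\<^sup>4\<close>, and \<open>\<zeta>\<close> is additive on the central part.\<close>

lemma \<alpha>_center:
  assumes "(0, z) \<in> D"
  shows "cong_mod q (\<alpha> (0, z)) 0"
proof (rule omega_nondegenerate)
  fix w
  obtain y where y: "y \<in> D" "cong_mod q (f y) (w, 0)" using f_surj by blast
  then have "cong_mod q (\<alpha> y) w" unfolding \<alpha>_def cong_mod_prod[of q "f _"] by simp
  then have yw: "cong_mod q w (\<alpha> y)" by (rule cong_mod_sym)
  have "cong_mod q (heis.\<omega> (\<alpha> (0, z)) w) (heis.\<omega> (\<alpha> (0, z)) (\<alpha> y))"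
    by (rule cong_mod_omega[OF cong_mod_refl yw])
  also have "cong_mod q \<dots> (\<zeta> 0)" using cong_mod_sym[OF \<zeta>_omega[OF assms y(1)]]
    by (simp add: biadditive.zero_left[OF biadditive_omega])
  also have "cong_mod q (\<zeta> 0) 0" using f_one by (simp add: \<zeta>_def cong_mod_prod[of q "f _"] zero_prod_def)
  finally show "cong_mod q (heis.\<omega> (\<alpha> (0, z)) w) 0" .
qed

lemma \<alpha>_cong:
  assumes "x \<in> D" "y \<in> D" "fst x = fst y"
  shows "cong_mod q (\<alpha> x) (\<alpha> y)"
proof -
  have "(fst y, snd y) \<in> D" "(fst y, snd x) \<in> D" using assms by (metis prod.collapse)+
  then have z: "(0, snd x - snd y) \<in> D" using heis.fiber_eq[OF D] by (fastforce simp: zero_fiber_def)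
  have "x = (0, snd x - snd y) \<star> y" using assms(3) by (simp add: prod_eq_iff)
  then have "cong_mod q (\<alpha> x) (\<alpha> (0, snd x - snd y) + \<alpha> y)" using \<alpha>_mult[OF z assms(2)] by simp
  also have "cong_mod q \<dots> (0 + \<alpha> y)" by (intro cong_mod_add \<alpha>_center z cong_mod_refl)
  finally show ?thesis by simp
qed

lemma \<zeta>_add:
  assumes "z \<in> zero_fiber D" "w \<in> zero_fiber D"
  shows "cong_mod q (\<zeta> (z + w)) (\<zeta> z + \<zeta> w)"
proof -
  have zw: "(0, z) \<in> D" "(0, w) \<in> D" using assms by (auto simp: zero_fiber_def)
  have "cong_mod q (\<zeta> (z + w)) (\<zeta> z + \<zeta> w + cocycle (\<alpha> (0, z)) (\<alpha> (0, w)))"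
    using f_mult[OF zw] by (simp add: \<zeta>_def \<alpha>_def cong_mod_prod[of q "f _"])
  also have "cong_mod q \<dots> (\<zeta> z + \<zeta> w + cocycle 0 0)"
    by (intro cong_mod_add cong_mod_refl cong_mod_cocycle \<alpha>_center zw)
  finally show ?thesis by simp
qed

lemma \<zeta>_0: "cong_mod q (\<zeta> 0) 0"
  using f_one by (simp add: \<zeta>_def cong_mod_prod[of q "f _"] zero_prod_def)

lemma \<zeta>_zmul:
  assumes "z \<in> zero_fiber D"
  shows "cong_mod q (\<zeta> (zmul j z)) (zmul j (\<zeta> z))"
proof (induction j rule: int_induct[where k = 0])
  case base
  show ?case using \<zeta>_0 by simp
next
  case (step1 j)
  have "zmul j z \<in> zero_fiber D" by (rule lat_zmul[OF heis.lat_zero_fiber[OF D] assms])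
  from \<zeta>_add[OF this assms] have "cong_mod q (\<zeta> (zmul (j + 1) z)) (\<zeta> (zmul j z) + \<zeta> z)"
    by (simp add: zmul_add)
  also have "cong_mod q \<dots> (zmul j (\<zeta> z) + \<zeta> z)" by (intro cong_mod_add cong_mod_refl step1)
  finally show ?case by (simp add: zmul_add)
next
  case (step2 j)
  have "zmul (j - 1) z \<in> zero_fiber D" by (rule lat_zmul[OF heis.lat_zero_fiber[OF D] assms])
  from \<zeta>_add[OF this assms] have "cong_mod q (\<zeta> (zmul j z)) (\<zeta> (zmul (j - 1) z) + \<zeta> z)"
    by (simp add: zmul_diff)
  then have "cong_mod q (\<zeta> (zmul (j - 1) z) + \<zeta> z) (zmul j (\<zeta> z))"
    using cong_mod_trans[OF cong_mod_sym step2(2)] by blast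
  then have "cong_mod q (\<zeta> (zmul (j - 1) z) + \<zeta> z - \<zeta> z) (zmul j (\<zeta> z) - \<zeta> z)" by (intro cong_mod_diff cong_mod_refl)
  then show ?case by (simp add: zmul_diff)
qed

end

lemma zmul_zmul: "zmul i (zmul j x) = zmul (i * j) x"
  using addg.int_pow_pow[of x j i] by (simp add: zmul_def mult.commute)

lemma cong_mod_zmul_0: "q dvd j \<Longrightarrow> cong_mod q (zmul j x) 0"
  by (auto simp: cong_mod_def zmul_zmul[symmetric] elim!: dvdE)

text \<open>A vector with nonzero constant part has commutators in both directions \<open>1\<close> and \<open>\<epsilon>\<close>, so its commutators
do not fit on one line. This singles out the \<open>\<epsilon>\<close>-part modulo \<open>q\<close> by a property that \<open>\<alpha>\<close> preserves.\<close>

lemma fst_if_omega_line: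
  assumes "prime (q::int)" "\<And>w. \<exists>c. cong_mod q (heis.\<omega> u w) (zmul c w0)"
  shows "cong_mod q (fst u) 0"
proof (rule ccontr)
  assume n: "\<not> cong_mod q (fst u) 0"
  obtain a b where ab: "fst u = (a, b)" by force
  obtain x y where w0: "w0 = (x, y)" by force
  obtain r1 r2 where r: "\<not> q dvd a * r2 - b * r1"
  proof (cases "q dvd a")
    case False
    then show ?thesis using that[of 1 0] by simp
  next
    case True
    then have "\<not> q dvd b" using n by (simp add: cong_mod_plane ab)
    then show ?thesis using that[of 0 "-1"] by simp
  qed
  obtain c where "cong_mod q (heis.\<omega> u ((0, 0), (r1, r2))) (zmul c w0)" using assms(2) by blast
  then have c: "q dvd c * x" "q dvd (a * r2 - b * r1) - c * y"
    by (simp_all add: cong_mod_plane omega_eq det2_def ab w0 zmul_plane)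
  obtain c' where "cong_mod q (heis.\<omega> u ((r1, r2), (0, 0))) (zmul c' w0)" using assms(2) by blast
  then have c': "q dvd (a * r2 - b * r1) - c' * x"
    by (simp add: cong_mod_plane omega_eq det2_def ab w0 zmul_plane)
  have "q dvd c \<or> q dvd x" using c(1) assms(1) by (simp add: prime_dvd_mult_iff)
  then show False
  proof
    assume "q dvd c"
    then have "q dvd c * y" by simp
    then have "q dvd ((a * r2 - b * r1) - c * y) + c * y" using c(2) by (rule dvd_add[rotated])
    then show False using r by simp
  next
    assume "q dvd x"
    then have "q dvd c' * x" by simp
    then have "q dvd ((a * r2 - b * r1) - c' * x) + c' * x" using c' by (rule dvd_add[rotated])
    then show False using r by simp
  qed
qed

lemma det2_if_span:
  assumes "prime (q::int)" "\<And>w. \<exists>i j. cong_mod q w (zmul i v + zmul j v')"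
  shows "\<not> q dvd det2 v v'"
proof
  assume det: "q dvd det2 v v'"
  obtain a b where v: "v = (a, b)" by force
  obtain c e where v': "v' = (c, e)" by force
  obtain i j where "cong_mod q (1, 0) (zmul i v + zmul j v')" using assms(2) by blast
  then have "q dvd 1 - (i * a + j * c)" "q dvd i * b + j * e"
    unfolding v v' by (simp_all add: cong_mod_plane zmul_plane dvd_diff_commute add.commute)
  then obtain x y where 1: "1 - (i * a + j * c) = q * x" "i * b + j * e = q * y" by (meson dvdE)
  obtain k l where "cong_mod q (0, 1) (zmul k v + zmul l v')" using assms(2) by blast
  then have "q dvd k * a + l * c" "q dvd 1 - (k * b + l * e)"
    unfolding v v' by (simp_all add: cong_mod_plane zmul_plane dvd_diff_commute add.commute)
  then obtain z w where 2: "k * a + l * c = q * z" "1 - (k * b + l * e) = q * w" by (meson dvdE)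
  have eqs: "i * a + j * c = 1 - q * x" "k * b + l * e = 1 - q * w" using 1 2 by simp_all
  have "(i * l - j * k) * det2 v v' = (i * a + j * c) * (k * b + l * e) - (i * b + j * e) * (k * a + l * c)"
    by (simp add: det2_def v v' algebra_simps)
  also have "\<dots> = (1 - q * x) * (1 - q * w) - (q * y) * (q * z)"
    by (simp only: 1(2) 2(1) eqs)
  finally have "1 = (i * l - j * k) * det2 v v' + q * (x + w - q * x * w + q * y * z)"
    by (simp add: algebra_simps)
  then have "q dvd 1" using det by (metis dvd_add dvd_mult dvd_triv_left)
  then show False using assms(1) not_prime_unit by blast
qed

lemma coeff_if_det2:
  assumes "prime (q::int)" "\<not> q dvd det2 v v'" "cong_mod q (zmul i v + zmul j v') 0"
  shows "q dvd i" "q dvd j"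
proof -
  have 0: "q dvd i * fst v + j * fst v'" "q dvd i * snd v + j * snd v'"
    using assms(3) by (simp_all add: cong_mod_plane zmul_prod[of i v] zmul_prod[of j v'])
  have "i * det2 v v' = (i * fst v + j * fst v') * snd v' - (i * snd v + j * snd v') * fst v'"
    by (simp add: det2_def algebra_simps)
  also have "q dvd \<dots>" using 0 by (intro dvd_diff dvd_mult2)
  finally have "q dvd i * det2 v v'" .
  then show "q dvd i" using assms(1,2) by (simp add: prime_dvd_mult_iff)
  have "j * det2 v v' = (i * snd v + j * snd v') * fst v - (i * fst v + j * fst v') * snd v"
    by (simp add: det2_def algebra_simps)
  also have "q dvd \<dots>" using 0 by (intro dvd_diff dvd_mult2)
  finally have "q dvd j * det2 v v'" .
  then show "q dvd j" using assms(1,2) by (simp add: prime_dvd_mult_iff)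
qed

context epi_mod_prime begin

text \<open>The triangular bases \<open>e1, e2\<close> of the image and \<open>f1, f2\<close> of the kernel give the pairing matrix
\<open>det2 e\<^sub>i f\<^sub>j\<close> with entries \<open>l R\<close>, \<open>l P\<close>, \<open>- l Q\<close>, \<open>0\<close>, where \<open>l\<close> generates the \<open>\<epsilon>\<close>-part of \<open>M\<close>. The images of
\<open>f1, f2\<close> under \<open>\<alpha>\<close> lie in the \<open>\<epsilon>\<close>-part by \<open>fst_if_omega_line\<close>; since \<open>\<alpha>\<close> is onto modulo \<open>q\<close>, the images of the
\<open>e\<^sub>i\<close> and of the \<open>f\<^sub>j\<close> are bases modulo \<open>q\<close>, so their pairing matrix is invertible modulo \<open>q\<close>. Applying \<open>\<zeta>\<close>
to the commutators shows that it is congruent to a multiple of the matrix with entries \<open>R\<close>, \<open>P\<close>, \<open>- Q\<close>, \<open>0\<close>,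
whose determinant \<open>P Q\<close> is therefore prime to \<open>q\<close>. Likewise \<open>q\<close> does not
divide \<open>m'\<close>, since otherwise \<open>[e1, e2]\<close> would map into the line of the \<open>\<epsilon>\<close>-part.\<close>

lemma unimodular:
  assumes A: "fst ` fst ` D = hermite d1 t d2"
    and B: "zero_fiber (fst ` D) = hermite p1 s p2"
    and K: "zero_fiber (zero_fiber D) = mults l" and Mm: "fst ` zero_fiber D = mults m"
    and P: "d1 * p2 = l * P" "d2 * p1 = l * Q" "d1 * s - t * p1 = l * R" "d1 * d2 = m * m'"
  shows "\<not> q dvd P \<and> \<not> q dvd Q \<and> \<not> q dvd m'"
proof -
  have La: "lat (fst ` D)" by (rule heis.lat_proj[OF D])
  have lM: "lat (zero_fiber D)" by (rule heis.lat_zero_fiber[OF D])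
  have "(d1, t) \<in> fst ` fst ` D" unfolding A by (rule hermite_mem)
  then obtain E1 where E1: "E1 \<in> D" "fst (fst E1) = (d1, t)" by force
  have "(0, d2) \<in> fst ` fst ` D" unfolding A by (rule hermite_mem)
  then obtain E2 where E2: "E2 \<in> D" "fst (fst E2) = (0, d2)" by force
  have "(p1, s) \<in> zero_fiber (fst ` D)" unfolding B by (rule hermite_mem)
  then obtain F1 where F1: "F1 \<in> D" "fst F1 = (0, (p1, s))" by (force simp: zero_fiber_def)
  have "(0, p2) \<in> zero_fiber (fst ` D)" unfolding B by (rule hermite_mem)
  then obtain F2 where F2: "F2 \<in> D" "fst F2 = (0, (0, p2))" by (force simp: zero_fiber_def)
  note inD = E1(1) E2(1) F1(1) F2(1)
  \<comment> \<open>the images of the lifted basis span all vectors modulo \<open>q\<close>\<close>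
  have span: "\<exists>i j k n. cong_mod q w (zmul i (\<alpha> E1) + (zmul j (\<alpha> E2) + (zmul k (\<alpha> F1) + zmul n (\<alpha> F2))))" for w
  proof -
    obtain x where x: "x \<in> D" "cong_mod q (f x) (w, 0)" using f_surj by blast
    have "fst (fst x) \<in> fst ` fst ` D" using x(1) by blast
    then obtain i j where ij: "fst (fst x) = (i * d1, i * t + j * d2)" unfolding A by blast
    have "fst x - (zmul i (fst E1) + zmul j (fst E2)) \<in> fst ` D"
      by (intro lat_closed(2,3)[OF La] lat_zmul[OF La] imageI inD x(1))
    moreover have "fst (fst x - (zmul i (fst E1) + zmul j (fst E2))) = 0"
      using ij E1 E2 by (simp add: zmul_prod[of i "fst E1"] zmul_prod[of j "fst E2"] zmul_plane zero_prod_def)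
    ultimately have "snd (fst x - (zmul i (fst E1) + zmul j (fst E2))) \<in> zero_fiber (fst ` D)"
      unfolding zero_fiber_def by (metis mem_Collect_eq prod.collapse)
    then obtain k n where kn: "snd (fst x - (zmul i (fst E1) + zmul j (fst E2))) = (k * p1, k * s + n * p2)"
      unfolding B by blast
    define y where "y = E1 [^]\<^bsub>heis\<^esub> i \<star> (E2 [^]\<^bsub>heis\<^esub> j \<star> (F1 [^]\<^bsub>heis\<^esub> k \<star> F2 [^]\<^bsub>heis\<^esub> n))"
    note pw = heis.G.subgroup_int_pow_closed[OF D]
    have y: "y \<in> D" unfolding y_def by (intro D_closed(1) pw inD)
    have e: "fst x = (zmul i (fst E1) + zmul j (fst E2)) + (0, (k * p1, k * s + n * p2))"
      using kn \<open>fst (fst x - _) = 0\<close> by (metis add_diff_cancel_left' diff_add_cancel add.commute prod.collapse)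
    have "fst y = fst x"
      unfolding e y_def using F1 F2 by (simp add: heis.fst_pow zmul_prod[of _ "(_, _)"] zmul_plane add.assoc)
    then have "cong_mod q (\<alpha> x) (\<alpha> y)" using \<alpha>_cong[OF x(1) y] by simp
    moreover have "cong_mod q w (\<alpha> x)"
      by (rule cong_mod_sym) (use x(2) in \<open>simp add: \<alpha>_def cong_mod_prod[of q "f _"]\<close>)
    ultimately have "cong_mod q w (\<alpha> y)" using cong_mod_trans by blast
    also have "cong_mod q (\<alpha> y) (zmul i (\<alpha> E1) + (zmul j (\<alpha> E2) + (zmul k (\<alpha> F1) + zmul n (\<alpha> F2))))"
      unfolding y_def by (intro \<alpha>_mult_cong D_closed(1) pw inD \<alpha>_pow)
    finally show ?thesis by (intro exI)
  qed
  \<comment> \<open>commutators with a kernel vector are multiples of \<open>(0, l)\<close>, so their images lie on the line of \<open>w0\<close>\<close>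
  define w0 where "w0 = \<zeta> (0, l)"
  have "l \<in> zero_fiber (zero_fiber D)" unfolding K by (simp add: mults_def)
  then have l: "(0, l) \<in> zero_fiber D" unfolding zero_fiber_def[of "zero_fiber D"] by (rule CollectD)
  have \<zeta>c: "cong_mod q (\<zeta> (0, c * l)) (zmul c w0)" for c
    using \<zeta>_zmul[OF l, of c] by (simp add: w0_def zmul_plane)
  have F0: "cong_mod q (fst (\<alpha> F)) 0" if F: "F \<in> D" "fst (fst F) = 0" for F
  proof (rule fst_if_omega_line[OF q])
    fix w
    obtain y where y: "y \<in> D" "cong_mod q (f y) (w, 0)" using f_surj by blast
    have yw: "cong_mod q w (\<alpha> y)"
      by (rule cong_mod_sym) (use y(2) in \<open>simp add: \<alpha>_def cong_mod_prod[of q "f _"]\<close>)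
    have "heis.\<omega> (fst F) (fst y) \<in> zero_fiber D"
      by (rule heis.commutator_in_zero_fiber[OF D]) (use F y in auto)
    moreover have o: "fst (heis.\<omega> (fst F) (fst y)) = 0" unfolding omega_eq F(2) by simp
    ultimately have "snd (heis.\<omega> (fst F) (fst y)) \<in> zero_fiber (zero_fiber D)"
      unfolding zero_fiber_def[of "zero_fiber D"] by (metis mem_Collect_eq prod.collapse)
    then obtain c where "snd (heis.\<omega> (fst F) (fst y)) = c * l" unfolding K mults_range by blast
    then have "heis.\<omega> (fst F) (fst y) = (0, c * l)" using o by (simp add: prod_eq_iff)
    then have 1: "cong_mod q (heis.\<omega> (\<alpha> F) (\<alpha> y)) (\<zeta> (0, c * l))"
      using cong_mod_sym[OF \<zeta>_omega[OF F(1) y(1)]] by simp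
    have "cong_mod q (heis.\<omega> (\<alpha> F) w) (heis.\<omega> (\<alpha> F) (\<alpha> y))" by (rule cong_mod_omega[OF cong_mod_refl yw])
    also note 1
    also note \<zeta>c
    finally show "\<exists>c. cong_mod q (heis.\<omega> (\<alpha> F) w) (zmul c w0)" by blast
  qed
  define v1 v2 r1 r2 where "v1 = fst (\<alpha> E1)" and "v2 = fst (\<alpha> E2)" and "r1 = snd (\<alpha> F1)" and "r2 = snd (\<alpha> F2)"
  have F: "cong_mod q (\<alpha> F1) (0, r1)" "cong_mod q (\<alpha> F2) (0, r2)"
    using F0[OF F1(1)] F0[OF F2(1)] F1(2) F2(2) by (simp_all add: cong_mod_prod[of q "\<alpha> _"] r1_def r2_def)
  have span_fst: "cong_mod q (zmul i v1 + zmul j v2) (fst w)"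
    and span_snd: "cong_mod q (snd w) (zmul i (snd (\<alpha> E1)) + (zmul j (snd (\<alpha> E2)) + (zmul k r1 + zmul n r2)))"
    if "cong_mod q w (zmul i (\<alpha> E1) + (zmul j (\<alpha> E2) + (zmul k (\<alpha> F1) + zmul n (\<alpha> F2))))" for w i j k n
  proof -
    have "cong_mod q w (zmul i (\<alpha> E1) + (zmul j (\<alpha> E2) + (zmul k (0, r1) + zmul n (0, r2))))"
      by (rule cong_mod_trans[OF that]) (intro cong_mod_add cong_mod_refl cong_mod_zmul F)
    then have "cong_mod q (fst w) (zmul i v1 + zmul j v2) \<and> cong_mod q (snd w) (zmul i (snd (\<alpha> E1)) + (zmul j (snd (\<alpha> E2)) + (zmul k r1 + zmul n r2)))"
      unfolding cong_mod_prod[of q w] v1_def v2_def by (simp add: zmul_prod[of _ "\<alpha> _"] zmul_prod[of _ "(0, _)"])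
    then show "cong_mod q (zmul i v1 + zmul j v2) (fst w)" using cong_mod_sym by blast
    show "cong_mod q (snd w) (zmul i (snd (\<alpha> E1)) + (zmul j (snd (\<alpha> E2)) + (zmul k r1 + zmul n r2)))"
      using \<open>_ \<and> _\<close> by blast
  qed
  have detv: "\<not> q dvd det2 v1 v2"
  proof (rule det2_if_span[OF q])
    fix w :: plane
    from span[of "(w, 0)"] show "\<exists>i j. cong_mod q w (zmul i v1 + zmul j v2)"
      using span_fst[of "(w, 0)"] by (metis cong_mod_sym fst_conv)
  qed
  have detr: "\<not> q dvd det2 r1 r2"
  proof (rule det2_if_span[OF q])
    fix w :: plane
    obtain i j k n where ex: "cong_mod q (0, w) (zmul i (\<alpha> E1) + (zmul j (\<alpha> E2) + (zmul k (\<alpha> F1) + zmul n (\<alpha> F2))))"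
      using span by blast
    have ij: "q dvd i" "q dvd j" using coeff_if_det2[OF q detv] span_fst[OF ex] by simp_all
    have "cong_mod q w (zmul i (snd (\<alpha> E1)) + (zmul j (snd (\<alpha> E2)) + (zmul k r1 + zmul n r2)))"
      using span_snd[OF ex] by simp
    also have "cong_mod q \<dots> (0 + (0 + (zmul k r1 + zmul n r2)))"
      by (intro cong_mod_add cong_mod_refl cong_mod_zmul_0 ij)
    finally show "\<exists>i j. cong_mod q w (zmul i r1 + zmul j r2)" by auto
  qed
  obtain x y where xy: "w0 = (x, y)" by force
  \<comment> \<open>the pairing matrix transported by \<open>\<zeta>\<close>, entry by entry\<close>
  have pair: "q dvd c * x \<and> q dvd c * y - det2 (fst (\<alpha> E)) r"
    if EF: "E \<in> D" "F \<in> D" "cong_mod q (\<alpha> F) (0, r)" "fst F = (0, r')" "det2 (fst (fst E)) r' = l * c" for E F r r' c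
  proof -
    have "heis.\<omega> (fst E) (fst F) = (0, c * l)" unfolding omega_eq EF(4) using EF(5) by (simp add: mult.commute)
    then have "cong_mod q (zmul c w0) (heis.\<omega> (\<alpha> E) (\<alpha> F))"
      using cong_mod_trans[OF cong_mod_sym[OF \<zeta>c] ] \<zeta>_omega[OF EF(1,2)] by metis
    also have "cong_mod q \<dots> (heis.\<omega> (\<alpha> E) (0, r))" by (rule cong_mod_omega[OF cong_mod_refl EF(3)])
    finally show ?thesis by (simp add: xy omega_eq cong_mod_plane zmul_plane)
  qed
  have p12: "q dvd P * x" "q dvd P * y - det2 v1 r2"
    using pair[OF E1(1) F2(1) F(2) F2(2), of P] P(1) E1(2) by (simp_all add: det2_def v1_def)
  have p21: "q dvd - Q * y - det2 v2 r1"
    using pair[OF E2(1) F1(1) F(1) F1(2), of "- Q"] P(2) E2(2) by (simp add: det2_def v2_def)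
  have "det2 (fst (fst E2)) (0, p2) = l * 0" by (simp add: E2 det2_def)
  from pair[OF E2(1) F2(1) F(2) F2(2) this] have p22: "q dvd det2 v2 r2" by (simp add: v2_def)
  have pq: "\<not> q dvd P * y \<and> \<not> q dvd Q * y"
  proof (rule ccontr)
    assume "\<not> (\<not> q dvd P * y \<and> \<not> q dvd Q * y)"
    then have "q dvd det2 v1 r2 \<or> q dvd det2 v2 r1"
    proof (elim disjE[OF de_Morgan_conj[THEN iffD1]])
      assume "\<not> \<not> q dvd P * y"
      then have "q dvd P * y" by simp
      then have "q dvd P * y - (P * y - det2 v1 r2)" using p12(2) by (rule dvd_diff)
      then show ?thesis by simp
    next
      assume "\<not> \<not> q dvd Q * y"
      then have "q dvd - Q * y" by simp
      then have "q dvd - Q * y - (- Q * y - det2 v2 r1)" using p21 by (rule dvd_diff)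
      then show ?thesis by simp
    qed
    then have "q dvd det2 v1 r1 * det2 v2 r2 - det2 v1 r2 * det2 v2 r1"
      using p22 by (intro dvd_diff) auto
    \<comment> \<open>the determinant of a matrix of pairings is the product of two determinants\<close>
    also have "det2 v1 r1 * det2 v2 r2 - det2 v1 r2 * det2 v2 r1 = det2 v1 v2 * det2 r1 r2"
      by (simp add: det2_def algebra_simps)
    finally show False using q detv detr by (simp add: prime_dvd_mult_iff)
  qed
  have nP: "\<not> q dvd P" "\<not> q dvd Q" using pq by auto
  then have qx: "q dvd x" using p12(1) q by (simp add: prime_dvd_mult_iff)
  have "\<not> q dvd m'"
  proof
    assume m': "q dvd m'"
    have "m \<in> fst ` zero_fiber D" unfolding Mm by (simp add: mults_def)
    then obtain h0 where h0: "(m, h0) \<in> zero_fiber D" by force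
    define h where "h = snd (heis.\<omega> (fst E1) (fst E2))"
    have om: "heis.\<omega> (fst E1) (fst E2) = (d1 * d2, h)"
      by (simp add: h_def omega_eq E1 E2 det2_def)
    have "(d1 * d2, h) \<in> zero_fiber D" unfolding om[symmetric]
      by (rule heis.commutator_in_zero_fiber[OF D]) (use inD in auto)
    then have "(d1 * d2, h) - zmul m' (m, h0) \<in> zero_fiber D" by (intro lat_closed(3)[OF lM] lat_zmul[OF lM] h0)
    then have "h - m' * h0 \<in> zero_fiber (zero_fiber D)" using P(4) by (simp add: zmul_plane zero_fiber_def mult.commute)
    then obtain c where c: "h - m' * h0 = c * l" unfolding K mults_range by blast
    then have dh: "(d1 * d2, h) = zmul m' (m, h0) + (0, c * l)" using P(4) by (simp add: zmul_plane mult.commute)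
    have cl: "(0, c * l) \<in> zero_fiber D" using lat_zmul[OF lM l, of c] by (simp add: zmul_plane)
    have "cong_mod q (heis.\<omega> (\<alpha> E1) (\<alpha> E2)) (\<zeta> (d1 * d2, h))"
      using cong_mod_sym[OF \<zeta>_omega[OF E1(1) E2(1)]] unfolding om .
    also have "cong_mod q (\<zeta> (d1 * d2, h)) (\<zeta> (zmul m' (m, h0)) + \<zeta> (0, c * l))"
      unfolding dh by (rule \<zeta>_add[OF lat_zmul[OF lM h0] cl])
    also have "cong_mod q \<dots> (zmul m' (\<zeta> (m, h0)) + zmul c w0)" by (intro cong_mod_add \<zeta>_zmul h0 \<zeta>c)
    also have "cong_mod q \<dots> (0 + zmul c w0)" by (intro cong_mod_add cong_mod_refl cong_mod_zmul_0 m')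
    finally have "q dvd det2 v1 v2 - c * x" by (simp add: cong_mod_plane omega_eq xy zmul_plane v1_def v2_def)
    then have "q dvd (det2 v1 v2 - c * x) + c * x" using qx by (intro dvd_add) simp_all
    then show False using detv by simp
  qed
  then show ?thesis using nP by blast
qed

end

lemma one_if_no_prime:
  assumes "(n::int) > 0" "\<And>q. prime q \<Longrightarrow> \<not> q dvd n"
  shows "n = 1"
proof (rule ccontr)
  assume "n \<noteq> 1"
  then have "\<not> is_unit n" using assms(1) by auto
  then obtain q where "prime q" "q dvd n" using prime_divisor_exists[of n] assms(1) by auto
  then show False using assms(2) by blast
qed

text \<open>Integers prime to all primes are units, so the pairing is \<open>l\<close> times a perfect one. With \<open>P = Q = 1\<close> the
triangular bases of image and kernel become proportional after a change of basis, and comparing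
indices shows that \<open>M\<close> is no larger than the span of the commutators.\<close>

theorem standard_form_if_locally:
  assumes D: "subgroup D heis" and fin: "card (rcosets\<^bsub>heis\<^esub> D) > 0"
    and epi: "\<And>q. prime q \<Longrightarrow> \<exists>f. epi_mod q D f"
  shows "standard_form D"
proof -
  define La M where "La = fst ` D" and "M = zero_fiber D"
  have La: "lat La" and M: "lat M" using heis.lat_proj[OF D] heis.lat_zero_fiber[OF D] by (simp_all add: La_def M_def)
  have "idx La * idx M > 0" using fin heis.card_rcosets_tw[OF D] by (simp add: La_def M_def)
  then have iLa: "idx La > 0" and iM: "idx M > 0" by simp_all
  then have i: "idx (fst ` La) > 0" "idx (zero_fiber La) > 0" "idx (fst ` M) > 0" "idx (zero_fiber M) > 0"
    using idx_prod[OF La] idx_prod[OF M] by auto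
  obtain d1 d2 t where d: "d1 > 0" "d2 > 0" "int (idx (fst ` La)) = d1 * d2"
    and A: "fst ` La = hermite d1 t d2"
    using hermite_basis[OF lat_fst[OF La] i(1)] .
  obtain p1 p2 s where p: "p1 > 0" "p2 > 0" "int (idx (zero_fiber La)) = p1 * p2"
    and B: "zero_fiber La = hermite p1 s p2"
    using hermite_basis[OF lat_zero_fiber[OF La] i(2)] .
  define m l where "m = int (idx (fst ` M))" and "l = int (idx (zero_fiber M))"
  have ml: "m > 0" "l > 0" "fst ` M = mults m" "zero_fiber M = mults l"
    using i lat_int_idx[OF lat_fst[OF M]] lat_int_idx[OF lat_zero_fiber[OF M]] by (simp_all add: m_def l_def)
  have om: "heis.\<omega> x y \<in> M" if "x \<in> La" "y \<in> La" for x y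
    using heis.commutator_in_zero_fiber[OF D] that by (simp add: La_def M_def)
  have "(d1, t) \<in> fst ` La" unfolding A by (rule hermite_mem)
  then obtain g1 where e1: "((d1, t), g1) \<in> La" by force
  have "(0, d2) \<in> fst ` La" unfolding A by (rule hermite_mem)
  then obtain g2 where e2: "((0, d2), g2) \<in> La" by force
  have "(p1, s) \<in> zero_fiber La" unfolding B by (rule hermite_mem)
  then have f1: "((0, 0), (p1, s)) \<in> La" by (simp add: zero_fiber_def zero_prod_def)
  have "(0, p2) \<in> zero_fiber La" unfolding B by (rule hermite_mem)
  then have f2: "((0, 0), (0, p2)) \<in> La" by (simp add: zero_fiber_def zero_prod_def)
  have kM: "l dvd z" if "(0, z) \<in> M" for z
    using that ml(4) by (auto simp: zero_fiber_def mults_def)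
  have "l dvd d1 * p2" using om[OF e1 f2] by (intro kM) (simp add: omega_eq det2_def)
  moreover have "l dvd - (d2 * p1)" using om[OF e2 f1] by (intro kM) (simp add: omega_eq det2_def)
  moreover have "l dvd d1 * s - t * p1" using om[OF e1 f1] by (intro kM) (simp add: omega_eq det2_def)
  ultimately obtain P Q R where PQR: "d1 * p2 = l * P" "d2 * p1 = l * Q" "d1 * s - t * p1 = l * R"
    by (meson dvdE dvd_minus_iff)
  have "fst (heis.\<omega> ((d1, t), g1) ((0, d2), g2)) \<in> fst ` M" using om[OF e1 e2] by blast
  then have "m dvd d1 * d2" unfolding ml(3) by (simp add: omega_eq det2_def mults_def)
  then obtain m' where m': "d1 * d2 = m * m'" by (rule dvdE)
  have pos: "P > 0" "Q > 0" "m' > 0"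
    using PQR(1,2) m' d p ml by (metis mult_pos_pos zero_less_mult_pos)+
  have np: "\<not> q dvd P \<and> \<not> q dvd Q \<and> \<not> q dvd m'" if q: "prime q" for q
  proof -
    obtain f where "epi_mod q D f" using epi[OF q] by blast
    then interpret epi_mod_prime q D f using D q by (simp add: epi_mod_prime_def)
    show ?thesis by (rule unimodular[OF A[unfolded La_def] B[unfolded La_def]
        ml(4,3)[unfolded M_def] PQR m'])
  qed
  have "P = 1" "Q = 1" "m' = 1" using pos np by (auto intro: one_if_no_prime)
  then have l: "d1 * p2 = l" "d2 * p1 = l" and mm: "m = d1 * d2" using PQR m' by auto
  \<comment> \<open>the two bases agree after scaling, up to adding \<open>R\<close> times the second basis vector to the first\<close>
  have hom: "dilate (d1 * d2) (zero_fiber La) = dilate l (fst ` La)"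
  proof -
    have "d1 * d2 * s = d2 * (l * R + t * p1)" using PQR(3) by (metis diff_eq_eq mult.assoc mult.commute)
    also have "\<dots> = l * t + R * (l * d2)" using l(2) by (simp add: algebra_simps)
    finally have ds: "d1 * d2 * s = l * t + R * (l * d2)" .
    have e: "(k * (d1 * d2 * p1), k * (d1 * d2 * s) + n * (d1 * d2 * p2)) =
        (k * (l * d1), k * (l * t) + (k * R + n) * (l * d2))" for k n
      unfolding ds using l by (auto simp: algebra_simps)
    have "(k * (l * d1), k * (l * t) + n * (l * d2)) =
        (k * (d1 * d2 * p1), k * (d1 * d2 * s) + (n - k * R) * (d1 * d2 * p2))" for k n
    proof -
      have c: "k * R + (n - k * R) = n" by simp
      show ?thesis using e[of k "n - k * R"] unfolding c by (rule HOL.sym)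
    qed
    then show ?thesis unfolding A B dilate_basis using e by blast
  qed
  obtain u L where u: "u > 0" "primitive_lat L" "fst ` La = dilate u L"
    using primitive_part[OF lat_fst[OF La] i(1)] by blast
  obtain v K where v: "v > 0" "primitive_lat K" "zero_fiber La = dilate v K"
    using primitive_part[OF lat_zero_fiber[OF La] i(2)] by blast
  have "dilate (d1 * d2 * v) K = dilate (l * u) L" using hom unfolding u(3) v(3) dilate_dilate .
  then have uv: "d1 * d2 * v = l * u" and KL: "K = L"
    using primitive_part_unique[OF _ _ _ v(2) u(2)] u(1) v(1) d(1,2) ml(2) by simp_all
  have sh: "homothetic u v L La"
    using u v La KL by (simp add: homothetic_def)
  have "d1 * d2 = u ^ 2 * int (idx L)"
    using d(3) idx_dilate[of L u] u by (simp add: primitive_lat_def)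
  moreover have "int (idx M) = d1 * d2 * l"
    using idx_prod[OF M] mm by (simp add: m_def l_def)
  ultimately have "int (idx M) * u = u ^ 2 * int (idx L) * (u ^ 2 * int (idx L) * v)"
    using uv by (simp add: algebra_simps)
  also have "\<dots> = int (idx (commutator_span La)) * u"
    using u v by (simp add: idx_commutator_span[OF sh] algebra_simps power2_eq_square power3_eq_cube)
  finally have "idx M = idx (commutator_span La)" using u(1) by simp
  moreover have "commutator_span La \<subseteq> M" by (rule commutator_span_subset[OF M om])
  ultimately have "commutator_span La = M" using plane_eq_if_idx[OF lat_commutator_span M] iM by simp
  then show ?thesis using D sh by (auto simp: standard_form_def La_def M_def)
qed

section \<open>Counting the subgroups of standard form\<close>

definition standard_subgroups :: "int \<Rightarrow> int \<Rightarrow> plane set \<Rightarrow> heis_elt set set" where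
  "standard_subgroups u v L = {D. subgroup D heis \<and> homothetic u v L (fst ` D) \<and> zero_fiber D = commutator_span (fst ` D)}"

text \<open>The factor \<open>(v\<^sup>2 N)\<^sup>2\<close> counts the lattices over the given image and kernel, the factor \<open>(u\<^sup>3 v N\<^sup>2)\<^sup>4\<close> the
subgroups over each lattice.\<close>

lemma card_standard_subgroups:
  assumes "u > 0" "v > 0" "primitive_lat L"
  shows "card (standard_subgroups u v L) = nat (u ^ 12 * v ^ 8) * idx L ^ 10" "finite (standard_subgroups u v L)"
proof -
  have L: "lat L" "idx L > 0" using assms(3) by (auto simp: primitive_lat_def)
  define S where "S = {\<Lambda>. homothetic u v L \<Lambda>}"
  define A where "A \<Lambda> = heis.subgroups_over \<Lambda> (commutator_span \<Lambda>)" for \<Lambda>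
  have S_eq: "S = {\<Lambda>. lat \<Lambda> \<and> fst ` \<Lambda> = dilate u L \<and> zero_fiber \<Lambda> = dilate v L}"
    using assms by (auto simp: S_def homothetic_def)
  have "free_rank (dilate u L) 2"
    using L assms(1) by (intro free_rank_plane lat_dilate) (simp_all add: idx_dilate)
  from card_lat_fiber[OF this lat_dilate[OF L(1), of v]]
  have cS: "card S = (nat (v ^ 2) * idx L) ^ 2"
    unfolding S_eq using assms(2) L(1) by (simp add: idx_dilate)
  have cpos: "card S > 0" unfolding cS using assms(2) L(2) by simp
  have cA: "card (A \<Lambda>) = (nat (u ^ 3 * v) * idx L ^ 2) ^ 4" if "\<Lambda> \<in> S" for \<Lambda>
  proof -
    have sh: "homothetic u v L \<Lambda>" using that by (simp add: S_def)
    have "idx \<Lambda> > 0" unfolding idx_homothetic[OF sh] using assms(1,2) L(2) by simp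
    then have "free_rank \<Lambda> 4" using sh by (intro free_rank_4) (simp_all add: homothetic_def)
    then show ?thesis unfolding A_def
      using heis.card_subgroups_over[OF _ lat_commutator_span omega_in_commutator_span] idx_commutator_span[OF sh] by simp
  qed
  have fA: "finite (A \<Lambda>)" if "\<Lambda> \<in> S" for \<Lambda>
    by (rule card_ge_0_finite) (use cA[OF that] assms L(2) in simp)
  have U: "standard_subgroups u v L = (\<Union>\<Lambda>\<in>S. A \<Lambda>)"
    by (auto simp: standard_subgroups_def S_def A_def heis.subgroups_over_def)
  have fS: "finite S" using cpos by (rule card_ge_0_finite)
  have disj: "A \<Lambda> \<inter> A \<Lambda>' = {}" if "\<Lambda> \<noteq> \<Lambda>'" for \<Lambda> \<Lambda>'
    using that by (auto simp: A_def heis.subgroups_over_def)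
  have "card (standard_subgroups u v L) = (\<Sum>\<Lambda>\<in>S. card (A \<Lambda>))"
    unfolding U by (rule card_UN_disjoint) (use fS fA disj in auto)
  also have "\<dots> = (nat (v ^ 2) * idx L) ^ 2 * (nat (u ^ 3 * v) * idx L ^ 2) ^ 4"
    by (simp add: cA cS)
  also have "\<dots> = nat (u ^ 12 * v ^ 8) * idx L ^ 10"
    using assms(1,2) by (simp add: nat_power_eq nat_mult_distrib power_mult_distrib power_mult[symmetric]
        power_add[symmetric] algebra_simps)
  finally show "card (standard_subgroups u v L) = nat (u ^ 12 * v ^ 8) * idx L ^ 10" .
  show "finite (standard_subgroups u v L)" unfolding U using fS fA by auto
qed

lemma standard_subgroups_unique:
  assumes "D \<in> standard_subgroups u v L" "D \<in> standard_subgroups u' v' L'"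
  shows "u = u' \<and> v = v' \<and> L = L'"
proof -
  have 1: "u > 0" "v > 0" "primitive_lat L" "u' > 0" "v' > 0" "primitive_lat L'" "dilate u L = dilate u' L'" "dilate v L = dilate v' L'"
    using assms by (auto simp: standard_subgroups_def homothetic_def)
  show ?thesis
    using primitive_part_unique[OF 1(7,1,4,3,6)] primitive_part_unique[OF 1(8,2,5,3,6)] by blast
qed

definition exponents :: "nat \<Rightarrow> (nat \<times> nat \<times> nat) set" where
  "exponents k = {(a, b, m). 5 * a + 3 * b + 4 * m = k}"

lemma finite_exponents: "finite (exponents k)"
  by (rule finite_subset[of _ "{..k} \<times> {..k} \<times> {..k}"]) (auto simp: exponents_def)

definition prim_count :: "nat \<Rightarrow> nat \<Rightarrow> nat" where
  "prim_count p m = (if m = 0 then 1 else p ^ m + p ^ (m - 1))"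

lemma card_standard_form_prime_power:
  assumes p: "prime (p::nat)"
  shows "card {D. standard_form D \<and> card (rcosets\<^bsub>heis\<^esub> D) = p ^ k} =
    (\<Sum>(a, b, m)\<in>exponents k. p ^ (12 * a + 8 * b + 10 * m) * prim_count p m)"
proof -
  define I where "I = (SIGMA x:exponents k. {L. primitive_lat L \<and> idx L = p ^ snd (snd x)})"
  define A where "A = (\<lambda>x :: (nat \<times> nat \<times> nat) \<times> plane set. standard_subgroups (int p ^ fst (fst x)) (int p ^ fst (snd (fst x))) (snd x))"
  have p0: "p > 0" "p > 1" using prime_gt_1_nat[OF p] by simp_all
  have "{D. standard_form D \<and> card (rcosets\<^bsub>heis\<^esub> D) = p ^ k} = (\<Union>x\<in>I. A x)"
  proof (intro equalityI subsetI)
    fix D assume "D \<in> {D. standard_form D \<and> card (rcosets\<^bsub>heis\<^esub> D) = p ^ k}"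
    then obtain u v L where D: "subgroup D heis" "zero_fiber D = commutator_span (fst ` D)" "homothetic u v L (fst ` D)"
      and i: "card (rcosets\<^bsub>heis\<^esub> D) = p ^ k" by (auto simp: standard_form_def)
    have uv: "u > 0" "v > 0" "primitive_lat L" using D(3) by (auto simp: homothetic_def)
    have e: "nat u ^ 5 * nat v ^ 3 * idx L ^ 4 = p ^ k"
      using index_standard_form[OF D(1,3,2)] i uv by (simp add: nat_mult_distrib nat_power_eq)
    have "nat u dvd nat u ^ 5 * nat v ^ 3 * idx L ^ 4"
      by (intro dvd_mult2) (simp add: dvd_power)
    then have "nat u dvd p ^ k" unfolding e .
    then obtain a where a: "nat u = p ^ a" using divides_primepow_nat[OF p] by auto
    have "nat v dvd nat u ^ 5 * nat v ^ 3 * idx L ^ 4"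
      by (intro dvd_mult2 dvd_mult) (simp add: dvd_power)
    then have "nat v dvd p ^ k" unfolding e .
    then obtain b where b: "nat v = p ^ b" using divides_primepow_nat[OF p] by auto
    have "idx L dvd nat u ^ 5 * nat v ^ 3 * idx L ^ 4"
      by (intro dvd_mult) (simp add: dvd_power)
    then have "idx L dvd p ^ k" unfolding e .
    then obtain m where m: "idx L = p ^ m" using divides_primepow_nat[OF p] by auto
    have "p ^ (5 * a + 3 * b + 4 * m) = p ^ k"
      using e unfolding a b m by (simp add: power_add power_mult mult.commute flip: power_mult)
    then have "5 * a + 3 * b + 4 * m = k" using p0 by (simp add: power_inject_exp)
    moreover have "u = int p ^ a" "v = int p ^ b" using a b uv by (metis int_nat_eq less_imp_le of_nat_power)+
    ultimately have "((a, b, m), L) \<in> I" "D \<in> A ((a, b, m), L)"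
      using uv m D by (auto simp: I_def A_def exponents_def standard_subgroups_def)
    then show "D \<in> (\<Union>x\<in>I. A x)" by blast
  next
    fix D assume "D \<in> (\<Union>x\<in>I. A x)"
    then obtain a b m L where x: "5 * a + 3 * b + 4 * m = k" "primitive_lat L" "idx L = p ^ m"
      and D: "subgroup D heis" "homothetic (int p ^ a) (int p ^ b) L (fst ` D)" "zero_fiber D = commutator_span (fst ` D)"
      by (auto simp: I_def A_def exponents_def standard_subgroups_def)
    have "card (rcosets\<^bsub>heis\<^esub> D) = nat ((int p ^ a) ^ 5 * (int p ^ b) ^ 3) * (p ^ m) ^ 4"
      using index_standard_form[OF D] x(3) by simp
    also have "nat ((int p ^ a) ^ 5 * (int p ^ b) ^ 3) = (p ^ a) ^ 5 * (p ^ b) ^ 3"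
      by (simp add: nat_mult_distrib nat_power_eq)
    also have "(p ^ a) ^ 5 * (p ^ b) ^ 3 * (p ^ m) ^ 4 = p ^ k"
      unfolding x(1)[symmetric] by (simp add: power_add mult.commute flip: power_mult)
    finally show "D \<in> {D. standard_form D \<and> card (rcosets\<^bsub>heis\<^esub> D) = p ^ k}"
      using D by (auto simp: standard_form_def)
  qed
  moreover have "card (\<Union>x\<in>I. A x) = (\<Sum>x\<in>I. card (A x))"
  proof (rule card_UN_disjoint)
    show "finite I" unfolding I_def
      using finite_exponents card_primitive_prime_power(2)[OF p] by (intro finite_SigmaI) auto
    show "\<forall>x\<in>I. finite (A x)"
      using card_standard_subgroups(2) p0 by (auto simp: I_def A_def)
    show "\<forall>x\<in>I. \<forall>y\<in>I. x \<noteq> y \<longrightarrow> A x \<inter> A y = {}"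
    proof (intro ballI impI equals0I)
      fix x y D assume xy: "x \<in> I" "y \<in> I" "x \<noteq> y" "D \<in> A x \<inter> A y"
      obtain a b m L a' b' m' L' where x: "x = ((a, b, m), L)" and y: "y = ((a', b', m'), L')"
        by (metis prod.collapse)
      have "int p ^ a = int p ^ a' \<and> int p ^ b = int p ^ b' \<and> L = L'"
        using xy(4) by (intro standard_subgroups_unique[of D]) (auto simp: x y A_def)
      moreover from this have "p ^ m = p ^ m'" using xy(1,2) by (auto simp: x y I_def)
      ultimately show False using xy(3) p0 by (auto simp: x y power_inject_exp)
    qed
  qed
  moreover have "(\<Sum>x\<in>I. card (A x)) =
      (\<Sum>(a, b, m)\<in>exponents k. p ^ (12 * a + 8 * b + 10 * m) * prim_count p m)"
  proof -
    have c: "card (A (x, L)) = p ^ (12 * fst x + 8 * fst (snd x) + 10 * snd (snd x))"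
      if "primitive_lat L" "idx L = p ^ snd (snd x)" for x L
    proof -
      have "card (A (x, L)) = nat ((int p ^ fst x) ^ 12 * (int p ^ fst (snd x)) ^ 8) * (p ^ snd (snd x)) ^ 10"
        unfolding A_def using card_standard_subgroups(1)[of "int p ^ fst x" "int p ^ fst (snd x)" L] that p0 by simp
      also have "nat ((int p ^ fst x) ^ 12 * (int p ^ fst (snd x)) ^ 8) = (p ^ fst x) ^ 12 * (p ^ fst (snd x)) ^ 8"
        by (simp add: nat_mult_distrib nat_power_eq)
      finally show ?thesis by (simp add: power_add mult.commute flip: power_mult)
    qed
    have "(\<Sum>x\<in>I. card (A x)) = (\<Sum>x\<in>exponents k. \<Sum>L\<in>{L. primitive_lat L \<and> idx L = p ^ snd (snd x)}. card (A (x, L)))"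
      unfolding I_def using finite_exponents card_primitive_prime_power(2)[OF p]
      by (subst sum.Sigma) auto
    also have "\<dots> = (\<Sum>x\<in>exponents k. p ^ (12 * fst x + 8 * fst (snd x) + 10 * snd (snd x)) * prim_count p (snd (snd x)))"
      by (rule sum.cong[OF HOL.refl])
        (simp add: c card_primitive_prime_power(1)[OF p] prim_count_def mult.commute)
    finally show ?thesis by (simp add: case_prod_unfold)
  qed
  ultimately show ?thesis by simp
qed

section \<open>Reduction modulo a prime\<close>

definition reduce_plane :: "int \<Rightarrow> plane \<Rightarrow> plane" where
  "reduce_plane q v = (fst v mod q, snd v mod q)"

definition reduce :: "int \<Rightarrow> heis_elt \<Rightarrow> heis_elt" where
  "reduce q x = ((reduce_plane q (fst (fst x)), reduce_plane q (snd (fst x))), reduce_plane q (snd x))"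

lemma reduce_eq_iff: "reduce q x = reduce q y \<longleftrightarrow> cong_mod q x y"
  by (auto simp: reduce_def reduce_plane_def cong_mod_prod[of q x] cong_mod_prod[of q "fst x"] cong_mod_plane mod_eq_dvd_iff)

lemma cong_mod_reduce: "cong_mod q (reduce q x) x"
  by (subst reduce_eq_iff[symmetric]) (simp add: reduce_def reduce_plane_def)

text \<open>The reduction of the model modulo \<open>q\<close> on canonical representatives, a finite image of the model.\<close>

definition heis_mod :: "int \<Rightarrow> heis_elt monoid" where
  "heis_mod q = \<lparr>carrier = range (reduce q), monoid.mult = (\<lambda>x y. reduce q (x \<star> y)), one = reduce q (0, 0)\<rparr>"

lemma reduce_hom: "reduce q \<in> hom heis (heis_mod q)"
proof -
  have "reduce q (x \<star> y) = reduce q (reduce q x \<star> reduce q y)" for x y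
    unfolding reduce_eq_iff by (intro cong_mod_heis_mult cong_mod_sym[OF cong_mod_reduce])
  then show ?thesis by (simp add: hom_def heis_mod_def del: tw_simps(3))
qed

lemma group_heis_mod: "group (heis_mod q)"
  using heis.G.hom_imp_img_group[OF reduce_hom[of q]] by (simp add: heis_mod_def)

lemma finite_heis_mod:
  assumes "q > 0"
  shows "finite (carrier (heis_mod q))"
proof (rule finite_subset)
  show "carrier (heis_mod q) \<subseteq> (({0..<q} \<times> {0..<q}) \<times> ({0..<q} \<times> {0..<q})) \<times> ({0..<q} \<times> {0..<q})"
    using assms by (auto simp: heis_mod_def reduce_def reduce_plane_def)
qed auto

section \<open>Pro-isomorphic subgroups of the presented group\<close>

abbreviation to_Gamma where "to_Gamma \<equiv> Gamma.nf"

definition of_Gamma where "of_Gamma = inv_into UNIV to_Gamma"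

lemma of_Gamma: "of_Gamma \<in> iso Gamma_t2 heis" "of_Gamma (to_Gamma x) = x"
    "y \<in> carrier Gamma_t2 \<Longrightarrow> to_Gamma (of_Gamma y) = y"
proof -
  have bij: "bij_betw to_Gamma UNIV (carrier Gamma_t2)" using nf_in_iso by (simp add: iso_def)
  show "of_Gamma \<in> iso Gamma_t2 heis"
    using heis.G.iso_set_sym[OF nf_in_iso] by (simp add: of_Gamma_def)
  show "of_Gamma (to_Gamma x) = x"
    using bij by (simp add: of_Gamma_def bij_betw_def)
  show "y \<in> carrier Gamma_t2 \<Longrightarrow> to_Gamma (of_Gamma y) = y"
    using bij by (simp add: of_Gamma_def bij_betw_def f_inv_into_f)
qed

lemma pro_iso_if_standard_form:
  assumes "standard_form D"
  shows "profinite_completions_iso (Gamma_t2\<lparr>carrier := to_Gamma ` D\<rparr>) Gamma_t2"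
proof -
  have D: "subgroup D heis" using assms by (simp add: standard_form_def)
  interpret h: group_hom heis Gamma_t2 to_Gamma
    using Gamma.nf_hom by (simp add: group_hom_def group_hom_axioms_def heis.group_tw group_Gamma)
  have hD: "subgroup (to_Gamma ` D) Gamma_t2" by (rule h.subgroup_img_is_subgroup[OF D])
  have gD: "group (heis\<lparr>carrier := D\<rparr>)" "group (Gamma_t2\<lparr>carrier := to_Gamma ` D\<rparr>)"
    using subgroup.subgroup_is_group[OF D heis.group_tw] subgroup.subgroup_is_group[OF hD group_Gamma] by auto
  have "restrict to_Gamma D \<in> iso (heis\<lparr>carrier := D\<rparr>) (Gamma_t2\<lparr>carrier := to_Gamma ` D\<rparr>)"
    by (rule iso_restrict[OF nf_in_iso heis.group_tw group_Gamma D])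
  then have "heis\<lparr>carrier := D\<rparr> \<cong> Gamma_t2\<lparr>carrier := to_Gamma ` D\<rparr>" by (rule is_isoI)
  then have "Gamma_t2\<lparr>carrier := to_Gamma ` D\<rparr> \<cong> heis\<lparr>carrier := D\<rparr>" by (rule group.iso_sym[OF gD(1)])
  also have "heis\<lparr>carrier := D\<rparr> \<cong> heis" by (rule heis.G.iso_sym[OF standard_form_iso[OF assms]])
  also have "heis \<cong> Gamma_t2" using nf_in_iso by (rule is_isoI)
  finally show ?thesis by (rule iso_imp_profinite_completions_iso[OF gD(2) group_Gamma])
qed

lemma standard_form_if_pro_iso:
  assumes D: "subgroup D heis" and fin: "card (rcosets\<^bsub>heis\<^esub> D) > 0"
    and iso: "profinite_completions_iso (Gamma_t2\<lparr>carrier := to_Gamma ` D\<rparr>) Gamma_t2"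
  shows "standard_form D"
proof (rule standard_form_if_locally[OF D fin])
  fix q :: int assume q: "prime q"
  interpret h: group_hom heis Gamma_t2 to_Gamma
    using Gamma.nf_hom by (simp add: group_hom_def group_hom_axioms_def heis.group_tw group_Gamma)
  have hD: "subgroup (to_Gamma ` D) Gamma_t2" by (rule h.subgroup_img_is_subgroup[OF D])
  have gD: "group (Gamma_t2\<lparr>carrier := to_Gamma ` D\<rparr>)"
    by (rule subgroup.subgroup_is_group[OF hD group_Gamma])
  have "of_Gamma \<in> hom Gamma_t2 heis" using of_Gamma(1) by (simp add: iso_def)
  then have 1: "reduce q \<circ> of_Gamma \<in> hom Gamma_t2 (heis_mod q)" by (rule hom_compose[OF _ reduce_hom])
  have c: "of_Gamma ` carrier Gamma_t2 = UNIV"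
    using of_Gamma(1) by (simp add: iso_def bij_betw_def)
  have 2: "(reduce q \<circ> of_Gamma) ` carrier Gamma_t2 = carrier (heis_mod q)"
    unfolding image_comp[symmetric] c by (simp add: heis_mod_def)
  have 3: "finite (carrier (heis_mod q))" using q by (intro finite_heis_mod prime_gt_0_int)
  obtain F where F: "F \<in> hom (Gamma_t2\<lparr>carrier := to_Gamma ` D\<rparr>) (heis_mod q)"
      "F ` carrier (Gamma_t2\<lparr>carrier := to_Gamma ` D\<rparr>) = carrier (heis_mod q)"
    by (rule finite_quotient_transfer[OF gD group_Gamma iso group_heis_mod 3 1 2])
  have F2: "F ` (to_Gamma ` D) = range (reduce q)" using F(2) by (simp add: heis_mod_def)
  have "epi_mod q D (\<lambda>x. F (to_Gamma x))"
    unfolding epi_mod_def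
  proof (intro conjI ballI allI)
    fix x y assume xy: "x \<in> D" "y \<in> D"
    have "F (to_Gamma (x \<star> y)) = reduce q (F (to_Gamma x) \<star> F (to_Gamma y))"
      using F(1) xy h.hom_mult[of x y] by (simp add: hom_def heis_mod_def del: tw_simps(3))
    then show "cong_mod q (F (to_Gamma (x \<star> y))) (F (to_Gamma x) \<star> F (to_Gamma y))"
      by (simp only: cong_mod_reduce)
  next
    fix h
    have "reduce q h \<in> F ` (to_Gamma ` D)" unfolding F2 by simp
    then obtain y where y: "reduce q h = F y" "y \<in> to_Gamma ` D" by (rule imageE)
    from y(2) obtain x where x: "y = to_Gamma x" "x \<in> D" by (rule imageE)
    have "cong_mod q (F (to_Gamma x)) h" unfolding x(1)[symmetric] y(1)[symmetric] by (rule cong_mod_reduce)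
    then show "\<exists>x\<in>D. cong_mod q (F (to_Gamma x)) h" by (rule bexI[OF _ x(2)])
  qed
  then show "\<exists>f. epi_mod q D f" by blast
qed

text \<open>Transport along the isomorphism with the model turns pro-isomorphic subgroups into subgroups of
standard form.\<close>

lemma pro_iso_count_Gamma:
  assumes "n > 0"
  shows "pro_iso_count Gamma_t2 n = card {D. standard_form D \<and> card (rcosets\<^bsub>heis\<^esub> D) = n}"
proof -
  interpret h: group_hom heis Gamma_t2 to_Gamma
    using Gamma.nf_hom by (simp add: group_hom_def group_hom_axioms_def heis.group_tw group_Gamma)
  interpret k: group_hom Gamma_t2 heis of_Gamma
    using of_Gamma(1) by (simp add: group_hom_def group_hom_axioms_def heis.group_tw group_Gamma iso_def)
  have inj: "inj to_Gamma" by (rule inj_on_inverseI[of _ of_Gamma]) (simp add: of_Gamma)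
  have index: "card (rcosets\<^bsub>Gamma_t2\<^esub> (to_Gamma ` D)) = card (rcosets\<^bsub>heis\<^esub> D)" for D
    using iso_image_rcosets[OF nf_in_iso, of D] by (simp add: card_image inj_on_def inj_image_eq_iff[OF inj])
  let ?A = "{D. standard_form D \<and> card (rcosets\<^bsub>heis\<^esub> D) = n}"
  let ?B = "{D. subgroup D Gamma_t2 \<and> card (rcosets\<^bsub>Gamma_t2\<^esub> D) = n \<and>
              profinite_completions_iso (Gamma_t2\<lparr>carrier := D\<rparr>) Gamma_t2}"
  have "?B = (`) to_Gamma ` ?A"
  proof (intro equalityI subsetI)
    fix D assume D: "D \<in> ?B"
    then have sub: "D \<subseteq> carrier Gamma_t2" using subgroup.subset by auto
    define E where "E = of_Gamma ` D"
    have E: "subgroup E heis" unfolding E_def using D by (intro k.subgroup_img_is_subgroup) simp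
    have DE: "D = to_Gamma ` E"
      using sub of_Gamma(3) unfolding E_def by (force simp: image_image subset_iff)
    have "standard_form E" using D E assms index by (intro standard_form_if_pro_iso) (auto simp: DE)
    then show "D \<in> (`) to_Gamma ` ?A" using D DE index by auto
  next
    fix D assume "D \<in> (`) to_Gamma ` ?A"
    then obtain E where E: "standard_form E" "card (rcosets\<^bsub>heis\<^esub> E) = n" "D = to_Gamma ` E" by blast
    then show "D \<in> ?B"
      using h.subgroup_img_is_subgroup[of E] index pro_iso_if_standard_form[OF E(1)] by (simp add: standard_form_def)
  qed
  moreover have "inj_on ((`) to_Gamma) ?A" by (simp add: inj_on_def inj_image_eq_iff[OF inj])
  then have "card ((`) to_Gamma ` ?A) = card ?A" by (rule card_image)
  ultimately show ?thesis unfolding pro_iso_count_def by (simp only:)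
qed

theorem pro_iso_count_prime_power:
  assumes "prime p"
  shows "pro_iso_count Gamma_t2 (p ^ k) =
    (\<Sum>(a, b, m)\<in>exponents k. p ^ (12 * a + 8 * b + 10 * m) * prim_count p m)"
  using pro_iso_count_Gamma[of "p ^ k"] card_standard_form_prime_power[OF assms] prime_gt_0_nat[OF assms] by simp

section \<open>The generating function\<close>

text \<open>Absolute summability is kept together with the value, since it is what allows products to be
formed and the triple series to be regrouped by powers of \<open>y\<close>.\<close>

definition abs_has_sum :: "('a \<Rightarrow> complex) \<Rightarrow> complex \<Rightarrow> bool" where
  "abs_has_sum f S \<longleftrightarrow> (\<lambda>x. norm (f x)) summable_on UNIV \<and> (f has_sum S) UNIV"

lemma abs_has_sum_times:
  assumes "abs_has_sum f S" "abs_has_sum g T"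
  shows "abs_has_sum (\<lambda>(x, y). f x * g y) (S * T)"
proof -
  obtain G where G: "((\<lambda>y. norm (g y)) has_sum G) UNIV"
    using assms by (auto simp: abs_has_sum_def summable_on_def)
  have "(\<lambda>p. norm (f (fst p) * g (snd p))) summable_on Sigma UNIV (\<lambda>_. UNIV)"
  proof (rule summable_on_SigmaI)
    show "((\<lambda>y. norm (f (fst (x, y)) * g (snd (x, y)))) has_sum (norm (f x) * G)) UNIV" for x
      using has_sum_cmult_right[OF G, of "norm (f x)"] by (simp add: norm_mult)
    show "(\<lambda>x. norm (f x) * G) summable_on UNIV"
      using assms by (intro summable_on_cmult_left) (auto simp: abs_has_sum_def)
  qed auto
  then have 1: "(\<lambda>p. norm (f (fst p) * g (snd p))) summable_on UNIV" by simp
  have "((\<lambda>p. f (fst p) * g (snd p)) has_sum S * T) (Sigma UNIV (\<lambda>_. UNIV))"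
  proof (rule has_sum_SigmaI)
    show "((\<lambda>y. f (fst (x, y)) * g (snd (x, y))) has_sum f x * T) UNIV" for x
      using assms has_sum_cmult_right[of g UNIV T "f x"] by (simp add: abs_has_sum_def)
    show "((\<lambda>x. f x * T) has_sum S * T) UNIV"
      using assms by (intro has_sum_cmult_left) (auto simp: abs_has_sum_def)
    show "(\<lambda>p. f (fst p) * g (snd p)) summable_on Sigma UNIV (\<lambda>_. UNIV)"
      using abs_summable_summable[OF 1] by simp
  qed
  with 1 show ?thesis by (simp add: abs_has_sum_def case_prod_unfold)
qed

lemma abs_has_sum_geometric:
  assumes "norm c < 1"
  shows "abs_has_sum (\<lambda>n. c ^ n) (1 / (1 - c))"
proof -
  have 1: "summable (\<lambda>n. norm (c ^ n))" using assms by (simp add: norm_power summable_geometric)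
  then have "((\<lambda>n. c ^ n) has_sum 1 / (1 - c)) UNIV"
    by (rule norm_summable_imp_has_sum) (rule geometric_sums[OF assms])
  moreover have "(\<lambda>n. norm (c ^ n)) summable_on UNIV"
    using norm_summable_imp_summable_on[of "\<lambda>n. norm (c ^ n)"] 1 by simp
  ultimately show ?thesis by (simp add: abs_has_sum_def)
qed

lemma abs_has_sum_prim_count:
  assumes "norm (of_nat p * c) < 1" "p > 0"
  shows "abs_has_sum (\<lambda>m. of_nat (prim_count p m) * c ^ m) ((1 + c) / (1 - of_nat p * c))"
proof -
  define d where "d = of_nat p * c"
  have d: "norm d < 1" using assms by (simp add: d_def)
  then have d1: "1 - d \<noteq> 0" by auto
  have e: "of_nat (prim_count p m) * c ^ m = d ^ m + (if m = 0 then 0 else c * d ^ (m - 1))" for m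
    by (cases m) (simp_all add: prim_count_def d_def power_mult_distrib algebra_simps)
  have s: "summable (\<lambda>m. norm (d ^ m))" using d by (simp add: norm_power summable_geometric)
  have "summable (\<lambda>m. norm ((\<lambda>m. if m = 0 then 0 else c * d ^ (m - 1)) (Suc m)))"
    using summable_mult[OF s, of "norm c"] by (simp add: norm_mult)
  then have s2: "summable (\<lambda>m. norm (if m = 0 then 0 else c * d ^ (m - 1)))"
    by (subst (asm) summable_Suc_iff)
  have n: "summable (\<lambda>m. norm (of_nat (prim_count p m) * c ^ m))"
    unfolding e by (rule summable_comparison_test'[OF summable_add[OF s s2], of 0])
      (simp only: real_norm_def abs_norm_cancel norm_triangle_ineq)
  have "(\<lambda>m. (\<lambda>m. if m = 0 then 0 else c * d ^ (m - 1)) (Suc m)) sums (c * (1 / (1 - d)))"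
    using sums_mult[OF geometric_sums[OF d], of c] by simp
  then have "(\<lambda>m. if m = 0 then 0 else c * d ^ (m - 1)) sums (c * (1 / (1 - d)) + 0)"
    by (subst (asm) sums_Suc_iff) simp
  then have "(\<lambda>m. of_nat (prim_count p m) * c ^ m) sums (1 / (1 - d) + (c * (1 / (1 - d)) + 0))"
    unfolding e by (intro sums_add geometric_sums d)
  also have "1 / (1 - d) + (c * (1 / (1 - d)) + 0) = (1 + c) / (1 - d)"
    using d1 by (simp add: field_simps)
  finally have "((\<lambda>m. of_nat (prim_count p m) * c ^ m) has_sum (1 + c) / (1 - d)) UNIV"
    by (rule norm_summable_imp_has_sum[OF n])
  moreover have "(\<lambda>m. norm (of_nat (prim_count p m) * c ^ m)) summable_on UNIV"
    using norm_summable_imp_summable_on[of "\<lambda>m. norm (of_nat (prim_count p m) * c ^ m)"] n by simp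
  ultimately show ?thesis by (simp add: abs_has_sum_def d_def)
qed

definition count_coeff :: "nat \<Rightarrow> nat \<Rightarrow> nat" where
  "count_coeff p k = (\<Sum>(a, b, m)\<in>exponents k. p ^ (12 * a + 8 * b + 10 * m) * prim_count p m)"

text \<open>The triple series over all \<open>(a, b, m)\<close> is the product of three series; collecting the terms with
\<open>5 a + 3 b + 4 m = k\<close> gives the coefficient of \<open>y\<^sup>k\<close>.\<close>

lemma generating_function_sums:
  fixes y :: complex
  assumes "p > 0" and n: "norm (of_nat p ^ 12 * y ^ 5) < 1" "norm (of_nat p ^ 8 * y ^ 3) < 1" "norm (of_nat p ^ 11 * y ^ 4) < 1"
  shows "(\<lambda>k. of_nat (count_coeff p k) * y ^ k) sums
    ((1 + of_nat p ^ 10 * y ^ 4) / ((1 - of_nat p ^ 8 * y ^ 3) * (1 - of_nat p ^ 11 * y ^ 4) * (1 - of_nat p ^ 12 * y ^ 5)))"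
proof -
  define A B C where "A = of_nat p ^ 12 * y ^ 5" and "B = of_nat p ^ 8 * y ^ 3" and "C = of_nat p ^ 10 * y ^ 4"
  have pC: "of_nat p * C = of_nat p ^ 11 * y ^ 4" by (simp add: C_def eval_nat_numeral)
  define t where "t = (\<lambda>(a, b, m). A ^ a * (B ^ b * (of_nat (prim_count p m) * C ^ m)))"
  have "abs_has_sum (\<lambda>(a, bm). A ^ a * (case bm of (b, m) \<Rightarrow> B ^ b * (of_nat (prim_count p m) * C ^ m)))
      (1 / (1 - A) * (1 / (1 - B) * ((1 + C) / (1 - of_nat p * C))))"
    by (intro abs_has_sum_times abs_has_sum_geometric abs_has_sum_prim_count assms(1))
      (use n in \<open>simp_all add: pC A_def B_def\<close>)
  moreover have "(\<lambda>(a, bm). A ^ a * (case bm of (b, m) \<Rightarrow> B ^ b * (of_nat (prim_count p m) * C ^ m))) = t"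
    by (auto simp: t_def fun_eq_iff)
  ultimately have sum: "(t has_sum (1 / (1 - A) * (1 / (1 - B) * ((1 + C) / (1 - of_nat p * C))))) UNIV"
    by (simp add: abs_has_sum_def)
  have "((\<lambda>x. t (snd x)) has_sum (1 / (1 - A) * (1 / (1 - B) * ((1 + C) / (1 - of_nat p * C))))) (Sigma UNIV exponents)"
  proof -
    have "bij_betw snd (Sigma UNIV exponents) (UNIV :: (nat \<times> nat \<times> nat) set)"
      by (rule bij_betwI[where g = "\<lambda>(a, b, m). (5 * a + 3 * b + 4 * m, (a, b, m))"])
        (auto simp: exponents_def)
    from has_sum_reindex_bij_betw[OF this, of t] sum show ?thesis by simp
  qed
  then have "((\<lambda>k. \<Sum>x\<in>exponents k. t x) has_sum (1 / (1 - A) * (1 / (1 - B) * ((1 + C) / (1 - of_nat p * C))))) UNIV"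
    by (rule has_sum_SigmaD) (auto intro!: has_sum_finiteI finite_exponents)
  then have "(\<lambda>k. \<Sum>x\<in>exponents k. t x) sums (1 / (1 - A) * (1 / (1 - B) * ((1 + C) / (1 - of_nat p * C))))"
    by (rule has_sum_imp_sums)
  also have "(\<lambda>k. \<Sum>x\<in>exponents k. t x) = (\<lambda>k. of_nat (count_coeff p k) * y ^ k)"
  proof
    fix k
    have "t x = of_nat (case x of (a, b, m) \<Rightarrow> p ^ (12 * a + 8 * b + 10 * m) * prim_count p m) * y ^ k"
      if "x \<in> exponents k" for x
    proof -
      obtain a b m where x: "x = (a, b, m)" by (metis prod.collapse)
      have k: "k = 5 * a + 3 * b + 4 * m" using that by (simp add: exponents_def x)
      show ?thesis unfolding x k
        by (simp add: t_def A_def B_def C_def power_mult_distrib power_mult power_add)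
    qed
    then show "(\<Sum>x\<in>exponents k. t x) = of_nat (count_coeff p k) * y ^ k"
      by (simp add: count_coeff_def sum_distrib_right)
  qed
  also have "1 / (1 - A) * (1 / (1 - B) * ((1 + C) / (1 - of_nat p * C))) =
     (1 + of_nat p ^ 10 * y ^ 4) / ((1 - of_nat p ^ 8 * y ^ 3) * (1 - of_nat p ^ 11 * y ^ 4) * (1 - of_nat p ^ 12 * y ^ 5))"
    unfolding pC by (simp add: A_def B_def C_def mult.commute mult.left_commute)
  finally show ?thesis .
qed

section \<open>Convergence of the local zeta function\<close>

lemma local_zeta_term_eq:
  assumes "prime p"
  shows "local_zeta_term Gamma_t2 p s k = of_nat (count_coeff p k) * (of_nat p powr (- s)) ^ k"
proof -
  have p: "(of_nat p :: complex) \<noteq> 0" using prime_gt_0_nat[OF assms] by simp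
  have "of_nat p powr (- (of_nat k * s)) = (of_nat p powr (- s) :: complex) ^ k"
    using p by (simp add: powr_def exp_of_nat_mult[symmetric] mult.assoc)
  then show ?thesis
    by (simp add: local_zeta_term_def count_coeff_def pro_iso_count_prime_power[OF assms])
qed

lemma norm_p_powr: "p > 0 \<Longrightarrow> norm (of_nat p powr (- s) :: complex) = real p powr (- Re s)"
  using norm_powr_real_powr[of "of_nat p" "- s"] by simp

lemma norm_term:
  assumes "p > 0"
  shows "norm (of_nat p ^ i * (of_nat p powr (- s)) ^ j :: complex) = real p powr (real i - real j * Re s)"
proof -
  have "norm (of_nat p ^ i * (of_nat p powr (- s)) ^ j :: complex) = real p ^ i * (real p powr (- Re s)) ^ j"
    using norm_p_powr[OF assms] by (simp add: norm_mult norm_power)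
  also have "\<dots> = real p powr (real i) * real p powr (real j * (- Re s))"
    using assms by (simp add: powr_realpow powr_power mult.commute)
  finally show ?thesis using assms by (simp add: powr_add[symmetric])
qed

lemma norm_term_less_1:
  assumes "p > 1" "real i < real j * Re s"
  shows "norm (of_nat p ^ i * (of_nat p powr (- s)) ^ j :: complex) < 1"
  using assms powr_less_mono[of "real i - real j * Re s" 0 "real p"] by (simp add: norm_term)

lemma local_zeta_sums:
  assumes p: "prime p" and s: "Re s > 11 / 4"
  shows "local_zeta_term Gamma_t2 p s sums
    (let x = of_nat p; y = of_nat p powr (- s) in
     (1 + x ^ 10 * y ^ 4) / ((1 - x ^ 8 * y ^ 3) * (1 - x ^ 11 * y ^ 4) * (1 - x ^ 12 * y ^ 5)))"
  unfolding Let_def local_zeta_term_eq[OF p]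
  using prime_gt_1_nat[OF p] s by (intro generating_function_sums norm_term_less_1) auto

text \<open>The contribution of \<open>(0, 0, m)\<close> alone makes the coefficient of index \<open>4 m\<close> at least \<open>p\<^bsup>11 m\<^esup>\<close>, so the terms do
not tend to zero.\<close>

lemma not_summable_local_zeta:
  assumes p: "prime p" and s: "Re s \<le> 11 / 4"
  shows "\<not> summable (local_zeta_term Gamma_t2 p s)"
proof
  assume "summable (local_zeta_term Gamma_t2 p s)"
  then have "(\<lambda>k. norm (local_zeta_term Gamma_t2 p s k)) \<longlonglongrightarrow> 0"
    by (intro tendsto_norm_zero summable_LIMSEQ_zero)
  then have lim: "(\<lambda>m. norm (local_zeta_term Gamma_t2 p s (4 * m))) \<longlonglongrightarrow> 0"
    by (rule filterlim_compose) (simp add: filterlim_subseq strict_mono_def)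
  have p1: "p > 1" using prime_gt_1_nat[OF p] .
  have "norm (local_zeta_term Gamma_t2 p s (4 * m)) \<ge> 1" for m
  proof -
    have "(0, 0, m) \<in> exponents (4 * m)" by (simp add: exponents_def)
    then have "p ^ (10 * m) * prim_count p m \<le> count_coeff p (4 * m)"
      unfolding count_coeff_def
      using member_le_sum[of "(0, 0, m)" "exponents (4 * m)" "\<lambda>(a, b, m). p ^ (12 * a + 8 * b + 10 * m) * prim_count p m"]
      by (auto simp: finite_exponents)
    moreover have "p ^ m \<le> prim_count p m" by (simp add: prim_count_def)
    ultimately have "p ^ (10 * m) * p ^ m \<le> count_coeff p (4 * m)"
      by (meson le_trans mult_le_mono2)
    then have c: "real (p ^ (11 * m)) \<le> real (count_coeff p (4 * m))"
      by (simp add: power_add[symmetric])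
    have "real p powr 0 \<le> real p powr (real (11 * m) - real (4 * m) * Re s)"
      using p1 s mult_left_mono[OF s, of "4 * real m"] by (intro powr_mono) auto
    also have "\<dots> = real (p ^ (11 * m)) * norm (of_nat p powr (- s) :: complex) ^ (4 * m)"
      using norm_term[of p "11 * m" s "4 * m"] p1 by (simp add: norm_mult norm_power)
    also have "\<dots> \<le> real (count_coeff p (4 * m)) * norm (of_nat p powr (- s) :: complex) ^ (4 * m)"
      by (rule mult_right_mono[OF c]) simp
    finally show ?thesis using p1 by (simp add: local_zeta_term_eq[OF p] norm_mult norm_power)
  qed
  then have "1 \<le> (0::real)" by (intro LIMSEQ_le_const[OF lim]) auto
  then show False by simp
qed

lemma local_zeta_abscissa_Gamma:
  assumes "prime p"
  shows "local_zeta_abscissa Gamma_t2 p = ereal (11 / 4)"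
proof -
  have "summable (local_zeta_term Gamma_t2 p s) \<longleftrightarrow> Re s > 11 / 4" for s
    using not_summable_local_zeta[OF assms, of s] local_zeta_sums[OF assms, of s]
    by (metis not_le sums_summable)
  then have "local_zeta_abscissa Gamma_t2 p = (INF s\<in>{s. Re s > 11 / 4}. ereal (Re s))"
    by (simp add: local_zeta_abscissa_def)
  also have "\<dots> = ereal (11 / 4)"
  proof (rule antisym)
    show "ereal (11 / 4) \<le> (INF s\<in>{s. Re s > 11 / 4}. ereal (Re s))"
      by (rule INF_greatest) auto
    show "(INF s\<in>{s. Re s > 11 / 4}. ereal (Re s)) \<le> ereal (11 / 4)"
    proof (rule dense_ge)
      fix e :: ereal assume "ereal (11 / 4) < e"
      then show "(INF s\<in>{s. Re s > 11 / 4}. ereal (Re s)) \<le> e"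
        by (cases e) (auto intro: INF_lower2[of "complex_of_real (real_of_ereal e)"])
    qed
  qed
  finally show ?thesis .
qed

section \<open>The rational function\<close>

definition num_t2 :: "rat poly poly" where
  "num_t2 = 1 + [:[:0, 1:]:] ^ 10 * [:0, 1:] ^ 4"

definition den_t2 :: "rat poly poly" where
  "den_t2 = (1 - [:[:0, 1:]:] ^ 8 * [:0, 1:] ^ 3) * (1 - [:[:0, 1:]:] ^ 11 * [:0, 1:] ^ 4) *
     (1 - [:[:0, 1:]:] ^ 12 * [:0, 1:] ^ 5)"

lemma W_t2_eq: "W_t2 = Fraction_Field.Fract num_t2 den_t2"
proof -
  have pow: "Fraction_Field.Fract a 1 ^ n = Fraction_Field.Fract (a ^ n) 1" for a :: "rat poly poly" and n
    by (induction n) (simp_all add: One_fract_def)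
  show ?thesis
    by (simp add: W_t2_def RX_def RY_def pow One_fract_def num_t2_def den_t2_def)
qed

lemma poly2_eval_1 [simp]: "poly2_eval 1 x y = 1"
  by (simp add: one_pCons poly2_eval_pCons map_poly_pCons)

lemma poly2_eval_power: "poly2_eval (a ^ n) x y = poly2_eval a x y ^ n"
  by (induction n) (simp_all add: poly2_eval_mult)

lemma poly2_eval_diff: "poly2_eval (a - b) x y = poly2_eval a x y - poly2_eval b x y"
  using poly2_eval_add[of "a - b" b x y] by simp

lemma poly2_eval_X [simp]: "poly2_eval [:[:0, 1:]:] x y = x"
  by (simp add: poly2_eval_pCons map_poly_pCons)

lemma poly2_eval_Y [simp]: "poly2_eval [:0, 1:] x y = y"
  by (simp add: poly2_eval_pCons)

lemma eval_num_t2: "poly2_eval num_t2 x y = 1 + x ^ 10 * y ^ 4"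
  by (simp add: num_t2_def poly2_eval_add poly2_eval_mult poly2_eval_power)

lemma eval_den_t2:
  "poly2_eval den_t2 x y = (1 - x ^ 8 * y ^ 3) * (1 - x ^ 11 * y ^ 4) * (1 - x ^ 12 * y ^ 5)"
  by (simp add: den_t2_def poly2_eval_diff poly2_eval_mult poly2_eval_power)

lemma den_t2_nonzero: "den_t2 \<noteq> 0"
proof
  assume "den_t2 = 0"
  then have "poly2_eval den_t2 0 0 = 0" by simp
  then show False by (simp add: eval_den_t2)
qed

lemma den_t2_convergent:
  assumes p: "prime p" and s: "Re s > 11 / 4"
  shows "poly2_eval den_t2 (of_nat p) (of_nat p powr (- s)) \<noteq> 0"
proof -
  have p1: "p > 1" using prime_gt_1_nat[OF p] .
  have "norm (of_nat p ^ 8 * (of_nat p powr (- s)) ^ 3 :: complex) < 1"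
    "norm (of_nat p ^ 11 * (of_nat p powr (- s)) ^ 4 :: complex) < 1"
    "norm (of_nat p ^ 12 * (of_nat p powr (- s)) ^ 5 :: complex) < 1"
    using p1 s by (intro norm_term_less_1; auto)+
  then show ?thesis unfolding eval_den_t2 by auto
qed

lemma Gamma_local_zeta_given_by:
  assumes p: "prime p"
  shows "local_zeta_given_by Gamma_t2 p W_t2"
  unfolding local_zeta_given_by_def local_zeta_abscissa_Gamma[OF p]
proof (intro conjI allI impI)
  fix s :: complex assume "ereal (11 / 4) < ereal (Re s)"
  then have s: "Re s > 11 / 4" by simp
  note d = den_t2_convergent[OF p s]
  show "ratfun_regular W_t2 (of_nat p) (of_nat p powr (- s))"
    unfolding ratfun_regular_def W_t2_eq using d by blast
  show "local_zeta Gamma_t2 p s = ratfun_eval W_t2 (of_nat p) (of_nat p powr (- s))"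
    unfolding W_t2_eq ratfun_eval_Fract[OF d] local_zeta_def eval_num_t2 eval_den_t2
    using sums_unique[OF local_zeta_sums[OF p s]] by (simp add: Let_def)
qed simp

text \<open>For fixed \<open>p\<close> the polynomial in \<open>y\<close> has infinitely many zeros, so its coefficients, polynomials in \<open>x\<close>, vanish
at every prime.\<close>

lemma poly2_zero:
  assumes "\<And>p s. prime (p::nat) \<Longrightarrow> Re s > 11 / 4 \<Longrightarrow> poly2_eval c (of_nat p) (of_nat p powr (- s)) = 0"
  shows "c = 0"
proof -
  have z: "map_poly (\<lambda>c. poly (map_poly of_rat c) (of_nat p)) c = (0 :: complex poly)" if p: "prime (p::nat)" for p
  proof (rule ccontr)
    let ?f = "map_poly (\<lambda>c. poly (map_poly of_rat c) (of_nat p)) c :: complex poly"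
    assume "?f \<noteq> 0"
    then have fin: "finite {x. poly ?f x = 0}" by (rule poly_roots_finite)
    have p1: "p > 1" using prime_gt_1_nat[OF p] .
    \<comment> \<open>the values of \<open>y\<close> at the real points \<open>s = 3 + n\<close>\<close>
    have "inj (\<lambda>n::nat. complex_of_real (real p powr (- (3 + real n))))"
      using p1 by (auto simp: inj_def powr_inj)
    then have "infinite (range (\<lambda>n::nat. complex_of_real (real p powr (- (3 + real n)))))"
      by (rule range_inj_infinite)
    moreover have "range (\<lambda>n::nat. complex_of_real (real p powr (- (3 + real n)))) \<subseteq> {x. poly ?f x = 0}"
    proof (intro image_subsetI CollectI)
      fix n :: nat
      have "of_nat p powr (- complex_of_real (3 + real n)) = complex_of_real (real p powr (- (3 + real n)))"
        using powr_of_real[of "real p" "- (3 + real n)"] by simp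
      then show "poly ?f (complex_of_real (real p powr (- (3 + real n)))) = 0"
        using assms[OF p, of "complex_of_real (3 + real n)"] by (simp add: poly2_eval_def)
    qed
    ultimately show False using fin finite_subset by blast
  qed
  have "coeff c i = 0" for i
  proof -
    have v: "poly (map_poly of_rat (coeff c i)) (of_nat p :: complex) = 0" if "prime (p::nat)" for p
      using arg_cong[OF z[OF that], of "\<lambda>f. coeff f i"] by (simp add: coeff_map_poly)
    have "(map_poly of_rat (coeff c i) :: complex poly) = 0"
    proof (rule ccontr)
      assume "(map_poly of_rat (coeff c i) :: complex poly) \<noteq> 0"
      then have "finite {x :: complex. poly (map_poly of_rat (coeff c i)) x = 0}" by (rule poly_roots_finite)
      then have "finite ((of_nat :: nat \<Rightarrow> complex) ` {p. prime p})"
        by (rule finite_subset[rotated]) (use v in auto)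
      then have "finite {p::nat. prime p}" by (rule finite_imageD) (simp add: inj_on_def)
      then show False using primes_infinite by blast
    qed
    then show ?thesis by (simp add: map_poly_eq_0_iff)
  qed
  then show ?thesis by (simp add: poly_eq_iff)
qed

lemma rational_function_unique:
  assumes "\<forall>p. prime p \<longrightarrow> local_zeta_given_by Gamma_t2 p W"
  shows "W = W_t2"
proof -
  obtain a b where W: "W = Fraction_Field.Fract a b" "b \<noteq> 0" by (rule Fract_cases)
  have "a * den_t2 - num_t2 * b = 0"
  proof (rule poly2_zero)
    fix p :: nat and s :: complex assume p: "prime p" and s: "Re s > 11 / 4"
    let ?x = "of_nat p :: complex" and ?y = "of_nat p powr (- s) :: complex"
    have "ratfun_regular W ?x ?y" "local_zeta Gamma_t2 p s = ratfun_eval W ?x ?y"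
      using assms p s by (auto simp: local_zeta_given_by_def local_zeta_abscissa_Gamma)
    moreover have "local_zeta Gamma_t2 p s = ratfun_eval W_t2 ?x ?y"
      using Gamma_local_zeta_given_by[OF p] p s by (auto simp: local_zeta_given_by_def local_zeta_abscissa_Gamma)
    ultimately obtain a' b' where W': "W = Fraction_Field.Fract a' b'" and b': "poly2_eval b' ?x ?y \<noteq> 0"
      and e: "ratfun_eval W ?x ?y = ratfun_eval W_t2 ?x ?y"
      by (auto simp: ratfun_regular_def)
    note d = den_t2_convergent[OF p s]
    have "b' \<noteq> 0" using b' by auto
    then have ab: "a * b' = a' * b" using W W' by (simp add: Fraction_Field.eq_fract)
    have "poly2_eval a' ?x ?y * poly2_eval den_t2 ?x ?y = poly2_eval num_t2 ?x ?y * poly2_eval b' ?x ?y"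
      using e b' d unfolding W' W_t2_eq by (simp add: ratfun_eval_Fract frac_eq_eq)
    then have "poly2_eval (a' * den_t2 - num_t2 * b') ?x ?y = 0" by (simp add: poly2_eval_diff poly2_eval_mult)
    moreover have "(a * den_t2 - num_t2 * b) * b' = (a' * den_t2 - num_t2 * b') * b"
      using ab by (simp add: algebra_simps)
    ultimately have "poly2_eval (a * den_t2 - num_t2 * b) ?x ?y * poly2_eval b' ?x ?y = 0"
      by (metis poly2_eval_mult mult_zero_left)
    then show "poly2_eval (a * den_t2 - num_t2 * b) ?x ?y = 0" using b' by simp
  qed
  then show ?thesis unfolding W(1) W_t2_eq using W(2) den_t2_nonzero by (simp add: Fraction_Field.eq_fract)
qed

section \<open>The functional equation\<close>

text \<open>At a zero of the numerator \<open>x\<^bsup>10\<^esup> y\<^sup>4 = -1\<close>; eliminating \<open>y\<close> between this and the vanishing of a factor of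
the denominator makes a power of \<open>x\<close> equal to \<open>-1\<close>. So at the points \<open>x = p\<close> numerator and denominator never
cancel, and regularity there means that the denominator does not vanish.\<close>

lemma no_common_zero:
  fixes x y :: complex
  assumes x: "norm x > 1" and num: "1 + x ^ 10 * y ^ 4 = 0"
  shows "(1 - x ^ 8 * y ^ 3) * (1 - x ^ 11 * y ^ 4) * (1 - x ^ 12 * y ^ 5) \<noteq> 0"
proof
  assume 0: "(1 - x ^ 8 * y ^ 3) * (1 - x ^ 11 * y ^ 4) * (1 - x ^ 12 * y ^ 5) = 0"
  have n: "x ^ 10 * y ^ 4 = - 1" using num by (simp add: eq_neg_iff_add_eq_0 add.commute)
  have "norm x ^ 2 > 1" using x by (rule one_less_power) simp
  then have nx: "norm x ^ 2 \<noteq> 1" by (rule less_imp_neq[THEN not_sym])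
  from 0 consider "x ^ 8 * y ^ 3 = 1" | "x ^ 11 * y ^ 4 = 1" | "x ^ 12 * y ^ 5 = 1" by auto
  then show False
  proof cases
    case 1
    have "x ^ 2 * (x ^ 10 * y ^ 4) ^ 3 = (x ^ 8 * y ^ 3) ^ 4"
      by (simp add: power_mult_distrib power_mult[symmetric] power_add[symmetric] mult.assoc[symmetric])
    then have "- (x ^ 2) = 1" unfolding n 1 by simp
    then have "norm (- (x ^ 2)) = norm (1 :: complex)" by (rule arg_cong)
    then show ?thesis using nx by (simp add: norm_power)
  next
    case 2
    have "x * (x ^ 10 * y ^ 4) = x ^ 11 * y ^ 4" by (simp add: eval_nat_numeral)
    then have "- x = 1" unfolding n 2 by simp
    then have "norm (- x) = norm (1 :: complex)" by (rule arg_cong)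
    then show ?thesis using x by simp
  next
    case 3
    have "x ^ 2 * (x ^ 12 * y ^ 5) ^ 4 = (x ^ 10 * y ^ 4) ^ 5"
      by (simp add: power_mult_distrib power_mult[symmetric] power_add[symmetric] mult.assoc[symmetric])
    then have "x ^ 2 = - 1" unfolding n 3 by simp
    then have "norm (x ^ 2) = norm (- 1 :: complex)" by (rule arg_cong)
    then show ?thesis using nx by (simp add: norm_power)
  qed
qed

lemma den_t2_regular:
  assumes p: "prime p" and r: "ratfun_regular W_t2 (of_nat p) y"
  shows "poly2_eval den_t2 (of_nat p) y \<noteq> 0"
proof
  assume 0: "poly2_eval den_t2 (of_nat p) y = 0"
  obtain a b where ab: "W_t2 = Fraction_Field.Fract a b" "poly2_eval b (of_nat p) y \<noteq> 0"
    using r by (auto simp: ratfun_regular_def)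
  then have "b \<noteq> 0" by auto
  then have "num_t2 * b = a * den_t2"
    using ab(1) den_t2_nonzero by (simp add: W_t2_eq Fraction_Field.eq_fract)
  then have "poly2_eval num_t2 (of_nat p) y * poly2_eval b (of_nat p) y = 0"
    using 0 by (metis poly2_eval_mult mult_zero_right)
  then have "1 + of_nat p ^ 10 * y ^ 4 = 0" using ab(2) by (simp add: eval_num_t2)
  moreover have "norm (of_nat p :: complex) > 1" using prime_gt_1_nat[OF p] by simp
  ultimately show False using no_common_zero 0 unfolding eval_den_t2 by blast
qed

lemma functional_equation:
  assumes p: "prime p" and r: "ratfun_regular W_t2 (of_nat p) (of_nat p powr (- s))"
  shows "ratfun_regular W_t2 (inverse (of_nat p)) (of_nat p powr s) \<and>
    ratfun_eval W_t2 (inverse (of_nat p)) (of_nat p powr s) =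
      (- 1) * of_nat p powr (21 - 8 * s) * ratfun_eval W_t2 (of_nat p) (of_nat p powr (- s))"
proof -
  define x y where "x = (of_nat p :: complex)" and "y = (of_nat p powr (- s) :: complex)"
  have x: "x \<noteq> 0" using prime_gt_0_nat[OF p] by (simp add: x_def)
  then have y: "y \<noteq> 0" by (simp add: x_def y_def powr_def)
  have ps: "of_nat p powr s = inverse y" by (simp add: y_def powr_minus)
  have pw: "of_nat p powr (21 - 8 * s) = x ^ 21 * y ^ 8"
  proof -
    have "of_nat p powr (21 - 8 * s) = exp (21 * Ln x) * exp (8 * (- s * Ln x))"
      using x by (simp add: powr_def x_def exp_add[symmetric] algebra_simps)
    also have "exp (21 * Ln x) = x ^ 21" using exp_of_nat_mult[of 21 "Ln x"] x by simp
    also have "exp (8 * (- s * Ln x)) = y ^ 8"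
      using exp_of_nat_mult[of 8 "- s * Ln x"] x by (simp add: y_def powr_def x_def)
    finally show ?thesis .
  qed
  have d: "poly2_eval den_t2 x y \<noteq> 0" using den_t2_regular[OF p r] by (simp add: x_def y_def)
  have inv1: "1 - inverse x ^ i * inverse y ^ j = - (1 - x ^ i * y ^ j) / (x ^ i * y ^ j)" for i j
    using x y by (simp add: field_simps)
  have inv2: "1 + inverse x ^ 10 * inverse y ^ 4 = (1 + x ^ 10 * y ^ 4) / (x ^ 10 * y ^ 4)"
    using x y by (simp add: field_simps)
  have dinv: "poly2_eval den_t2 (inverse x) (inverse y) = - poly2_eval den_t2 x y / (x ^ 31 * y ^ 12)"
  proof -
    have e: "x ^ 31 * y ^ 12 = (x ^ 8 * y ^ 3) * (x ^ 11 * y ^ 4) * (x ^ 12 * y ^ 5)"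
      by (simp add: power_add[symmetric] mult_ac flip: mult.assoc)
    have "(- A / a) * (- B / b) * (- C / c) = - (A * B * C) / (a * b * c)" for A B C a b c :: complex
      by simp
    then show ?thesis unfolding eval_den_t2 inv1 e by blast
  qed
  then have d': "poly2_eval den_t2 (inverse x) (inverse y) \<noteq> 0" using d x y by simp
  have "ratfun_eval W_t2 (inverse x) (inverse y) =
      ((1 + x ^ 10 * y ^ 4) / (x ^ 10 * y ^ 4)) / (- poly2_eval den_t2 x y / (x ^ 31 * y ^ 12))"
    unfolding W_t2_eq ratfun_eval_Fract[OF d'] eval_num_t2 inv2 dinv ..
  also have "\<dots> = - (x ^ 31 * y ^ 12 / (x ^ 10 * y ^ 4)) * ((1 + x ^ 10 * y ^ 4) / poly2_eval den_t2 x y)"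
    by simp
  also have "x ^ 31 * y ^ 12 / (x ^ 10 * y ^ 4) = x ^ 21 * y ^ 8"
  proof -
    have "x ^ 31 * y ^ 12 = (x ^ 21 * y ^ 8) * (x ^ 10 * y ^ 4)"
      by (simp add: power_add[symmetric] mult_ac flip: mult.assoc)
    then show ?thesis using x y by simp
  qed
  also have "(1 + x ^ 10 * y ^ 4) / poly2_eval den_t2 x y = ratfun_eval W_t2 x y"
    unfolding W_t2_eq ratfun_eval_Fract[OF d] eval_num_t2 ..
  finally have "ratfun_eval W_t2 (inverse x) (inverse y) = (- 1) * (x ^ 21 * y ^ 8) * ratfun_eval W_t2 x y"
    by simp
  moreover have "ratfun_regular W_t2 (inverse x) (inverse y)"
    unfolding ratfun_regular_def W_t2_eq using d' by blast
  ultimately show ?thesis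
    unfolding ps pw unfolding y_def[symmetric] unfolding x_def[symmetric] by blast
qed

theorem theorem1p1:
  shows "(\<forall>p. prime p \<longrightarrow> local_zeta_given_by Gamma_t2 p W_t2) \<and>
    (\<forall>p. prime p \<longrightarrow> local_zeta_abscissa Gamma_t2 p = ereal (11 / 4)) \<and>
    (\<forall>W. (\<forall>p. prime p \<longrightarrow> local_zeta_given_by Gamma_t2 p W) \<longrightarrow>
      (\<forall>p s. prime p \<longrightarrow>
        ratfun_regular W (of_nat p) (of_nat p powr (- s)) \<longrightarrow>
          ratfun_regular W (inverse (of_nat p)) (of_nat p powr s) \<and>
          ratfun_eval W (inverse (of_nat p)) (of_nat p powr s) =
            (- 1) * of_nat p powr (21 - 8 * s) *
            ratfun_eval W (of_nat p) (of_nat p powr (- s))))"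
proof (intro conjI[of "\<forall>p. prime p \<longrightarrow> local_zeta_given_by Gamma_t2 p W_t2"]
    conjI[of "\<forall>p. prime p \<longrightarrow> local_zeta_abscissa Gamma_t2 p = ereal (11 / 4)"] allI impI)
  show "local_zeta_given_by Gamma_t2 p W_t2" if "prime p" for p
    by (rule Gamma_local_zeta_given_by[OF that])
  show "local_zeta_abscissa Gamma_t2 p = ereal (11 / 4)" if "prime p" for p
    by (rule local_zeta_abscissa_Gamma[OF that])
  fix W p and s :: complex
  assume W: "\<forall>p. prime p \<longrightarrow> local_zeta_given_by Gamma_t2 p W" and p: "prime p"
    and r: "ratfun_regular W (of_nat p) (of_nat p powr (- s))"
  show "ratfun_regular W (inverse (of_nat p)) (of_nat p powr s) \<and>
      ratfun_eval W (inverse (of_nat p)) (of_nat p powr s) =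
        (- 1) * of_nat p powr (21 - 8 * s) *
        ratfun_eval W (of_nat p) (of_nat p powr (- s))"
    using functional_equation[OF p] r unfolding rational_function_unique[OF W] .
qed

end
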